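(* Let $G$ be a locally compact group, let $A$ be a $C^{*}$-algebra, let $X$ be a full Hilbert $A$-module, and let $t\mapsto\eta_t$ be a continuous action of $G$ on $X$. Let $H,K$ be Hilbert spaces, let $t\mapsto u_t$ and $t\mapsto u'_t$ be unitary representations of $G$ on $H$ and $K$ respectively, and let $\Phi:X\to L(H,K)$ be a completely positive map which is $(u',u)$-covariant with respect to $(G,\eta,X)$, i.e. $\Phi(\eta_t(x))=u'_t\,\Phi(x)\,u_t^{*}$ for all $x\in X$, $t\in G$. Let $\varphi:A\to L(H)$ be the completely positive map associated to $\Phi$. Then there is a completely positive map $\widehat\Phi:G\times_\eta X\to L(H,K)$ such that $$\widehat\Phi(\widehat x)=\int_G\Phi(\widehat x(t))\,u_t\,dt\qquad\text{for all }\widehat x\in C(G,X).$$ Moreover, the completely positive map associated to $\widehat\Phi$ is the map $\widehat\varphi:G\times_{\alpha^\eta}A\to L(H)$ such that $$\widehat\varphi(f)=\int_G\varphi(f(t))\,u_t\,dt\qquad\text{for all }f\in C(G,A).$$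
   Context: $L(H,K)$ is the space of bounded linear operators between Hilbert spaces $H$ and $K$, $L(H)=L(H,H)$. A Hilbert $A$-module $X$ is a right $A$-module with an $A$-valued inner product $\langle\cdot,\cdot\rangle$, linear over $\mathbb C$ and $A$ in the second variable and conjugate linear in the first, complete for the norm $\|x\|=\|\langle x,x\rangle\|^{1/2}$. It is full if the closed two-sided ideal of $A$ generated by $\{\langle x,y\rangle:x,y\in X\}$ equals $A$. A map $\Phi:X\to L(H,K)$ on a Hilbert module $X$ over a $C^{*}$-algebra $A$ is called completely positive if there is a completely positive linear map $\varphi:A\to L(H)$ with $\Phi(x)^{*}\Phi(y)=\varphi(\langle x,y\rangle)$ for all $x,y\in X$; such a $\varphi$ is said to be associated to $\Phi$, and it is unique if $X$ is full. A morphism of Hilbert $C^{*}$-modules from a Hilbert $A$-module $X$ to a Hilbert $B$-module $Y$ is a map $\Psi:X\to Y$ for which there is a $*$-homomorphism $\psi:A\to B$ with $\langle\Psi(x),\Psi(y)\rangle=\psi(\langle x,y\rangle)$ for all $x,y\in X$; it is an isomorphism if it is invertible and both $\Psi$ and $\Psi^{-1}$ are morphisms. $\mathrm{Aut}(X)$ is the group of isomorphisms of Hilbert $C^{*}$-modules from $X$ to $X$. A continuous action of $G$ on a full Hilbert $A$-module $X$ is a group homomorphism $t\mapsto\eta_t$ from $G$ to $\mathrm{Aut}(X)$ such that $(t,x)\mapsto\eta_t(x)$ is continuous from $G\times X$ to $X$. Such an action induces a unique continuous action $t\mapsto\alpha^\eta_t$ of $G$ on $A$ by $*$-automorphisms with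 $\alpha^\eta_t(\langle x,y\rangle)=\langle\eta_t(x),\eta_t(y)\rangle$ for all $x,y\in X$, $t\in G$. Unitary representations of $G$ are understood to be strongly continuous. $dt$ is a left Haar measure on $G$ and $\Delta$ is the modular function. $C(G,A)$ and $C(G,X)$ denote the continuous compactly supported functions from $G$ to $A$ and to $X$. $G\times_{\alpha^\eta}A$ is the (full) $C^{*}$-crossed product, the completion in the universal norm of the $*$-algebra $C(G,A)$ with product $(f*g)(s)=\int_G f(t)\alpha^\eta_t(g(t^{-1}s))\,dt$ and involution $f^{*}(s)=\Delta(s)^{-1}\alpha^\eta_s(f(s^{-1})^{*})$. The crossed product $G\times_\eta X$ is the Hilbert $G\times_{\alpha^\eta}A$-module obtained by completing $C(G,X)$, a pre-Hilbert module with action and inner product determined by $$(\widehat x f)(s)=\int_G\widehat x(t)\,\alpha^\eta_t(f(t^{-1}s))\,dt,\qquad \langle\widehat x,\widehat y\rangle(s)=\int_G\alpha^\eta_{t^{-1}}(\langle\widehat x(t),\widehat y(ts)\rangle)\,dt$$ for $\widehat x,\widehat y\in C(G,X)$, $f\in C(G,A)$. Operator-valued integrals are taken in the strong sense (pointwise on vectors). *)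

theory Defs
  imports "HOL-Analysis.Analysis"
begin

section \<open>Complex normed spaces and Hilbert spaces\<close>

class complex_vector = real_vector +
  fixes scaleC :: "complex \<Rightarrow> 'a \<Rightarrow> 'a" (infixr \<open>*\<^sub>C\<close> 75)
  assumes scaleC_add_right: "c *\<^sub>C (x + y) = c *\<^sub>C x + c *\<^sub>C y"
    and scaleC_add_left: "(c + d) *\<^sub>C x = c *\<^sub>C x + d *\<^sub>C x"
    and scaleC_scaleC: "c *\<^sub>C d *\<^sub>C x = (c * d) *\<^sub>C x"
    and scaleR_scaleC: "r *\<^sub>R x = complex_of_real r *\<^sub>C x"

class complex_normed_vector = complex_vector + real_normed_vector +
  assumes norm_scaleC: "norm (c *\<^sub>C x) = cmod c * norm x"

text \<open>Inner products are conjugate linear in the first variable.\<close>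

class chilbert_space = complex_normed_vector + complete_space +
  fixes cinner :: "'a \<Rightarrow> 'a \<Rightarrow> complex"
  assumes cinner_commute: "cinner x y = cnj (cinner y x)"
    and cinner_add_right: "cinner x (y + z) = cinner x y + cinner x z"
    and cinner_scaleC_right: "cinner x (c *\<^sub>C y) = c * cinner x y"
    and cinner_self: "cinner x x = complex_of_real ((norm x)\<^sup>2)"

text \<open>\<open>bounded_clinear T\<close> says that \<open>T\<close> belongs to $L(H,K)$; operators are plain functions.\<close>

definition bounded_clinear :: "('h::complex_normed_vector \<Rightarrow> 'k::complex_normed_vector) \<Rightarrow> bool"
  where "bounded_clinear T \<longleftrightarrow> bounded_linear T \<and> (\<forall>c x. T (c *\<^sub>C x) = c *\<^sub>C T x)"

definition adjoint_op :: "('h::chilbert_space \<Rightarrow> 'k::chilbert_space) \<Rightarrow> 'k \<Rightarrow> 'h"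
  where "adjoint_op T = (THE S. \<forall>x y. cinner (S x) y = cinner x (T y))"

definition unitary_op :: "('h::chilbert_space \<Rightarrow> 'h) \<Rightarrow> bool"
  where "unitary_op U \<longleftrightarrow>
    bounded_clinear U \<and> adjoint_op U \<circ> U = id \<and> U \<circ> adjoint_op U = id"


section \<open>C*-algebras and completely positive maps\<close>

class cstar_algebra = complex_normed_vector + real_normed_algebra + complete_space +
  fixes star :: "'a \<Rightarrow> 'a"
  assumes scaleC_mult_left: "(c *\<^sub>C a) * b = c *\<^sub>C (a * b)"
    and scaleC_mult_right: "a * (c *\<^sub>C b) = c *\<^sub>C (a * b)"
    and star_star: "star (star a) = a"
    and star_add: "star (a + b) = star a + star b"
    and star_scaleC: "star (c *\<^sub>C a) = cnj c *\<^sub>C star a"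
    and star_mult: "star (a * b) = star b * star a"
    and cstar_identity: "norm (star a * a) = (norm a)\<^sup>2"

definition star_homomorphism :: "('a::cstar_algebra \<Rightarrow> 'b::cstar_algebra) \<Rightarrow> bool"
  where "star_homomorphism \<psi> \<longleftrightarrow>
    (\<forall>a b. \<psi> (a + b) = \<psi> a + \<psi> b) \<and> (\<forall>c a. \<psi> (c *\<^sub>C a) = c *\<^sub>C \<psi> a) \<and>
    (\<forall>a b. \<psi> (a * b) = \<psi> a * \<psi> b) \<and> (\<forall>a. \<psi> (star a) = star (\<psi> a))"

definition positive_element :: "'a::cstar_algebra \<Rightarrow> bool"
  where "positive_element a \<longleftrightarrow> (\<exists>b. a = star b * b)"

text \<open>An $n \times n$ matrix is a function of two indices, of which only the values below \<open>n\<close>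
  matter. The first predicate says that $M$ has the form $B^{*}B$ in $M_n(A)$; the second one is
  positivity of an operator matrix as an operator on $H^n$.\<close>

definition positive_matrix :: "nat \<Rightarrow> (nat \<Rightarrow> nat \<Rightarrow> 'a::cstar_algebra) \<Rightarrow> bool"
  where "positive_matrix n M \<longleftrightarrow>
    (\<exists>B. \<forall>i<n. \<forall>j<n. M i j = (\<Sum>k<n. star (B k i) * B k j))"

definition positive_op_matrix :: "nat \<Rightarrow> (nat \<Rightarrow> nat \<Rightarrow> 'h::chilbert_space \<Rightarrow> 'h) \<Rightarrow> bool"
  where "positive_op_matrix n T \<longleftrightarrow>
    (\<forall>h. (\<Sum>i<n. \<Sum>j<n. cinner (h i) (T i j (h j))) \<in> \<real>\<^sub>\<ge>\<^sub>0)"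

definition completely_positive :: "('a::cstar_algebra \<Rightarrow> 'h::chilbert_space \<Rightarrow> 'h) \<Rightarrow> bool"
  where "completely_positive \<phi> \<longleftrightarrow>
    (\<forall>a. bounded_clinear (\<phi> a)) \<and>
    (\<forall>a b h. \<phi> (a + b) h = \<phi> a h + \<phi> b h) \<and> (\<forall>c a h. \<phi> (c *\<^sub>C a) h = c *\<^sub>C \<phi> a h) \<and>
    (\<forall>n M. positive_matrix n M \<longrightarrow> positive_op_matrix n (\<lambda>i j. \<phi> (M i j)))"


section \<open>Hilbert modules\<close>

locale hilbert_module =
  fixes act :: "'x::{complex_normed_vector, complete_space} \<Rightarrow> 'a::cstar_algebra \<Rightarrow> 'x"
    and ip :: "'x \<Rightarrow> 'x \<Rightarrow> 'a"
  assumes act_add_left: "act (x + y) a = act x a + act y a"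
    and act_add_right: "act x (a + b) = act x a + act x b"
    and act_mult: "act x (a * b) = act (act x a) b"
    and act_scaleC_left: "act (c *\<^sub>C x) a = c *\<^sub>C act x a"
    and act_scaleC_right: "act x (c *\<^sub>C a) = c *\<^sub>C act x a"
    and ip_add_right: "ip x (y + z) = ip x y + ip x z"
    and ip_scaleC_right: "ip x (c *\<^sub>C y) = c *\<^sub>C ip x y"
    and ip_act_right: "ip x (act y a) = ip x y * a"
    and ip_star: "star (ip x y) = ip y x"
    and ip_positive: "positive_element (ip x x)"
    and norm_ip: "norm x = sqrt (norm (ip x x))"

definition closed_two_sided_ideal :: "'a::cstar_algebra set \<Rightarrow> bool"
  where "closed_two_sided_ideal I \<longleftrightarrow>
    closed I \<and> 0 \<in> I \<and> (\<forall>a\<in>I. \<forall>b\<in>I. a + b \<in> I) \<and> (\<forall>c. \<forall>a\<in>I. c *\<^sub>C a \<in> I) \<and>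
    (\<forall>a\<in>I. \<forall>b. a * b \<in> I \<and> b * a \<in> I)"

definition full_module :: "('x \<Rightarrow> 'x \<Rightarrow> 'a::cstar_algebra) \<Rightarrow> bool"
  where "full_module ip \<longleftrightarrow>
    \<Inter>{I. closed_two_sided_ideal I \<and> (\<forall>x y. ip x y \<in> I)} = UNIV"

definition associated_cp ::
    "('x \<Rightarrow> 'x \<Rightarrow> 'a::cstar_algebra) \<Rightarrow> ('x \<Rightarrow> 'h::chilbert_space \<Rightarrow> 'k::chilbert_space)
      \<Rightarrow> ('a \<Rightarrow> 'h \<Rightarrow> 'h) \<Rightarrow> bool"
  where "associated_cp ip \<Phi> \<phi> \<longleftrightarrow>
    completely_positive \<phi> \<and> (\<forall>x y. adjoint_op (\<Phi> x) \<circ> \<Phi> y = \<phi> (ip x y))"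

definition completely_positive_module_map ::
    "('x \<Rightarrow> 'x \<Rightarrow> 'a::cstar_algebra) \<Rightarrow> ('x \<Rightarrow> 'h::chilbert_space \<Rightarrow> 'k::chilbert_space) \<Rightarrow> bool"
  where "completely_positive_module_map ip \<Phi> \<longleftrightarrow>
    (\<forall>x. bounded_clinear (\<Phi> x)) \<and> (\<exists>\<phi>. associated_cp ip \<Phi> \<phi>)"

definition module_morphism ::
    "('x \<Rightarrow> 'x \<Rightarrow> 'a::cstar_algebra) \<Rightarrow> ('y \<Rightarrow> 'y \<Rightarrow> 'b::cstar_algebra) \<Rightarrow> ('x \<Rightarrow> 'y) \<Rightarrow> bool"
  where "module_morphism ipX ipY \<Psi> \<longleftrightarrow>
    (\<exists>\<psi>. star_homomorphism \<psi> \<and> (\<forall>x y. ipY (\<Psi> x) (\<Psi> y) = \<psi> (ipX x y)))"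

definition module_automorphism :: "('x \<Rightarrow> 'x \<Rightarrow> 'a::cstar_algebra) \<Rightarrow> ('x \<Rightarrow> 'x) \<Rightarrow> bool"
  where "module_automorphism ip \<Psi> \<longleftrightarrow>
    bij \<Psi> \<and> module_morphism ip ip \<Psi> \<and> module_morphism ip ip (inv \<Psi>)"


section \<open>Actions and representations of locally compact groups\<close>

text \<open>Groups are written additively, as in \<^class>\<open>topological_group_add\<close>, which does not
  assume commutativity: $st$ is \<open>s + t\<close> and $t^{-1}s$ is \<open>- t + s\<close>.\<close>

definition module_action ::
    "('x::topological_space \<Rightarrow> 'x \<Rightarrow> 'a::cstar_algebra)
      \<Rightarrow> ('g::topological_group_add \<Rightarrow> 'x \<Rightarrow> 'x) \<Rightarrow> bool"
  where "module_action ip \<eta> \<longleftrightarrow>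
    (\<forall>t. module_automorphism ip (\<eta> t)) \<and> (\<forall>s t. \<eta> (s + t) = \<eta> s \<circ> \<eta> t) \<and>
    continuous_on UNIV (\<lambda>(t, x). \<eta> t x)"

definition algebra_action :: "('g::topological_group_add \<Rightarrow> 'a::cstar_algebra \<Rightarrow> 'a) \<Rightarrow> bool"
  where "algebra_action \<alpha> \<longleftrightarrow>
    (\<forall>t. star_homomorphism (\<alpha> t) \<and> bij (\<alpha> t)) \<and> (\<forall>s t. \<alpha> (s + t) = \<alpha> s \<circ> \<alpha> t) \<and>
    continuous_on UNIV (\<lambda>(t, a). \<alpha> t a)"

definition induced_action ::
    "('x \<Rightarrow> 'x \<Rightarrow> 'a::cstar_algebra) \<Rightarrow> ('g::topological_group_add \<Rightarrow> 'x \<Rightarrow> 'x)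
      \<Rightarrow> ('g \<Rightarrow> 'a \<Rightarrow> 'a) \<Rightarrow> bool"
  where "induced_action ip \<eta> \<alpha> \<longleftrightarrow>
    algebra_action \<alpha> \<and> (\<forall>t x y. \<alpha> t (ip x y) = ip (\<eta> t x) (\<eta> t y))"

definition unitary_representation :: "('g::topological_group_add \<Rightarrow> 'h::chilbert_space \<Rightarrow> 'h) \<Rightarrow> bool"
  where "unitary_representation u \<longleftrightarrow>
    (\<forall>t. unitary_op (u t)) \<and> (\<forall>s t. u (s + t) = u s \<circ> u t) \<and>
    (\<forall>h. continuous_on UNIV (\<lambda>t. u t h))"

definition covariant_map ::
    "('g::topological_group_add \<Rightarrow> 'k::chilbert_space \<Rightarrow> 'k) \<Rightarrow> ('g \<Rightarrow> 'h::chilbert_space \<Rightarrow> 'h)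
      \<Rightarrow> ('g \<Rightarrow> 'x \<Rightarrow> 'x) \<Rightarrow> ('x \<Rightarrow> 'h \<Rightarrow> 'k) \<Rightarrow> bool"
  where "covariant_map u' u \<eta> \<Phi> \<longleftrightarrow>
    (\<forall>x t. \<Phi> (\<eta> t x) = u' t \<circ> \<Phi> x \<circ> adjoint_op (u t))"


section \<open>Haar measure and vector-valued integrals\<close>

text \<open>Regularity is that of a Radon measure (outer on Borel sets, inner on open sets), so that
  groups that are not sigma-compact are covered.\<close>

definition left_haar_measure :: "'g::{topological_group_add, t2_space} measure \<Rightarrow> bool"
  where "left_haar_measure \<mu> \<longleftrightarrow>
    sets \<mu> = sets borel \<and> emeasure \<mu> UNIV \<noteq> 0 \<and>
    (\<forall>C. compact C \<longrightarrow> emeasure \<mu> C < \<infinity>) \<and>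
    (\<forall>E\<in>sets borel. emeasure \<mu> E = (INF U\<in>{U. open U \<and> E \<subseteq> U}. emeasure \<mu> U)) \<and>
    (\<forall>U. open U \<longrightarrow>
      emeasure \<mu> U = (SUP C\<in>{C. compact C \<and> C \<subseteq> U}. emeasure \<mu> C)) \<and>
    (\<forall>E\<in>sets borel. \<forall>t. emeasure \<mu> ((\<lambda>s. t + s) ` E) = emeasure \<mu> E)"

definition modular_function :: "'g::topological_group_add measure \<Rightarrow> 'g \<Rightarrow> real"
  where "modular_function \<mu> s =
    (THE d. 0 < d \<and>
      (\<forall>E\<in>sets borel. emeasure \<mu> ((\<lambda>r. r + s) ` E) = ennreal d * emeasure \<mu> E))"

text \<open>The Bochner integral. The definition is that of \<^const>\<open>has_bochner_integral\<close>, which cannot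
  be used itself because it requires the target space to be second countable.\<close>

definition has_vector_integral ::
    "'g measure \<Rightarrow> ('g \<Rightarrow> 'b::real_normed_vector) \<Rightarrow> 'b \<Rightarrow> bool"
  where "has_vector_integral \<mu> F v \<longleftrightarrow>
    F \<in> borel_measurable \<mu> \<and>
    (\<exists>S. (\<forall>i. Bochner_Integration.simple_bochner_integrable \<mu> (S i)) \<and>
      (\<lambda>i. \<integral>\<^sup>+ t. ennreal (norm (F t - S i t)) \<partial>\<mu>) \<longlonglongrightarrow> 0 \<and>
      (\<lambda>i. Bochner_Integration.simple_bochner_integral \<mu> (S i)) \<longlonglongrightarrow> v)"

definition vector_integral :: "'g measure \<Rightarrow> ('g \<Rightarrow> 'b::real_normed_vector) \<Rightarrow> 'b"
  where "vector_integral \<mu> F = (THE v. has_vector_integral \<mu> F v)"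

text \<open>Operator-valued integrals in the strong sense; existence of the integral is part of the
  assertion.\<close>

definition has_strong_integral ::
    "'g measure \<Rightarrow> ('g \<Rightarrow> 'h \<Rightarrow> 'k::real_normed_vector) \<Rightarrow> ('h \<Rightarrow> 'k) \<Rightarrow> bool"
  where "has_strong_integral \<mu> T S \<longleftrightarrow> (\<forall>h. has_vector_integral \<mu> (\<lambda>t. T t h) (S h))"


section \<open>Crossed products\<close>

definition Cc :: "('g::topological_space \<Rightarrow> 'b::real_normed_vector) set"
  where "Cc = {f. continuous_on UNIV f \<and> compact (closure {t. f t \<noteq> 0})}"

definition convolution ::
    "'g::topological_group_add measure \<Rightarrow> ('g \<Rightarrow> 'a::cstar_algebra \<Rightarrow> 'a)
      \<Rightarrow> ('g \<Rightarrow> 'a) \<Rightarrow> ('g \<Rightarrow> 'a) \<Rightarrow> 'g \<Rightarrow> 'a"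
  where "convolution \<mu> \<alpha> f g = (\<lambda>s. vector_integral \<mu> (\<lambda>t. f t * \<alpha> t (g (- t + s))))"

definition involution ::
    "'g::topological_group_add measure \<Rightarrow> ('g \<Rightarrow> 'a::cstar_algebra \<Rightarrow> 'a) \<Rightarrow> ('g \<Rightarrow> 'a) \<Rightarrow> 'g \<Rightarrow> 'a"
  where "involution \<mu> \<alpha> f = (\<lambda>s. inverse (modular_function \<mu> s) *\<^sub>R \<alpha> s (star (f (- s))))"

definition L1_norm :: "'g measure \<Rightarrow> ('g \<Rightarrow> 'a::real_normed_vector) \<Rightarrow> real"
  where "L1_norm \<mu> f = (\<integral>t. norm (f t) \<partial>\<mu>)"

definition cstar_seminorm ::
    "'g::topological_group_add measure \<Rightarrow> ('g \<Rightarrow> 'a::cstar_algebra \<Rightarrow> 'a)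
      \<Rightarrow> (('g \<Rightarrow> 'a) \<Rightarrow> real) \<Rightarrow> bool"
  where "cstar_seminorm \<mu> \<alpha> p \<longleftrightarrow>
    (\<forall>f\<in>Cc. 0 \<le> p f) \<and>
    (\<forall>f\<in>Cc. \<forall>g\<in>Cc. p (\<lambda>t. f t + g t) \<le> p f + p g) \<and>
    (\<forall>c. \<forall>f\<in>Cc. p (\<lambda>t. c *\<^sub>C f t) = cmod c * p f) \<and>
    (\<forall>f\<in>Cc. \<forall>g\<in>Cc. p (convolution \<mu> \<alpha> f g) \<le> p f * p g) \<and>
    (\<forall>f\<in>Cc. p (involution \<mu> \<alpha> f) = p f) \<and>
    (\<forall>f\<in>Cc. p (convolution \<mu> \<alpha> (involution \<mu> \<alpha> f) f) = (p f)\<^sup>2)"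

text \<open>The universal norm is the supremum of all C*-seminorms on $C(G,A)$ dominated by the
  $L^1$-norm, that is of the seminorms $f \mapsto \|\pi(f)\|$ for the $L^1$-contractive
  *-homomorphisms $\pi$ into C*-algebras (equivalently, *-representations on Hilbert spaces, or
  integrated forms of covariant representations). Seminorms are used because one cannot quantify
  over Hilbert spaces of all types inside a definition.\<close>

definition universal_norm ::
    "'g::topological_group_add measure \<Rightarrow> ('g \<Rightarrow> 'a::cstar_algebra \<Rightarrow> 'a) \<Rightarrow> ('g \<Rightarrow> 'a) \<Rightarrow> real"
  where "universal_norm \<mu> \<alpha> f =
    (SUP p\<in>{p. cstar_seminorm \<mu> \<alpha> p \<and> (\<forall>g\<in>Cc. p g \<le> L1_norm \<mu> g)}. p f)"

text \<open>The completions are presented as types \<open>'c\<close> and \<open>'y\<close> with canonical maps \<open>\<iota>\<close> and \<open>\<kappa>\<close> of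
  $C(G,A)$ and $C(G,X)$ onto dense subspaces. That \<open>\<kappa>\<close> is isometric is implied by
  \<open>norm_ip\<close> and the formula for the inner product.\<close>

definition crossed_product_algebra ::
    "'g::topological_group_add measure \<Rightarrow> ('g \<Rightarrow> 'a::cstar_algebra \<Rightarrow> 'a)
      \<Rightarrow> (('g \<Rightarrow> 'a) \<Rightarrow> 'c::cstar_algebra) \<Rightarrow> bool"
  where "crossed_product_algebra \<mu> \<alpha> \<iota> \<longleftrightarrow>
    (\<forall>f\<in>Cc. \<forall>g\<in>Cc. \<iota> (\<lambda>t. f t + g t) = \<iota> f + \<iota> g) \<and>
    (\<forall>c. \<forall>f\<in>Cc. \<iota> (\<lambda>t. c *\<^sub>C f t) = c *\<^sub>C \<iota> f) \<and>
    (\<forall>f\<in>Cc. \<forall>g\<in>Cc. \<iota> (convolution \<mu> \<alpha> f g) = \<iota> f * \<iota> g) \<and>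
    (\<forall>f\<in>Cc. \<iota> (involution \<mu> \<alpha> f) = star (\<iota> f)) \<and>
    (\<forall>f\<in>Cc. norm (\<iota> f) = universal_norm \<mu> \<alpha> f) \<and>
    closure (\<iota> ` Cc) = UNIV"

definition crossed_product_act ::
    "'g::topological_group_add measure \<Rightarrow> ('g \<Rightarrow> 'a::cstar_algebra \<Rightarrow> 'a)
      \<Rightarrow> ('x::real_normed_vector \<Rightarrow> 'a \<Rightarrow> 'x) \<Rightarrow> ('g \<Rightarrow> 'x) \<Rightarrow> ('g \<Rightarrow> 'a) \<Rightarrow> 'g \<Rightarrow> 'x"
  where "crossed_product_act \<mu> \<alpha> act x f =
    (\<lambda>s. vector_integral \<mu> (\<lambda>t. act (x t) (\<alpha> t (f (- t + s)))))"

definition crossed_product_ip ::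
    "'g::topological_group_add measure \<Rightarrow> ('g \<Rightarrow> 'a::cstar_algebra \<Rightarrow> 'a)
      \<Rightarrow> ('x \<Rightarrow> 'x \<Rightarrow> 'a) \<Rightarrow> ('g \<Rightarrow> 'x) \<Rightarrow> ('g \<Rightarrow> 'x) \<Rightarrow> 'g \<Rightarrow> 'a"
  where "crossed_product_ip \<mu> \<alpha> ip x y =
    (\<lambda>s. vector_integral \<mu> (\<lambda>t. \<alpha> (- t) (ip (x t) (y (t + s)))))"

definition crossed_product_module ::
    "'g::topological_group_add measure \<Rightarrow> ('g \<Rightarrow> 'a::cstar_algebra \<Rightarrow> 'a)
      \<Rightarrow> ('x::complex_normed_vector \<Rightarrow> 'a \<Rightarrow> 'x) \<Rightarrow> ('x \<Rightarrow> 'x \<Rightarrow> 'a)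
      \<Rightarrow> (('g \<Rightarrow> 'a) \<Rightarrow> 'c::cstar_algebra)
      \<Rightarrow> ('y::{complex_normed_vector, complete_space} \<Rightarrow> 'c \<Rightarrow> 'y) \<Rightarrow> ('y \<Rightarrow> 'y \<Rightarrow> 'c)
      \<Rightarrow> (('g \<Rightarrow> 'x) \<Rightarrow> 'y) \<Rightarrow> bool"
  where "crossed_product_module \<mu> \<alpha> act ip \<iota> actY ipY \<kappa> \<longleftrightarrow>
    hilbert_module actY ipY \<and>
    (\<forall>x\<in>Cc. \<forall>y\<in>Cc. \<kappa> (\<lambda>t. x t + y t) = \<kappa> x + \<kappa> y) \<and>
    (\<forall>c. \<forall>x\<in>Cc. \<kappa> (\<lambda>t. c *\<^sub>C x t) = c *\<^sub>C \<kappa> x) \<and>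
    (\<forall>x\<in>Cc. \<forall>f\<in>Cc. \<kappa> (crossed_product_act \<mu> \<alpha> act x f) = actY (\<kappa> x) (\<iota> f)) \<and>
    (\<forall>x\<in>Cc. \<forall>y\<in>Cc. ipY (\<kappa> x) (\<kappa> y) = \<iota> (crossed_product_ip \<mu> \<alpha> ip x y)) \<and>
    closure (\<kappa> ` Cc) = UNIV"

end

theory Submission
  imports Defs
begin

text \<open>The form \<open>\<langle>b \<otimes> h, c \<otimes> k\<rangle> = \<langle>h, \<phi>(b\<^sup>*c) k\<rangle>\<close> on \<open>A \<otimes> H\<close> carries the covariant representation
  \<open>\<pi>(a) (b \<otimes> h) = ab \<otimes> h\<close>, \<open>v\<^sub>t (b \<otimes> h) = \<alpha>\<^sub>t(b) \<otimes> u\<^sub>t h\<close>. The norm of its integrated form is a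
  C*-seminorm on $C(G,A)$ below the $L^1$-norm, hence below the universal norm, and it dominates
  \<open>\<phi>'(f) = \<integral> \<phi>(f(t)) u\<^sub>t dt\<close> up to a constant, because \<open>\<phi>'\<close> is a compression of the integrated form.
  Therefore \<open>\<phi>'\<close> extends to the crossed product, and \<open>\<Phi>'(x)\<^sup>*\<Phi>'(y) = \<phi>'(\<langle>x,y\<rangle>)\<close> gives the extension of
  \<open>\<Phi>'(x) = \<integral> \<Phi>(x(t)) u\<^sub>t dt\<close>. Any map associated to it is bounded and is determined on the inner
  products, which span a dense subspace.

  Boundedness of completely positive maps, contractivity of \<open>\<pi>\<close> and approximate units only need
  square roots obtained by a contraction argument, not spectral theory or the order of \<open>A\<close>. Limits of
  Riemann sums in \<open>A \<otimes> H\<close> replace integrals in its completion. The modular function and the inversion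
  formula for Haar measure come from the single exchange of integrals
  \<open>\<integral> f \<integral> g = \<integral> g(s\<^sup>-\<^sup>1) (\<integral> f(ts) dt) ds\<close>.\<close>

text \<open>The map taking f to \<integral> \<phi>(f(t)) u_t dt is not multiplicative, so its norm
  need not be a C*-seminorm and cannot be compared with the universal norm directly. This is why a
  dilation has to be built: only there do convolution and involution become product and adjoint. The
  universal norm is a supremum of seminorms on functions, so the dilation has to supply a seminorm
  on \<open>Cc\<close> and nothing more; it therefore enters only through matrix coefficients, which
  are complex integrals.

  Two features of the setting shape the rest. The algebra may lack a unit, so 1 - e is only ever
  seen as the map taking b to b - e b, and norm estimates are estimates of multipliers. The group
  may be neither second countable nor sigma-compact, so sums of Borel functions into a Banach space
  can fail to be measurable and product measures are out of reach. Every exchange of integrals rests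
  instead on uniform approximation over a compact square.\<close>

section \<open>Complex scalars and bounded operators\<close>

lemma scaleC_one [simp]: "(1::complex) *\<^sub>C (x::'a::complex_vector) = x"
  using scaleR_scaleC[of 1 x] by simp

lemma scaleC_zero_left [simp]: "(0::complex) *\<^sub>C (x::'a::complex_vector) = 0"
  using scaleR_scaleC[of 0 x] by simp

lemma scaleC_zero_right [simp]: "c *\<^sub>C (0::'a::complex_vector) = 0"
  using scaleC_add_right[of c 0 "0::'a"] by simp

lemma scaleC_minus_right [simp]: "c *\<^sub>C (- x) = - (c *\<^sub>C (x::'a::complex_vector))"
  using scaleC_add_right[of c x "-x"] by (simp add: eq_neg_iff_add_eq_0 add.commute)

lemma scaleC_minus_left [simp]: "(- c) *\<^sub>C x = - (c *\<^sub>C (x::'a::complex_vector))"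
  using scaleC_add_left[of c "-c" x] by (simp add: eq_neg_iff_add_eq_0 add.commute)

lemma scaleC_diff_right: "c *\<^sub>C (x - y) = c *\<^sub>C x - c *\<^sub>C (y::'a::complex_vector)"
  using scaleC_add_right[of c x "-y"] by simp

lemma scaleC_scaleR: "c *\<^sub>C (r *\<^sub>R x) = r *\<^sub>R (c *\<^sub>C (x::'a::complex_vector))"
  by (simp add: scaleR_scaleC scaleC_scaleC mult.commute)

lemma bounded_bilinear_scaleC:
  "bounded_bilinear (scaleC :: complex \<Rightarrow> 'a::complex_normed_vector \<Rightarrow> 'a)"
  by (rule bounded_bilinear.intro)
     (auto simp: scaleC_add_left scaleC_add_right scaleC_scaleR norm_scaleC scaleR_scaleC
       scaleC_scaleC scaleR_conv_of_real mult.commute intro: exI[of _ 1])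

lemmas continuous_on_scaleC [continuous_intros] = bounded_bilinear.continuous_on [OF bounded_bilinear_scaleC]
lemmas tendsto_scaleC [tendsto_intros] = bounded_bilinear.tendsto [OF bounded_bilinear_scaleC]

lemma bounded_clinearD:
  assumes "bounded_clinear T"
  shows "bounded_linear T" "T (c *\<^sub>C x) = c *\<^sub>C T x" "T (x + y) = T x + T y" "T (x - y) = T x - T y"
    "T 0 = 0" "T (- x) = - T x" "T (r *\<^sub>R x) = r *\<^sub>R T x"
  using assms linear_simps[of T] unfolding bounded_clinear_def by auto

lemma bounded_clinearI:
  assumes "\<And>x y. T (x + y) = T x + T y" "\<And>c x. T (c *\<^sub>C x) = c *\<^sub>C T x" "\<And>x. norm (T x) \<le> norm x * B"
  shows "bounded_clinear T"
  unfolding bounded_clinear_def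
  using assms by (auto intro!: bounded_linear_intro[of T B] simp: scaleR_scaleC)

section \<open>Hilbert spaces\<close>

lemma cinner_add_left: "cinner (x + y) z = cinner x z + cinner (y::'h::chilbert_space) z"
  by (metis cinner_add_right cinner_commute complex_cnj_add)

lemma cinner_scaleC_left: "cinner (c *\<^sub>C x) y = cnj c * cinner (x::'h::chilbert_space) y"
  by (metis cinner_commute cinner_scaleC_right complex_cnj_mult)

lemma cinner_zero_left [simp]: "cinner 0 (x::'h::chilbert_space) = 0"
  using cinner_add_left[of 0 0 x] by simp

lemma cinner_zero_right [simp]: "cinner (x::'h::chilbert_space) 0 = 0"
  using cinner_add_right[of x 0 0] by simp

lemma cinner_minus_left [simp]: "cinner (- x) (y::'h::chilbert_space) = - cinner x y"
  using cinner_add_left[of x "-x" y] by (simp add: eq_neg_iff_add_eq_0 add.commute)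

lemma cinner_minus_right [simp]: "cinner x (- y::'h::chilbert_space) = - cinner x y"
  using cinner_add_right[of x y "-y"] by (simp add: eq_neg_iff_add_eq_0 add.commute)

lemma cinner_diff_left: "cinner (x - y) z = cinner x z - cinner (y::'h::chilbert_space) z"
  using cinner_add_left[of x "-y" z] by simp

lemma cinner_diff_right: "cinner x (y - z) = cinner x y - cinner x (z::'h::chilbert_space)"
  using cinner_add_right[of x y "-z"] by simp

lemma cinner_sum_right: "cinner y (sum f S) = (\<Sum>i\<in>S. cinner y (f i :: 'h::chilbert_space))"
  by (induction S rule: infinite_finite_induct) (simp_all add: cinner_add_right)

lemma Re_cinner_commute: "Re (cinner y x) = Re (cinner x (y::'h::chilbert_space))"
  by (metis cinner_commute complex_cnj_cnj complex.sel(1) cnj.simps(1))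

lemma norm_add_square:
  "(norm (x + y :: 'h::chilbert_space))\<^sup>2 = (norm x)\<^sup>2 + 2 * Re (cinner x y) + (norm y)\<^sup>2"
proof -
  have "complex_of_real ((norm (x + y))\<^sup>2) = cinner x x + cinner x y + cinner y x + cinner y y"
    unfolding cinner_self[symmetric] by (simp add: cinner_add_left cinner_add_right)
  then have "(norm (x + y))\<^sup>2 = Re (cinner x x + cinner x y + cinner y x + cinner y y)"
    by (metis Re_complex_of_real)
  then show ?thesis by (simp add: cinner_self Re_cinner_commute[of y x] del: of_real_power)
qed

lemma norm_diff_square:
  "(norm (x - y :: 'h::chilbert_space))\<^sup>2 = (norm x)\<^sup>2 - 2 * Re (cinner x y) + (norm y)\<^sup>2"
  using norm_add_square[of x "-y"] by simp

lemma Re_cinner_le: "Re (cinner x y) \<le> norm x * norm (y::'h::chilbert_space)"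
proof -
  have "(norm (x + y))\<^sup>2 \<le> (norm x + norm y)\<^sup>2"
    by (simp add: norm_triangle_ineq power_mono)
  then show ?thesis unfolding norm_add_square by (simp add: power2_sum)
qed

lemma complex_rotate: "\<exists>c. cmod c = 1 \<and> c * z = complex_of_real (cmod z)"
proof (cases "z = 0")
  case False
  then show ?thesis
    by (intro exI[of _ "cnj z / cmod z"])
       (auto simp: norm_divide complex_norm_square[symmetric] mult.commute power2_eq_square)
qed (auto intro: exI[of _ 1])

lemma norm_cinner_le: "cmod (cinner x y) \<le> norm x * norm (y::'h::chilbert_space)"
proof -
  obtain c where c: "cmod c = 1" "c * cinner x y = complex_of_real (cmod (cinner x y))"
    using complex_rotate by blast
  have "cmod (cinner x y) = Re (cinner x (c *\<^sub>C y))" by (simp add: cinner_scaleC_right c)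
  also have "\<dots> \<le> norm x * norm (c *\<^sub>C y)" by (rule Re_cinner_le)
  finally show ?thesis by (simp add: norm_scaleC c)
qed

lemma cinner_scaleR_left: "cinner (r *\<^sub>R x) y = r *\<^sub>R cinner (x::'h::chilbert_space) y"
  by (simp add: scaleR_scaleC cinner_scaleC_left scaleR_conv_of_real)

lemma cinner_scaleR_right: "cinner x (r *\<^sub>R y) = r *\<^sub>R cinner (x::'h::chilbert_space) y"
  by (simp add: scaleR_scaleC cinner_scaleC_right scaleR_conv_of_real)

lemma bounded_bilinear_cinner: "bounded_bilinear (cinner :: 'h::chilbert_space \<Rightarrow> 'h \<Rightarrow> complex)"
  by (rule bounded_bilinear.intro)
     (auto simp: cinner_add_left cinner_add_right cinner_scaleR_left cinner_scaleR_right norm_cinner_le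
       intro: exI[of _ 1])

lemmas continuous_on_cinner [continuous_intros] = bounded_bilinear.continuous_on [OF bounded_bilinear_cinner]
lemmas tendsto_cinner [tendsto_intros] = bounded_bilinear.tendsto [OF bounded_bilinear_cinner]
lemmas bounded_linear_cinner_right = bounded_bilinear.bounded_linear_right [OF bounded_bilinear_cinner]

lemma cinner_extI: "(\<And>z. cinner z x = cinner z y) \<Longrightarrow> x = (y::'h::chilbert_space)"
proof -
  assume *: "\<And>z. cinner z x = cinner z y"
  have "cinner (x - y) (x - y) = 0" by (simp add: cinner_diff_right *)
  then show ?thesis by (simp add: cinner_self del: of_real_power)
qed

lemma norm_le_if_cinner_le:
  assumes "\<And>z. cmod (cinner z x) \<le> B * norm (z::'h::chilbert_space)" "B \<ge> 0"
  shows "norm x \<le> B"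
proof (cases "norm x = 0")
  case False
  have "norm x * norm x \<le> B * norm x"
    using assms(1)[of x] by (simp add: cinner_self norm_mult power2_eq_square)
  then show ?thesis using False by simp
qed (use assms in simp)

text \<open>The representing vector minimises \<open>\<parallel>y\<parallel>\<^sup>2 - 2 Re (f y)\<close>; minimising sequences are Cauchy by
  the parallelogram law.\<close>

lemma riesz:
  fixes f :: "'h::chilbert_space \<Rightarrow> complex"
  assumes f: "bounded_linear f" and fC: "\<And>c x. f (c *\<^sub>C x) = c * f x"
  shows "\<exists>w. \<forall>y. f y = cinner w y"
proof -
  interpret f: bounded_linear f by fact
  obtain B where B: "\<And>x. cmod (f x) \<le> norm x * B" "B > 0" using f.pos_bounded by blast
  define J where "J y = (norm y)\<^sup>2 - 2 * Re (f y)" for y :: 'h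
  \<comment> \<open>Completing the square bounds J below by minus the square of B, so its infimum
    exists.\<close>
  have Jlow: "J y \<ge> - B\<^sup>2" for y
  proof -
    have "Re (f y) \<le> norm y * B" using B(1)[of y] complex_Re_le_cmod[of "f y"] by linarith
    moreover have "0 \<le> (norm y - B)\<^sup>2" by simp
    ultimately show ?thesis unfolding J_def power2_diff by linarith
  qed
  define d where "d = Inf (range J)"
  have bdd: "bdd_below (range J)" using Jlow by (auto intro!: bdd_belowI[of _ "- B\<^sup>2"])
  have d_le: "d \<le> J y" for y unfolding d_def by (rule cInf_lower[OF _ bdd]) simp
  have "\<exists>y. J y < d + 1 / real (Suc n)" for n
    using cInf_lessD[of "range J" "d + 1 / real (Suc n)"] unfolding d_def by auto
  then obtain y where y: "\<And>n. J (y n) < d + 1 / real (Suc n)" by metis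
  \<comment> \<open>Parallelogram law for the quadratic part of J; the linear part cancels. Since J
    at the midpoint is at least d, two almost minimal points are close to each other.\<close>
  have par: "(norm (a - b))\<^sup>2 / 2 = J a + J b - 2 * J ((1/2) *\<^sub>R (a + b))" for a b :: 'h
  proof -
    have "(norm ((1/2) *\<^sub>R (a + b)))\<^sup>2 = (norm (a + b))\<^sup>2 / 4"
      unfolding norm_scaleR power_mult_distrib by (simp add: power2_eq_square)
    moreover have "Re (f ((1/2) *\<^sub>R (a + b))) = (Re (f a) + Re (f b)) / 2"
      unfolding f.scaleR f.add by simp
    ultimately show ?thesis unfolding J_def by (simp add: norm_add_square norm_diff_square)
  qed
  have close: "(norm (y m - y n))\<^sup>2 \<le> 2 / real (Suc m) + 2 / real (Suc n)" for m n
    using par[of "y m" "y n"] y[of m] y[of n] d_le[of "(1/2) *\<^sub>R (y m + y n)"] by simp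
  have "Cauchy y"
  proof (rule metric_CauchyI)
    fix e :: real assume e: "e > 0"
    then have "e\<^sup>2 / 4 > 0" by simp
    then obtain N where N: "inverse (real (Suc N)) < e\<^sup>2 / 4" using reals_Archimedean by blast
    show "\<exists>M. \<forall>m\<ge>M. \<forall>n\<ge>M. dist (y m) (y n) < e"
    proof (intro exI allI impI)
      fix m n assume mn: "m \<ge> N" "n \<ge> N"
      have "1 / real (Suc m) \<le> 1 / real (Suc N)" "1 / real (Suc n) \<le> 1 / real (Suc N)"
        using mn by (auto simp: frac_le)
      then have "(norm (y m - y n))\<^sup>2 < e\<^sup>2"
        using close[of m n] N by (simp add: inverse_eq_divide)
      then show "dist (y m) (y n) < e" using e by (simp add: dist_norm power2_less_imp_less)
    qed
  qed
  then obtain w where w: "y \<longlonglongrightarrow> w" using convergent_eq_Cauchy by blast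
  have "(\<lambda>n. J (y n)) \<longlonglongrightarrow> J w" unfolding J_def by (intro tendsto_intros w f.tendsto)
  moreover have "(\<lambda>n. d + 1 / real (Suc n)) \<longlonglongrightarrow> d + 0"
    by (intro tendsto_intros LIMSEQ_Suc lim_1_over_n)
  ultimately have "J w \<le> d + 0"
    by (rule LIMSEQ_le) (use y less_imp_le in blast)
  then have min: "J w \<le> J z" for z using d_le[of z] by simp
  have Re0: "Re (f z) = Re (cinner w z)" for z
  proof -
    have key: "0 \<le> 2 * r * (Re (cinner w z) - Re (f z)) + r\<^sup>2 * (norm z)\<^sup>2" for r :: real
      using min[of "w + r *\<^sub>R z"] unfolding J_def norm_add_square
      by (simp add: f.add f.scaleR cinner_scaleR_right power_mult_distrib algebra_simps)
    define a where "a = Re (cinner w z) - Re (f z)"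
    \<comment> \<open>The added 1 makes the step r = - a / b meaningful for z = 0 as well.\<close>
    define b where "b = (norm z)\<^sup>2 + 1"
    have b: "b > 0" unfolding b_def by (simp add: add_nonneg_pos)
    have "0 \<le> 2 * (- a / b) * a + (- a / b)\<^sup>2 * (norm z)\<^sup>2" using key[of "- a / b"] unfolding a_def .
    also have "\<dots> \<le> 2 * (- a / b) * a + (- a / b)\<^sup>2 * b" unfolding b_def by (simp add: mult_left_mono)
    also have "\<dots> = - a\<^sup>2 / b" using b by (simp add: power2_eq_square field_simps)
    finally have "a\<^sup>2 \<le> 0" using b by (simp add: field_simps)
    then show ?thesis unfolding a_def by simp
  qed
  have "f z = cinner w z" for z
  proof (rule complex_eqI)
    show "Re (f z) = Re (cinner w z)" by (rule Re0)
    \<comment> \<open>The real part at \<i> z is minus the imaginary part at z, so equality of real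
      parts everywhere is enough.\<close>
    show "Im (f z) = Im (cinner w z)"
      using Re0[of "\<i> *\<^sub>C z"] by (simp add: fC cinner_scaleC_right)
  qed
  then show ?thesis by blast
qed

text \<open>\<open>adjoint_op\<close> is a definite description, so existence and uniqueness are
  both due: Riesz represents one functional for each x, and a vector is determined by its inner
  products.\<close>

lemma adjoint_op:
  assumes T: "bounded_clinear T"
  shows "cinner (adjoint_op T x) y = cinner x (T y)"
proof -
  have "\<exists>w. \<forall>y. cinner x (T y) = cinner w y" for x
    by (rule riesz)
       (auto simp: bounded_clinearD(2)[OF T] cinner_scaleC_right
         intro: bounded_linear_compose[OF bounded_linear_cinner_right bounded_clinearD(1)[OF T], unfolded o_def])
  then obtain S where S: "\<And>x y. cinner (S x) y = cinner x (T y)" by metis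
  have "\<forall>x y. cinner (adjoint_op T x) y = cinner x (T y)"
    unfolding adjoint_op_def
  proof (rule theI[of _ S])
    show "\<forall>x y. cinner (S x) y = cinner x (T y)" using S by blast
    fix S' assume "\<forall>x y. cinner (S' x) y = cinner x (T y)"
    then have "cinner z (S' x) = cinner z (S x)" for z x by (metis S cinner_commute)
    then show "S' = S" using cinner_extI by blast
  qed
  then show ?thesis by blast
qed

lemma adjoint_op_eqI:
  assumes T: "bounded_clinear T" and "\<And>y. cinner z y = cinner x (T y)"
  shows "adjoint_op T x = z"
proof (rule cinner_extI)
  fix w show "cinner w (adjoint_op T x) = cinner w z"
    by (metis adjoint_op[OF T] assms(2) cinner_commute)
qed

instance chilbert_space \<subseteq> banach ..
instance cstar_algebra \<subseteq> banach ..

section \<open>Square roots in C*-algebras\<close>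

lemma star_zero [simp]: "star (0::'a::cstar_algebra) = 0"
  using star_add[of 0 "0::'a"] by simp

lemma star_minus [simp]: "star (- a) = - star (a::'a::cstar_algebra)"
  using star_add[of a "- a"] by (simp add: eq_neg_iff_add_eq_0 add.commute)

lemma star_diff: "star (a - b) = star a - star (b::'a::cstar_algebra)"
  using star_add[of a "- b"] by simp

lemma star_scaleR: "star (r *\<^sub>R a) = r *\<^sub>R star (a::'a::cstar_algebra)"
  by (simp add: scaleR_scaleC star_scaleC)

lemma norm_star [simp]: "norm (star a) = norm (a::'a::cstar_algebra)"
proof -
  have "norm a \<le> norm (star a)" for a :: 'a
  proof (cases "a = 0")
    case False
    have "norm a * norm a \<le> norm (star a) * norm a"
      using norm_mult_ineq[of "star a" a] by (simp add: cstar_identity power2_eq_square)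
    then show ?thesis using False by simp
  qed simp
  from this[of a] this[of "star a"] show ?thesis by (simp add: star_star)
qed

lemma bounded_linear_star: "bounded_linear (star :: 'a::cstar_algebra \<Rightarrow> 'a)"
  by (rule bounded_linear_intro[of _ 1]) (auto simp: star_add star_scaleR)

lemmas continuous_on_star [continuous_intros] = bounded_linear.continuous_on [OF bounded_linear_star]
lemmas tendsto_star [tendsto_intros] = bounded_linear.tendsto [OF bounded_linear_star]

lemma norm_mult_star: "norm (a * star a) = (norm (a::'a::cstar_algebra))\<^sup>2"
  using cstar_identity[of "star a"] by (simp add: star_star)

text \<open>Testing on b = star a recovers the norm of a through the C*-identity. Bounds for formal
  elements such as 1 - w are proved for multiplication operators and return to norms in this
  way.\<close>

lemma norm_le_if_multiplier_le:
  fixes a :: "'a::cstar_algebra"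
  assumes "\<And>b. norm (a * b) \<le> C * norm b" "C \<ge> 0"
  shows "norm a \<le> C"
proof (cases "norm a = 0")
  case False
  then show ?thesis
    using assms(1)[of "star a"] by (simp add: norm_mult_star power2_eq_square)
qed (use assms in simp)

text \<open>The iteration w to (c' + w^2)/2 for the scalar c' = 1. It increases to the double root
  1, and its increments dominate those of the algebra-valued iteration even in the boundary case of
  norm 1, where no geometric rate is available.\<close>

fun root_majorant :: "nat \<Rightarrow> real" where
  "root_majorant 0 = 0"
| "root_majorant (Suc n) = (1 + (root_majorant n)\<^sup>2) / 2"

lemma root_majorant_bounds: "0 \<le> root_majorant n \<and> root_majorant n \<le> 1"
  by (induction n) (auto simp: power_le_one)

lemma root_majorant_mono: "root_majorant n \<le> root_majorant (Suc n)"
proof -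
  have "0 \<le> (1 - root_majorant n)\<^sup>2" by simp
  then show ?thesis by (simp add: power2_diff)
qed

lemma root_majorant_tendsto: "root_majorant \<longlonglongrightarrow> 1"
proof -
  have "convergent root_majorant"
  proof (rule Bseq_mono_convergent)
    show "Bseq root_majorant" by (rule BseqI'[of _ 1]) (simp add: root_majorant_bounds)
    show "\<forall>m n. m \<le> n \<longrightarrow> root_majorant m \<le> root_majorant n"
      using lift_Suc_mono_le[of root_majorant, OF root_majorant_mono] by blast
  qed
  then obtain l where l: "root_majorant \<longlonglongrightarrow> l" by (auto simp: convergent_def)
  have "(\<lambda>n. root_majorant (Suc n)) \<longlonglongrightarrow> (1 + l\<^sup>2) / 2"
    unfolding root_majorant.simps by (intro tendsto_intros l) simp
  then have "(1 + l\<^sup>2) / 2 = l" using LIMSEQ_unique LIMSEQ_Suc[OF l] by blast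
  then have "(1 - l)\<^sup>2 = 0" by (simp add: power2_diff)
  then show ?thesis using l by simp
qed

text \<open>Solves \<open>2 w = c' + w\<^sup>2\<close> for \<open>c' = \<gamma> + c\<close> of multiplier norm at most 1 by the iteration
  \<open>w \<mapsto> (c' + w\<^sup>2) / 2\<close>, where \<open>w = \<gamma> + v\<close>. Treating the scalar part separately avoids a unitization.\<close>

lemma root_iteration:
  fixes c :: "'a::cstar_algebra"
  assumes \<gamma>: "\<gamma> = 0 \<or> \<gamma> = (1::real)" and c: "\<And>b. norm (\<gamma> *\<^sub>R b + c * b) \<le> norm b"
  shows "\<exists>v. 2 *\<^sub>R v = c + (2 * \<gamma>) *\<^sub>R v + v * v \<and> (star c = c \<longrightarrow> star v = v) \<and>
    (\<forall>x. x * c = c * x \<longrightarrow> x * v = v * x)"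
proof -
  \<comment> \<open>Scalar and algebra part of w are iterated separately: o' is the majorant for
    \<gamma> = 1 and constantly 0 for \<gamma> = 0.\<close>
  define o' where "o' n = \<gamma> * root_majorant n" for n
  define v where "v = rec_nat 0 (\<lambda>n z. (1/2) *\<^sub>R (c + (2 * o' n) *\<^sub>R z + z * z))"
  have v0: "v 0 = 0" and vS: "v (Suc n) = (1/2) *\<^sub>R (c + (2 * o' n) *\<^sub>R v n + v n * v n)" for n
    by (auto simp: v_def)
  have oS: "o' (Suc n) = (\<gamma> + (o' n)\<^sup>2) / 2" for n using \<gamma> by (auto simp: o'_def)
  define W where "W n b = o' n *\<^sub>R b + v n * b" for n b
  have W_diff: "W n (b - b') = W n b - W n b'" for n b b'
    by (simp add: W_def algebra_simps)
  have WS: "W (Suc n) b = (1/2) *\<^sub>R ((\<gamma> *\<^sub>R b + c * b) + W n (W n b))" for n b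
    by (simp add: W_def vS oS algebra_simps power2_eq_square add_divide_distrib)
       (simp flip: scaleR_add_left)
  have b1: "norm (W n b) \<le> root_majorant n * norm b" for n b
  proof (induction n arbitrary: b)
    case (Suc n)
    have "norm (W n (W n b)) \<le> root_majorant n * (root_majorant n * norm b)"
      by (rule order_trans[OF Suc mult_left_mono[OF Suc]]) (simp add: root_majorant_bounds)
    then have "norm ((\<gamma> *\<^sub>R b + c * b) + W n (W n b)) \<le> norm b + root_majorant n * (root_majorant n * norm b)"
      using c[of b] norm_triangle_ineq[of "\<gamma> *\<^sub>R b + c * b" "W n (W n b)"] by linarith
    then show ?case unfolding WS norm_scaleR by (simp add: field_simps power2_eq_square)
  qed (simp add: W_def v0 o'_def)
  \<comment> \<open>With W' the successor of W, the squares differ by W' (W' - W) + (W' - W) W. The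
    recursion of the majorant factors in the same way, so the bound reproduces itself.\<close>
  have b2: "norm (W (Suc n) b - W n b) \<le> (root_majorant (Suc n) - root_majorant n) * norm b" for n b
  proof (induction n arbitrary: b)
    case 0
    then show ?case using c[of b] unfolding WS by (simp add: W_def v0 o'_def)
  next
    case (Suc n)
    let ?d = "root_majorant (Suc n) - root_majorant n"
    have "W (Suc (Suc n)) b - W (Suc n) b = (1/2) *\<^sub>R (W (Suc n) (W (Suc n) b) - W n (W n b))"
      unfolding WS[of "Suc n" b] WS[of n b] by (simp add: algebra_simps)
    also have "\<dots> = (1/2) *\<^sub>R (W (Suc n) (W (Suc n) b - W n b) + (W (Suc n) (W n b) - W n (W n b)))"
      by (simp add: W_diff)
    also have "norm \<dots> \<le> (1/2) * (root_majorant (Suc n) * (?d * norm b) + ?d * (root_majorant n * norm b))"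
    proof -
      have "norm (W (Suc n) (W (Suc n) b - W n b)) \<le> root_majorant (Suc n) * (?d * norm b)"
        by (rule order_trans[OF b1 mult_left_mono[OF Suc]]) (simp add: root_majorant_bounds del: root_majorant.simps)
      moreover have "norm (W (Suc n) (W n b) - W n (W n b)) \<le> ?d * (root_majorant n * norm b)"
        by (rule order_trans[OF Suc mult_left_mono[OF b1]]) (use root_majorant_mono[of n] in simp)
      ultimately show ?thesis
        using norm_triangle_ineq[of "W (Suc n) (W (Suc n) b - W n b)" "W (Suc n) (W n b) - W n (W n b)"]
        unfolding norm_scaleR by simp
    qed
    also have "\<dots> = (root_majorant (Suc (Suc n)) - root_majorant (Suc n)) * norm b"
      unfolding root_majorant.simps(2)[of "Suc n"] root_majorant.simps(2)[of n]
      by (simp add: field_simps power2_eq_square)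
    finally show ?case .
  qed
  \<comment> \<open>Passing from W to v removes a scalar increment that is itself at most the
    increment of the majorant; hence the factor 2.\<close>
  have b3: "norm (v (Suc n) - v n) \<le> 2 * (root_majorant (Suc n) - root_majorant n)" for n
  proof (rule norm_le_if_multiplier_le)
    fix b
    let ?d = "root_majorant (Suc n) - root_majorant n"
    have "(v (Suc n) - v n) * b = (W (Suc n) b - W n b) - (o' (Suc n) - o' n) *\<^sub>R b"
      by (simp add: W_def algebra_simps)
    moreover have "norm ((o' (Suc n) - o' n) *\<^sub>R b) \<le> ?d * norm b"
      using \<gamma> root_majorant_mono[of n] by (auto simp: o'_def mult_right_mono)
    ultimately show "norm ((v (Suc n) - v n) * b) \<le> 2 * ?d * norm b"
      using b2[of n b] norm_triangle_ineq4[of "W (Suc n) b - W n b" "(o' (Suc n) - o' n) *\<^sub>R b"]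
      by (simp add: left_diff_distrib del: root_majorant.simps)
  qed (use root_majorant_mono[of n] in simp)
  have "summable (\<lambda>n. v (Suc n) - v n)"
  proof (rule summable_comparison_test'[of "\<lambda>n. 2 * (root_majorant (Suc n) - root_majorant n)" 0])
    show "summable (\<lambda>n. 2 * (root_majorant (Suc n) - root_majorant n))"
      by (rule summable_mult) (rule telescope_summable[OF root_majorant_tendsto])
  qed (rule b3)
  then have "convergent (\<lambda>n. \<Sum>i<n. v (Suc i) - v i)"
    by (simp add: summable_iff_convergent)
  then have "convergent v" by (simp add: sum_lessThan_telescope v0)
  then obtain l where l: "v \<longlonglongrightarrow> l" by (auto simp: convergent_def)
  have ol: "o' \<longlonglongrightarrow> \<gamma>"
    unfolding o'_def using tendsto_mult[OF tendsto_const root_majorant_tendsto, of \<gamma>] by simp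
  have "(\<lambda>n. 2 *\<^sub>R v (Suc n)) \<longlonglongrightarrow> 2 *\<^sub>R l" by (intro tendsto_intros LIMSEQ_Suc l)
  moreover have "(\<lambda>n. 2 *\<^sub>R v (Suc n)) \<longlonglongrightarrow> c + (2 * \<gamma>) *\<^sub>R l + l * l"
    unfolding vS by (auto intro!: tendsto_intros l ol)
  ultimately have "2 *\<^sub>R l = c + (2 * \<gamma>) *\<^sub>R l + l * l" by (rule LIMSEQ_unique)
  moreover have "star l = l" if "star c = c"
  proof -
    have "star (v n) = v n" for n
      by (induction n) (simp_all add: v0 vS that star_add star_scaleR star_mult)
    then show ?thesis using LIMSEQ_unique[OF tendsto_star[OF l]] l by simp
  qed
  moreover have "x * l = l * x" if "x * c = c * x" for x
  proof -
    have "x * v n = v n * x" for n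
    proof (induction n)
      case (Suc n)
      have "x * (v n * v n) = (x * v n) * v n" by (simp add: mult.assoc)
      also have "\<dots> = v n * (x * v n)" by (simp only: Suc mult.assoc)
      also have "\<dots> = v n * v n * x" by (simp only: Suc mult.assoc)
      finally have "x * (v n * v n) = v n * v n * x" .
      with Suc that show ?case by (simp add: vS distrib_left distrib_right)
    qed (simp add: v0)
    then show ?thesis
      using LIMSEQ_unique[OF tendsto_mult[OF tendsto_const l, of x] ] tendsto_mult[OF l tendsto_const, of x] by simp
  qed
  ultimately show ?thesis by blast
qed

text \<open>The case \<gamma> = 0. Formally w = 1 - sqrt (1 - c), so (1 - w)^2 = 1 - c.\<close>

lemma one_minus_contraction_root:
  fixes c :: "'a::cstar_algebra"
  assumes "norm c \<le> 1"
  shows "\<exists>w. 2 *\<^sub>R w = c + w * w \<and> (star c = c \<longrightarrow> star w = w) \<and> (\<forall>x. x * c = c * x \<longrightarrow> x * w = w * x)"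
proof -
  have "norm (0 *\<^sub>R b + c * b) \<le> norm b" for b
    using norm_mult_ineq[of c b] mult_right_mono[OF assms norm_ge_zero[of b]] by simp
  from root_iteration[OF _ this] show ?thesis by simp
qed

text \<open>With \<open>w = 1 - \<surd>(1 - x\<^sup>2)\<close>, the elements \<open>x \<plusminus> \<i> (1 - w)\<close> are unitary multipliers, which gives the
  estimates that a functional calculus would provide.\<close>

lemma selfadjoint_cosine:
  fixes x :: "'a::cstar_algebra"
  assumes sx: "star x = x" and nx: "norm x \<le> 1"
  obtains w where "star w = w" "2 *\<^sub>R w = x * x + w * w" "w * x = x * w"
    "\<And>b. norm (b - w * b) \<le> norm b" "\<And>b. norm (x * (b - w * b)) \<le> norm b / 2"
proof -
  have "norm (x * x) \<le> 1" using norm_mult_ineq[of x x] nx by (metis mult_le_one norm_ge_zero order_trans)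
  moreover have "star (x * x) = x * x" "x * (x * x) = (x * x) * x" by (simp_all add: star_mult sx mult.assoc)
  ultimately obtain w where w: "2 *\<^sub>R w = x * x + w * w" "star w = w" "w * x = x * w"
    using one_minus_contraction_root[of "x * x"] by metis
  have wx: "w * (x * z) = x * (w * z)" for z using w(3) by (metis mult.assoc)
  have ww: "w * (w * z) = 2 *\<^sub>R (w * z) - x * (x * z)" for z
  proof -
    have "(2 *\<^sub>R w) * z = (x * x + w * w) * z" using w(1) by simp
    then show ?thesis by (simp add: algebra_simps)
  qed
  \<comment> \<open>With x = cos \<theta> and 1 - w = sin \<theta>, the maps \<open>U \<i>\<close>
    and \<open>U (-\<i>)\<close> are multiplication by exp (i \<theta>) and exp (- i
    \<theta>).\<close>
  define U where "U \<sigma> b = x * b + \<sigma> *\<^sub>C (b - w * b)" for \<sigma> b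
  have iso: "norm (U \<sigma> b) = norm b" if "\<sigma> = \<i> \<or> \<sigma> = - \<i>" for \<sigma> b
  proof -
    have "star (U \<sigma> b) * U \<sigma> b = star b * b"
      using that by (auto simp: U_def star_add star_diff star_scaleC star_mult sx w(2) algebra_simps scaleC_mult_left
          scaleC_mult_right scaleC_scaleC scaleC_add_right scaleC_diff_right wx ww scaleR_2)
    then have "(norm (U \<sigma> b))\<^sup>2 = (norm b)\<^sup>2" using cstar_identity by metis
    then show ?thesis by simp
  qed
  have S: "norm (b - w * b) \<le> norm b" for b
  proof -
    have "U \<i> b - U (-\<i>) b = (2 * \<i>) *\<^sub>C (b - w * b)" by (simp add: U_def flip: scaleC_add_left)
    then have "2 * norm (b - w * b) = norm (U \<i> b - U (-\<i>) b)" by (simp add: norm_scaleC norm_mult)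
    also have "\<dots> \<le> norm b + norm b" using norm_triangle_ineq4[of "U \<i> b" "U (-\<i>) b"] by (simp add: iso)
    finally show ?thesis by simp
  qed
  \<comment> \<open>The squares of the two isometries differ by 2 i sin (2 \<theta>) = 4 i cos
    \<theta> sin \<theta>, whose norm is at most 2; hence the 1/2.\<close>
  have xS: "norm (x * (b - w * b)) \<le> norm b / 2" for b
  proof -
    have gen: "U \<i> c - U (-\<i>) d = x * (c - d) + \<i> *\<^sub>C ((c + d) - w * (c + d))" for c d
      by (simp add: U_def algebra_simps scaleC_add_right scaleC_diff_right)
    have dif: "U \<i> b - U (-\<i>) b = (2 * \<i>) *\<^sub>C (b - w * b)" by (simp add: U_def flip: scaleC_add_left)
    have add: "U \<i> b + U (-\<i>) b = 2 *\<^sub>C (x * b)"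
      by (simp add: U_def scaleC_add_left[of 1 1, simplified])
    have "U \<i> (U \<i> b) - U (-\<i>) (U (-\<i>) b) = (2 * \<i>) *\<^sub>C (x * (b - w * b)) + (2 * \<i>) *\<^sub>C (x * (b - w * b))"
      unfolding gen[of "U \<i> b" "U (-\<i>) b"] dif add
      by (simp add: scaleC_mult_right scaleC_diff_right scaleC_scaleC wx right_diff_distrib mult.commute)
    then have "U \<i> (U \<i> b) - U (-\<i>) (U (-\<i>) b) = (4 * \<i>) *\<^sub>C (x * (b - w * b))"
      by (simp flip: scaleC_add_left)
    then have "4 * norm (x * (b - w * b)) = norm (U \<i> (U \<i> b) - U (-\<i>) (U (-\<i>) b))"
      by (simp add: norm_scaleC norm_mult)
    also have "\<dots> \<le> norm b + norm b" using norm_triangle_ineq4[of "U \<i> (U \<i> b)" "U (-\<i>) (U (-\<i>) b)"] by (simp add: iso)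
    finally show ?thesis by simp
  qed
  show thesis using that[of w] w S xS by blast
qed

text \<open>As multipliers, 1 - x^2 = (1 - w)^2 is a product of contractions, and x - x^3 = x (1 -
  w) (1 - w). The constant 1/2 is not sharp, but it is exactly what the doubling in
  \<open>cubic_iterates\<close> can afford.\<close>

lemma norm_diff_square_mult_le:
  fixes x :: "'a::cstar_algebra"
  assumes "star x = x" "norm x \<le> 1"
  shows "norm (b - x * x * b) \<le> norm b" "norm (x - x * x * x) \<le> 1 / 2"
proof -
  obtain w where w: "2 *\<^sub>R w = x * x + w * w" "w * x = x * w"
    "\<And>b. norm (b - w * b) \<le> norm b" "\<And>b. norm (x * (b - w * b)) \<le> norm b / 2"
    using selfadjoint_cosine[OF assms] by metis
  have eq: "(b - w * b) - w * (b - w * b) = b - x * x * b" for b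
  proof -
    have "(2 *\<^sub>R w) * b = (x * x + w * w) * b" using w(1) by simp
    then show ?thesis by (simp add: algebra_simps scaleR_2)
  qed
  show *: "norm (b - x * x * b) \<le> norm b" for b
    using w(3)[of b] w(3)[of "b - w * b"] unfolding eq by simp
  show "norm (x - x * x * x) \<le> 1 / 2"
  proof (rule norm_le_if_multiplier_le)
    fix b
    have "(x - x * x * x) * b = x * (b - x * x * b)" by (simp add: algebra_simps)
    also have "\<dots> = x * ((b - w * b) - w * (b - w * b))" by (simp only: eq)
    also have "norm \<dots> \<le> norm (b - w * b) / 2" by (rule w(4))
    also have "\<dots> \<le> 1 / 2 * norm b" using w(3)[of b] by simp
    finally show "norm ((x - x * x * x) * b) \<le> 1 / 2 * norm b" .
  qed simp
qed

section \<open>Positive elements and approximate units\<close>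

text \<open>Spectrally, p lies between 0 and 2. As a norm condition this passes to convergent convex
  combinations, and it is the form in which the root iteration accepts p.\<close>

definition unit_positive :: "'a::cstar_algebra \<Rightarrow> bool"
  where "unit_positive p \<longleftrightarrow> star p = p \<and> (\<forall>b. norm (b - p * b) \<le> norm b)"

lemma unit_positive_square:
  "star x = x \<Longrightarrow> norm x \<le> 1 \<Longrightarrow> unit_positive (x * (x::'a::cstar_algebra))"
  unfolding unit_positive_def by (simp add: norm_diff_square_mult_le(1) star_mult)

lemma unit_positive_zero: "unit_positive 0"
  by (simp add: unit_positive_def)

lemma norm_le_2_if_contraction:
  fixes e :: "'a::cstar_algebra"
  assumes "\<And>b. norm (b - e * b) \<le> norm b"
  shows "norm e \<le> 2"
proof (rule norm_le_if_multiplier_le)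
  fix b show "norm (e * b) \<le> 2 * norm b"
    using norm_triangle_ineq4[of b "b - e * b"] assms[of b] by simp
qed simp

text \<open>For \<gamma> = 1 and c = - p the linear terms of the iteration equation cancel and v * v
  = p remains.\<close>

lemma unit_positive_root:
  assumes "unit_positive p"
  obtains v where "star v = v" "v * v = (p::'a::cstar_algebra)"
proof -
  have "norm (1 *\<^sub>R b + (- p) * b) \<le> norm b" for b using assms by (simp add: unit_positive_def)
  then obtain v where "2 *\<^sub>R v = - p + (2 * 1) *\<^sub>R v + v * v" "star (- p) = - p \<longrightarrow> star v = v"
    using root_iteration[of 1 "- p"] by blast
  then show thesis using that[of v] assms by (auto simp: unit_positive_def)
qed

text \<open>The weights add up to 1, so 1 minus the sum is the corresponding average of the
  contractions 1 - p n.\<close>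

lemma unit_positive_suminf:
  fixes p :: "nat \<Rightarrow> 'a::cstar_algebra"
  assumes p: "\<And>n. unit_positive (p n)"
  shows "summable (\<lambda>n. (1/2)^Suc n *\<^sub>R p n)" "unit_positive (\<Sum>n. (1/2)^Suc n *\<^sub>R p n)"
proof -
  define r :: "nat \<Rightarrow> real" where "r n = (1/2)^Suc n" for n
  have half: "r sums 1" unfolding r_def by (rule power_half_series)
  have r0: "r n \<ge> 0" for n by (simp add: r_def)
  have sp: "star (p n) = p n" and np: "norm (b - p n * b) \<le> norm b" for n b
    using p[of n] by (auto simp: unit_positive_def)
  have n2: "norm (p n) \<le> 2" for n by (rule norm_le_2_if_contraction) (rule np)
  have s: "summable (\<lambda>n. r n *\<^sub>R p n)"
  proof (rule summable_comparison_test'[of "\<lambda>n. r n * 2" 0])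
    show "summable (\<lambda>n. r n * 2)" using sums_summable[OF half] by (rule summable_mult2)
    show "norm (r n *\<^sub>R p n) \<le> r n * 2" for n
      using mult_left_mono[OF n2 r0] r0 by simp
  qed
  let ?q = "\<Sum>n. r n *\<^sub>R p n"
  have 1: "star ?q = ?q"
    using bounded_linear.suminf[OF bounded_linear_star s] by (simp only: star_scaleR sp)
  have 2: "norm (b - ?q * b) \<le> norm b" for b
  proof -
    have "(\<lambda>n. r n *\<^sub>R b) sums b" using sums_scaleR_left[OF half, of b] by (simp only: scaleR_one)
    moreover have "(\<lambda>n. r n *\<^sub>R p n * b) sums (?q * b)"
      by (rule bounded_linear.sums[OF bounded_linear_mult_left summable_sums[OF s]])
    ultimately have sm: "(\<lambda>n. r n *\<^sub>R b - r n *\<^sub>R p n * b) sums (b - ?q * b)" by (rule sums_diff)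
    have le: "norm (r n *\<^sub>R b - r n *\<^sub>R p n * b) \<le> r n * norm b" for n
    proof -
      have "r n *\<^sub>R b - r n *\<^sub>R p n * b = r n *\<^sub>R (b - p n * b)"
        by (simp add: algebra_simps)
      then show ?thesis using mult_left_mono[OF np r0] r0 by simp
    qed
    have rb: "(\<lambda>n. r n * norm b) sums (1 * norm b)" by (rule sums_mult2[OF half])
    have "norm (\<Sum>n. r n *\<^sub>R b - r n *\<^sub>R p n * b) \<le> (\<Sum>n. r n * norm b)"
      by (rule norm_suminf_le[OF le sums_summable[OF rb]])
    then show ?thesis by (simp only: sums_unique[OF sm, symmetric] sums_unique[OF rb, symmetric] mult_1)
  qed
  show "summable (\<lambda>n. (1/2)^Suc n *\<^sub>R p n)" "unit_positive (\<Sum>n. (1/2)^Suc n *\<^sub>R p n)"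
    using s 1 2 unfolding unit_positive_def r_def by blast+
qed

text \<open>The recursion \<open>y \<mapsto> 2 (y - y\<^sup>3)\<close> preserves the unit ball, so that \<open>x = \<Sum> 2\<^sup>-\<^sup>n y\<^sub>n\<^sup>3\<close>.\<close>

definition cubic_iterates :: "'a::cstar_algebra \<Rightarrow> nat \<Rightarrow> 'a"
  where "cubic_iterates x = rec_nat x (\<lambda>_ y. 2 *\<^sub>R (y - y * y * y))"

lemma cubic_iterates_0: "cubic_iterates x 0 = x"
  and cubic_iterates_Suc: "cubic_iterates x (Suc n) = 2 *\<^sub>R (cubic_iterates x n - cubic_iterates x n * cubic_iterates x n * cubic_iterates x n)"
  by (auto simp: cubic_iterates_def)

lemma cubic_iterates:
  assumes "star x = x" "norm x \<le> 1"
  shows "star (cubic_iterates x n) = cubic_iterates x n \<and> norm (cubic_iterates x n) \<le> 1"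
proof (induction n)
  case (Suc n)
  let ?y = "cubic_iterates x n"
  have "star (?y * ?y * ?y) = ?y * ?y * ?y" using Suc by (simp add: star_mult mult.assoc)
  then show ?case
    using Suc norm_diff_square_mult_le(2)[of ?y]
    by (simp add: cubic_iterates_Suc star_scaleR star_diff)
qed (simp add: cubic_iterates_0 assms)

text \<open>A cube is a difference of squares: G = (y + y^2)/2 and K = (y - y^2)/2 satisfy G^2 - K^2
  = y^3. An expansion of x into cubes thus becomes a difference of two convex combinations of
  squares.\<close>

lemma selfadjoint_decomposition:
  fixes x :: "'a::cstar_algebra"
  assumes "star x = x" "norm x \<le> 1"
  obtains p q where "unit_positive p" "unit_positive q" "x = 2 *\<^sub>R (p - q)"
proof -
  define y where "y = cubic_iterates x"
  have y: "star (y n) = y n" "norm (y n) \<le> 1" for n using cubic_iterates[OF assms] by (auto simp: y_def)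
  define G where "G n = (1/2) *\<^sub>R (y n + y n * y n)" for n
  define K where "K n = (1/2) *\<^sub>R (y n - y n * y n)" for n
  have yy: "norm (y n * y n) \<le> 1" for n
    using norm_mult_ineq[of "y n" "y n"] y(2)[of n] by (metis mult_le_one norm_ge_zero order_trans)
  have G: "unit_positive (G n * G n)" for n
    using y(2)[of n] yy[of n] norm_triangle_ineq[of "y n" "y n * y n"]
    by (intro unit_positive_square) (auto simp: G_def star_scaleR star_add star_mult y(1))
  have K: "unit_positive (K n * K n)" for n
    using y(2)[of n] yy[of n] norm_triangle_ineq4[of "y n" "y n * y n"]
    by (intro unit_positive_square) (auto simp: K_def star_scaleR star_diff star_mult y(1))
  note sG = unit_positive_suminf[of "\<lambda>n. G n * G n", OF G]
  note sK = unit_positive_suminf[of "\<lambda>n. K n * K n", OF K]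
  have GK: "G n * G n - K n * K n = y n * y n * y n" for n
  proof -
    have "(a + b) * (a + b) - (a - b) * (a - b) = 2 *\<^sub>R (a * b) + 2 *\<^sub>R (b * a)" for a b :: 'a
      by (simp add: algebra_simps scaleR_2)
    from this[of "y n" "y n * y n"] show ?thesis
      by (simp add: G_def K_def mult.assoc flip: scaleR_add_left scaleR_diff_right)
  qed
  have "(\<lambda>n. (1/2)^n *\<^sub>R y n) \<longlonglongrightarrow> 0"
  proof (rule Lim_null_comparison[of _ "\<lambda>n. (1/2)^n"])
    show "\<forall>\<^sub>F n in sequentially. norm ((1/2)^n *\<^sub>R y n) \<le> (1/2)^n"
      using y(2) by (simp add: divide_right_mono)
    show "(\<lambda>n. (1/2)^n) \<longlonglongrightarrow> (0::real)" by (rule LIMSEQ_power_zero) simp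
  qed
  \<comment> \<open>Half of y (n + 1) is y n - (y n)^3, so the terms are 2^-n (y n)^3. Their weights
    are twice the convex weights, which is the 2 in the conclusion.\<close>
  from telescope_sums'[OF this]
  have "(\<lambda>n. (1/2)^n *\<^sub>R y n - (1/2)^Suc n *\<^sub>R y (Suc n)) sums x"
    by (simp add: y_def cubic_iterates_0)
  moreover have "(1/2)^n *\<^sub>R y n - (1/2)^Suc n *\<^sub>R y (Suc n) = 2 *\<^sub>R ((1/2)^Suc n *\<^sub>R (G n * G n) - (1/2)^Suc n *\<^sub>R (K n * K n))" for n
  proof -
    have "2 *\<^sub>R ((1/2)^Suc n *\<^sub>R (G n * G n) - (1/2)^Suc n *\<^sub>R (K n * K n)) = (1/2)^n *\<^sub>R (G n * G n - K n * K n)"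
      by (simp add: scaleR_diff_right)
    then show ?thesis by (simp add: GK y_def cubic_iterates_Suc scaleR_diff_right)
  qed
  ultimately have 1: "(\<lambda>n. 2 *\<^sub>R ((1/2)^Suc n *\<^sub>R (G n * G n) - (1/2)^Suc n *\<^sub>R (K n * K n))) sums x" by simp
  have "(\<lambda>n. 2 *\<^sub>R ((1/2)^Suc n *\<^sub>R (G n * G n) - (1/2)^Suc n *\<^sub>R (K n * K n))) sums
     (2 *\<^sub>R ((\<Sum>n. (1/2)^Suc n *\<^sub>R (G n * G n)) - (\<Sum>n. (1/2)^Suc n *\<^sub>R (K n * K n))))"
    by (intro sums_scaleR_right sums_diff summable_sums sG(1) sK(1))
  with 1 have "x = 2 *\<^sub>R ((\<Sum>n. (1/2)^Suc n *\<^sub>R (G n * G n)) - (\<Sum>n. (1/2)^Suc n *\<^sub>R (K n * K n)))"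
    by (rule sums_unique2)
  then show thesis using that sG(2) sK(2) by blast
qed

text \<open>Let z n be the cubic iterates of x, the normalised product of y and star y. The
  multiplier 1 - (z n)^2 is a contraction and sends z n to half of z (n + 1). A product 1 - e of
  such factors sends x to 2^-n z n, and the C*-identity carries the smallness over to (1 - e)
  y.\<close>

lemma approximate_unit_single:
  fixes y :: "'a::cstar_algebra"
  assumes "\<epsilon> > 0"
  obtains e where "\<And>b. norm (b - e * b) \<le> norm b" "norm (y - e * y) \<le> \<epsilon>"
proof (cases "y = 0")
  case True
  then show thesis using that[of 0] assms by simp
next
  case False
  define r where "r = (norm y)\<^sup>2"
  have r: "r > 0" using False by (simp add: r_def)
  define x where "x = (1/r) *\<^sub>R (y * star y)"
  have sx: "star x = x" by (simp add: x_def star_scaleR star_mult star_star)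
  have nx: "norm x \<le> 1" using r by (simp add: x_def norm_mult_star r_def)
  have z: "star (cubic_iterates x n) = cubic_iterates x n" "norm (cubic_iterates x n) \<le> 1" for n
    using cubic_iterates[OF sx nx] by auto
  have "\<exists>e. (\<forall>b. norm (b - e * b) \<le> norm b) \<and> x - e * x = (1/2)^n *\<^sub>R cubic_iterates x n" for n
  proof (induction n)
    case 0 show ?case by (rule exI[of _ 0]) (simp add: cubic_iterates_0)
  next
    case (Suc n)
    then obtain e where e: "\<And>b. norm (b - e * b) \<le> norm b" "x - e * x = (1/2)^n *\<^sub>R cubic_iterates x n" by blast
    let ?z = "cubic_iterates x n"
    \<comment> \<open>This is 1 - ?e = (1 - z^2) (1 - e), written out without the unit.\<close>
    let ?e = "e + ?z * ?z - ?z * ?z * e"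
    have eq: "b - ?e * b = (b - e * b) - ?z * ?z * (b - e * b)" for b by (simp add: algebra_simps)
    have "norm (b - ?e * b) \<le> norm b" for b
      unfolding eq using norm_diff_square_mult_le(1)[OF z(1)[of n] z(2)[of n], of "b - e * b"] e(1)[of b] by linarith
    moreover have "x - ?e * x = (1/2)^Suc n *\<^sub>R cubic_iterates x (Suc n)"
      unfolding eq e(2) by (simp add: cubic_iterates_Suc algebra_simps)
    ultimately show ?case by blast
  qed
  then have "\<exists>e. \<forall>n. (\<forall>b. norm (b - e n * b) \<le> norm b) \<and> x - e n * x = (1/2)^n *\<^sub>R cubic_iterates x n"
    by (intro choice) blast
  then obtain e where e: "\<And>n b. norm (b - e n * b) \<le> norm b" "\<And>n. x - e n * x = (1/2)^n *\<^sub>R cubic_iterates x n"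
    by blast
  \<comment> \<open>The square is r times the norm of (1 - e) x (1 - star e), at most 2^-n (1 + norm
    e); norm e \<le> 2 gives the 3.\<close>
  have bound: "(norm (y - e n * y))\<^sup>2 \<le> 3 * r * (1/2)^n" for n
  proof -
    have ne: "norm (e n) \<le> 2" by (rule norm_le_2_if_contraction[OF e(1)])
    have n1: "norm (x - e n * x) \<le> (1/2)^n" using z(2)[of n] by (simp add: e(2) divide_right_mono)
    have *: "(y - a * y) * star (y - a * y) = (y * star y - a * (y * star y)) - (y * star y - a * (y * star y)) * star a" for a
      by (simp add: star_diff star_mult algebra_simps)
    have "(1/r) *\<^sub>R ((y - e n * y) * star (y - e n * y)) = (x - e n * x) - (x - e n * x) * star (e n)"
      unfolding *[of "e n"] x_def
      by (simp only: scaleR_diff_right mult_scaleR_left mult_scaleR_right left_diff_distrib)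
    then have "norm ((y - e n * y) * star (y - e n * y)) / r = norm ((x - e n * x) - (x - e n * x) * star (e n))"
      using r norm_scaleR[of "1/r" "(y - e n * y) * star (y - e n * y)"] by (simp only: abs_of_pos divide_pos_pos zero_less_one times_divide_eq_left mult_1)
    also have "\<dots> \<le> norm (x - e n * x) + norm (x - e n * x) * norm (star (e n))"
      by (rule order_trans[OF norm_triangle_ineq4 add_left_mono[OF norm_mult_ineq]])
    also have "\<dots> \<le> (1/2)^n + (1/2)^n * 2"
      using n1 ne by (intro add_mono mult_mono) auto
    finally have "(norm (y - e n * y))\<^sup>2 / r \<le> (1/2)^n + (1/2)^n * 2" unfolding norm_mult_star .
    then show ?thesis using r by (simp add: field_simps)
  qed
  have "0 < \<epsilon>\<^sup>2 / (3 * r)" using assms r by simp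
  then obtain n where "(1/2)^n < \<epsilon>\<^sup>2 / (3 * r)"
    using real_arch_pow_inv[of "\<epsilon>\<^sup>2 / (3 * r)" "1/2"] by auto
  then have "3 * r * (1/2)^n \<le> \<epsilon>\<^sup>2" using r by (simp add: field_simps)
  then have "(norm (y - e n * y))\<^sup>2 \<le> \<epsilon>\<^sup>2" by (rule order_trans[OF bound])
  then have "norm (y - e n * y) \<le> \<epsilon>" by (rule power2_le_imp_le) (use assms in simp)
  then show thesis using that[OF e(1)] by blast
qed

text \<open>The new factor 1 - d is chosen for the residue y - e * y of the new element. Being a
  contraction, it does not spoil the elements treated before.\<close>

lemma approximate_unit_finite:
  fixes F :: "'a::cstar_algebra set"
  assumes "finite F" "\<epsilon> > 0"
  shows "\<exists>e. (\<forall>b. norm (b - e * b) \<le> norm b) \<and> (\<forall>y\<in>F. norm (y - e * y) \<le> \<epsilon>)"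
  using assms(1)
proof (induction F)
  case empty show ?case by (rule exI[of _ 0]) simp
next
  case (insert y F)
  then obtain e where e: "\<And>b. norm (b - e * b) \<le> norm b" "\<And>y. y \<in> F \<Longrightarrow> norm (y - e * y) \<le> \<epsilon>" by blast
  obtain d where d: "\<And>b. norm (b - d * b) \<le> norm b" "norm ((y - e * y) - d * (y - e * y)) \<le> \<epsilon>"
    using approximate_unit_single[OF assms(2), of "y - e * y"] by blast
  let ?e = "d + e - d * e"
  have eq: "b - ?e * b = (b - e * b) - d * (b - e * b)" for b by (simp add: algebra_simps)
  show ?case
    unfolding eq using order_trans[OF d(1) e(1)] order_trans[OF d(1) e(2)] d(2)
    by (intro exI[of _ ?e]) (simp only: eq insert_iff, blast)
qed

lemma approximate_unit_compact:
  fixes C :: "'a::cstar_algebra set"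
  assumes "compact C" "\<epsilon> > 0"
  obtains e where "\<And>b. norm (b - e * b) \<le> norm b" "\<And>y. y \<in> C \<Longrightarrow> norm (y - e * y) \<le> \<epsilon>"
proof -
  obtain F where F: "finite F" "F \<subseteq> C" "C \<subseteq> (\<Union>x\<in>F. ball x (\<epsilon>/2))"
  proof (rule compactE_image[OF assms(1), of C "\<lambda>x. ball x (\<epsilon>/2)"])
    show "C \<subseteq> (\<Union>x\<in>C. ball x (\<epsilon>/2))" using assms(2) by auto
  qed auto
  obtain e where e: "\<And>b. norm (b - e * b) \<le> norm b" "\<And>y. y \<in> F \<Longrightarrow> norm (y - e * y) \<le> \<epsilon>/2"
    using approximate_unit_finite[OF F(1), of "\<epsilon>/2"] assms(2) by auto
  have "norm (y - e * y) \<le> \<epsilon>" if "y \<in> C" for y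
  proof -
    obtain x where x: "x \<in> F" "norm (y - x) < \<epsilon>/2" using F(3) \<open>y \<in> C\<close> by (auto simp: dist_norm norm_minus_commute)
    have eq: "norm (y - e * y) = norm (((y - x) - e * (y - x)) + (x - e * x))" by (simp add: algebra_simps)
    show ?thesis using e(1)[of "y - x"] e(2)[OF x(1)] x(2) norm_triangle_ineq[of "(y - x) - e * (y - x)" "x - e * x"] unfolding eq by linarith
  qed
  then show thesis using that e(1) by blast
qed


section \<open>Completely positive maps\<close>

locale cp_map =
  fixes \<phi> :: "'a::cstar_algebra \<Rightarrow> 'h::chilbert_space \<Rightarrow> 'h"
  assumes cp: "completely_positive \<phi>"
begin

lemma clinear: "bounded_clinear (\<phi> a)"
  and add: "\<phi> (a + b) h = \<phi> a h + \<phi> b h"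
  and scaleC: "\<phi> (c *\<^sub>C a) h = c *\<^sub>C \<phi> a h"
  using cp by (auto simp: completely_positive_def)

lemmas apply_simps = bounded_clinearD(2-)[OF clinear]

lemma scaleR: "\<phi> (r *\<^sub>R a) h = r *\<^sub>R \<phi> a h"
  by (simp add: scaleR_scaleC scaleC)

lemma zero: "\<phi> 0 h = 0" using add[of 0 0 h] by simp

lemma minus: "\<phi> (- a) h = - \<phi> a h" using scaleR[of "-1" a h] by simp

lemma diff: "\<phi> (a - b) h = \<phi> a h - \<phi> b h"
  using add[of a "- b" h] by (simp add: minus)

text \<open>The b i form the first row of a square matrix whose other rows vanish.\<close>

lemma positive_row:
  "(\<Sum>i<n. \<Sum>j<n. cinner (h i) (\<phi> (star (b i) * b j) (h j))) \<in> \<real>\<^sub>\<ge>\<^sub>0" for n :: nat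
proof -
  have "positive_matrix n (\<lambda>i j. star (b i) * b j)"
    unfolding positive_matrix_def
  proof (intro exI[of _ "\<lambda>k i. if k = 0 then b i else 0"] allI impI)
    fix i j assume "i < n" "j < n"
    then have "(\<Sum>k<n. star (if k = 0 then b i else 0) * (if k = 0 then b j else 0)) =
      (\<Sum>k<n. if k = 0 then star (b i) * b j else 0)"
      by (intro sum.cong) auto
    with \<open>i < n\<close> show "star (b i) * b j = (\<Sum>k<n. star (if k = 0 then b i else 0) * (if k = 0 then b j else 0))"
      by simp
  qed
  then show ?thesis using cp unfolding completely_positive_def positive_op_matrix_def by blast
qed

lemma positive: "cinner h (\<phi> (star b * b) h) \<in> \<real>\<^sub>\<ge>\<^sub>0"
  using positive_row[where n = 1 and h = "\<lambda>_. h" and b = "\<lambda>_. b"] by simp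

lemma unit_positive_nonneg: "unit_positive p \<Longrightarrow> cinner h (\<phi> p h) \<in> \<real>\<^sub>\<ge>\<^sub>0"
  using unit_positive_root[of p] positive[of h] by metis

text \<open>Gliding hump: violations of size 4^(n+1), summed with weights 2^-(n+1), would give one
  element T whose bounded operator \<phi> T has a bound above 2^(n+1) for every n.\<close>

lemma bounded_on_unit_positive:
  "\<exists>M>0. \<forall>p h. unit_positive p \<longrightarrow> Re (cinner h (\<phi> p h)) \<le> M * (norm h)\<^sup>2"
proof (rule ccontr)
  assume neg: "\<not> ?thesis"
  have "\<exists>p h. unit_positive p \<and> Re (cinner h (\<phi> p h)) > 4 ^ Suc n * (norm h)\<^sup>2" for n
    using neg by (metis not_le zero_less_numeral zero_less_power)
  then obtain p h where p: "\<And>n. unit_positive (p n)"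
    and h: "\<And>n. Re (cinner (h n) (\<phi> (p n) (h n))) > 4 ^ Suc n * (norm (h n))\<^sup>2"
    by metis
  define T where "T = (\<Sum>n. (1/2)^Suc n *\<^sub>R p n)"
  obtain B where nB: "\<And>v. norm (\<phi> T v) \<le> norm v * B"
    using bounded_linear.bounded[OF bounded_clinearD(1)[OF clinear]] by blast
  have "2 ^ Suc n < B" for n
  proof -
    \<comment> \<open>With its n-th term replaced by 0 the sum is still
      \<open>unit_positive\<close>, so the quadratic form of \<phi> T is at least that of the n-th
      term alone.\<close>
    define p' where "p' = p(n := 0)"
    have p': "unit_positive (p' m)" for m by (auto simp: p'_def p unit_positive_zero)
    have A: "(\<lambda>m. (1/2)^Suc m *\<^sub>R p m - (1/2)^Suc m *\<^sub>R p' m) sums (T - (\<Sum>m. (1/2)^Suc m *\<^sub>R p' m))"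
      unfolding T_def using unit_positive_suminf(1)[OF p] unit_positive_suminf(1)[OF p']
      by (intro sums_diff summable_sums)
    have B: "(\<lambda>m. (1/2)^Suc m *\<^sub>R p m - (1/2)^Suc m *\<^sub>R p' m) =
      (\<lambda>m. if m = n then (1/2)^Suc n *\<^sub>R p n else 0)"
      by (auto simp: p'_def)
    have C: "(\<lambda>m. if m = n then (1/2)^Suc n *\<^sub>R p n else 0) sums ((1/2)^Suc n *\<^sub>R p n)"
      by (rule sums_single[of n "\<lambda>_. (1/2)^Suc n *\<^sub>R p n"])
    have "T - (\<Sum>m. (1/2)^Suc m *\<^sub>R p' m) = (1/2)^Suc n *\<^sub>R p n"
      by (rule sums_unique2[OF A[unfolded B] C])
    then have T: "T = (\<Sum>m. (1/2)^Suc m *\<^sub>R p' m) + (1/2)^Suc n *\<^sub>R p n" by (simp add: algebra_simps)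
    have "0 \<le> Re (cinner (h n) (\<phi> (\<Sum>m. (1/2)^Suc m *\<^sub>R p' m) (h n)))"
      using unit_positive_nonneg[OF unit_positive_suminf(2)[OF p']] by (simp add: complex_nonneg_Reals_iff del: power_Suc)
    then have "(1/2)^Suc n * Re (cinner (h n) (\<phi> (p n) (h n))) \<le> Re (cinner (h n) (\<phi> T (h n)))"
      unfolding T add scaleR cinner_add_right cinner_scaleR_right by (simp del: power_Suc)
    also have "\<dots> \<le> norm (h n) * norm (\<phi> T (h n))" by (rule Re_cinner_le)
    also have "\<dots> \<le> norm (h n) * (norm (h n) * B)" by (intro mult_left_mono nB) simp
    finally have "(1/2)^Suc n * Re (cinner (h n) (\<phi> (p n) (h n))) \<le> B * (norm (h n))\<^sup>2"
      by (simp add: power2_eq_square mult_ac)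
    moreover have "(1/2)^Suc n * (4 ^ Suc n * (norm (h n))\<^sup>2) < (1/2)^Suc n * Re (cinner (h n) (\<phi> (p n) (h n)))"
      by (rule mult_strict_left_mono[OF h]) simp
    moreover have "(1/2)^Suc n * (4 ^ Suc n * (norm (h n))\<^sup>2) = 2 ^ Suc n * (norm (h n))\<^sup>2"
    proof -
      have "(1/2)^Suc n * 4 ^ Suc n = (2::real) ^ Suc n" unfolding power_mult_distrib[symmetric] by simp
      then show ?thesis by (simp only: mult.assoc[symmetric])
    qed
    ultimately have "2 ^ Suc n * (norm (h n))\<^sup>2 < B * (norm (h n))\<^sup>2" by linarith
    then show ?thesis by (rule mult_right_less_imp_less) simp
  qed
  then have lt: "2 ^ Suc n < B" for n by blast
  obtain n where "B < 2 ^ n" using real_arch_pow[of 2 B] by auto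
  moreover have "(2::real) ^ n \<le> 2 ^ Suc n" by simp
  ultimately show False using lt[of n] by linarith
qed

lemma selfadjoint_quadratic_real:
  assumes "star x = x"
  shows "Im (cinner h (\<phi> x h)) = 0"
proof -
  define r where "r = norm x + 1"
  have r: "r > 0" by (simp add: r_def add_nonneg_pos)
  obtain p q where pq: "unit_positive p" "unit_positive q" "(1/r) *\<^sub>R x = 2 *\<^sub>R (p - q)"
    using selfadjoint_decomposition[of "(1/r) *\<^sub>R x"] assms r by (auto simp: star_scaleR r_def)
  have "x = r *\<^sub>R ((1/r) *\<^sub>R x)" using r by simp
  also have "\<dots> = (2 * r) *\<^sub>R (p - q)" unfolding pq(3) by simp
  finally show ?thesis
    using unit_positive_nonneg[OF pq(1), of h] unit_positive_nonneg[OF pq(2), of h]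
    by (simp add: scaleR diff cinner_scaleR_right cinner_diff_right complex_nonneg_Reals_iff)
qed

text \<open>The quadratic form is real, so polarisation with k + \<i> h and k + h gives the two
  parts of the symmetry.\<close>

lemma selfadjoint_hermitian:
  assumes "star x = x"
  shows "cinner k (\<phi> x h) = cnj (cinner h (\<phi> x k))"
proof (rule complex_eqI)
  show "Re (cinner k (\<phi> x h)) = Re (cnj (cinner h (\<phi> x k)))"
    using selfadjoint_quadratic_real[OF assms, of "k + \<i> *\<^sub>C h"] selfadjoint_quadratic_real[OF assms, of h]
      selfadjoint_quadratic_real[OF assms, of k]
    by (simp add: apply_simps cinner_add_left cinner_add_right cinner_scaleC_left cinner_scaleC_right)
  show "Im (cinner k (\<phi> x h)) = Im (cnj (cinner h (\<phi> x k)))"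
    using selfadjoint_quadratic_real[OF assms, of "k + h"] selfadjoint_quadratic_real[OF assms, of h]
      selfadjoint_quadratic_real[OF assms, of k]
    by (simp add: apply_simps cinner_add_left cinner_add_right)
qed

lemma hermitian: "cinner k (\<phi> a h) = cnj (cinner h (\<phi> (star a) k))"
proof -
  define x y where "x = (1/2) *\<^sub>R (a + star a)" and "y = (- \<i> / 2) *\<^sub>C (a - star a)"
  have s: "star x = x" "star y = y"
    by (auto simp: x_def y_def star_scaleR star_scaleC star_add star_diff star_star scaleC_diff_right)
  have "\<i> *\<^sub>C y = (1/2) *\<^sub>R (a - star a)" by (simp add: y_def scaleC_scaleC scaleR_scaleC)
  then have a: "a = x + \<i> *\<^sub>C y" and sa: "star a = x + (- \<i>) *\<^sub>C y"
    by (simp_all add: x_def scaleR_add_right scaleR_diff_right flip: scaleR_add_left)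
  show ?thesis
    unfolding sa unfolding a using selfadjoint_hermitian[OF s(1), of k h] selfadjoint_hermitian[OF s(2), of k h]
    by (simp add: add scaleC cinner_add_right cinner_scaleC_right diff cinner_diff_right)
qed

text \<open>Three passages: x = 2 r (p - q) bounds the quadratic form of a self-adjoint x,
  polarisation turns this into an operator bound, and real and imaginary parts reach a general a.
  The last passage turns 2 M into 4 M.\<close>

lemma bounded_ex: "\<exists>M\<ge>0. \<forall>a h. norm (\<phi> a h) \<le> M * norm a * norm h"
proof -
  obtain M where M: "M > 0" "\<And>p h. unit_positive p \<Longrightarrow> Re (cinner h (\<phi> p h)) \<le> M * (norm h)\<^sup>2"
    using bounded_on_unit_positive by blast
  have quad: "\<bar>Re (cinner h (\<phi> x h))\<bar> \<le> 2 * M * norm x * (norm h)\<^sup>2" if sx: "star x = x" for x h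
  proof (cases "x = 0")
    case False
    define r where "r = norm x"
    have r: "r > 0" using False by (simp add: r_def)
    obtain p q where pq: "unit_positive p" "unit_positive q" "(1/r) *\<^sub>R x = 2 *\<^sub>R (p - q)"
      using selfadjoint_decomposition[of "(1/r) *\<^sub>R x"] sx r by (auto simp: star_scaleR r_def)
    have "x = r *\<^sub>R ((1/r) *\<^sub>R x)" using r by simp
    also have "\<dots> = (2 * r) *\<^sub>R (p - q)" unfolding pq(3) by simp
    finally have x: "x = (2 * r) *\<^sub>R (p - q)" .
    have "Re (cinner h (\<phi> x h)) = 2 * r * (Re (cinner h (\<phi> p h)) - Re (cinner h (\<phi> q h)))"
      by (subst x) (simp add: scaleR diff cinner_scaleR_right cinner_diff_right right_diff_distrib)
    moreover have "\<bar>Re (cinner h (\<phi> p h)) - Re (cinner h (\<phi> q h))\<bar> \<le> M * (norm h)\<^sup>2"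
      using unit_positive_nonneg[OF pq(1), of h] unit_positive_nonneg[OF pq(2), of h]
        M(2)[OF pq(1), of h] M(2)[OF pq(2), of h] by (auto simp: complex_nonneg_Reals_iff)
    ultimately have "\<bar>Re (cinner h (\<phi> x h))\<bar> \<le> 2 * r * (M * (norm h)\<^sup>2)"
      using r by (simp add: abs_mult)
    then show ?thesis by (simp add: r_def mult_ac)
  qed (simp add: zero)
  have sab: "norm (\<phi> x h) \<le> 2 * M * norm x * norm h" if sx: "star x = x" for x h
  proof (cases "\<phi> x h = 0 \<or> h = 0")
    case False
    \<comment> \<open>k points along \<phi> x h and has the norm of h, so the parallelogram law
      returns a multiple of the squared norm of h.\<close>
    define k where "k = (norm h / norm (\<phi> x h)) *\<^sub>R \<phi> x h"
    have nk: "norm k = norm h" using False by (simp add: k_def)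
    have "Re (cinner k (\<phi> x h)) = norm h * norm (\<phi> x h)"
      using False by (simp add: k_def cinner_scaleR_left cinner_self power2_eq_square)
    moreover have "Re (cinner h (\<phi> x k)) = Re (cinner k (\<phi> x h))"
      using selfadjoint_hermitian[OF sx, of h k] by simp
    ultimately have "4 * (norm h * norm (\<phi> x h)) = Re (cinner (k + h) (\<phi> x (k + h))) - Re (cinner (k - h) (\<phi> x (k - h)))"
      by (simp add: apply_simps cinner_add_left cinner_add_right cinner_diff_left cinner_diff_right)
    also have "\<dots> \<le> 2 * M * norm x * (norm (k + h))\<^sup>2 + 2 * M * norm x * (norm (k - h))\<^sup>2"
      using quad[OF sx, of "k + h"] quad[OF sx, of "k - h"] by linarith
    also have "\<dots> = 2 * M * norm x * ((norm (k + h))\<^sup>2 + (norm (k - h))\<^sup>2)"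
      by (simp add: distrib_left)
    also have "(norm (k + h))\<^sup>2 + (norm (k - h))\<^sup>2 = 4 * (norm h)\<^sup>2"
      by (simp add: norm_add_square norm_diff_square nk)
    finally have "norm h * norm (\<phi> x h) \<le> norm h * (2 * M * norm x * norm h)"
      by (simp add: power2_eq_square mult_ac)
    then show ?thesis using False by simp
  qed (use M(1) in \<open>auto simp: apply_simps\<close>)
  have "norm (\<phi> a h) \<le> 4 * M * norm a * norm h" for a h
  proof -
    define x y where "x = (1/2) *\<^sub>R (a + star a)" and "y = (- \<i> / 2) *\<^sub>C (a - star a)"
    have s: "star x = x" "star y = y"
      by (auto simp: x_def y_def star_scaleR star_scaleC star_add star_diff star_star scaleC_diff_right)
    have nx: "norm x \<le> norm a" using norm_triangle_ineq[of a "star a"] by (simp add: x_def)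
    have ny: "norm y \<le> norm a" using norm_triangle_ineq4[of a "star a"] by (simp add: y_def norm_scaleC norm_divide)
    have "\<i> *\<^sub>C y = (1/2) *\<^sub>R (a - star a)" by (simp add: y_def scaleC_scaleC scaleR_scaleC)
    then have a: "a = x + \<i> *\<^sub>C y" 
      by (simp add: x_def scaleR_add_right scaleR_diff_right flip: scaleR_add_left)
    have "norm (\<phi> a h) \<le> norm (\<phi> x h) + norm (\<phi> y h)"
      by (subst a) (use norm_triangle_ineq[of "\<phi> x h" "\<i> *\<^sub>C \<phi> y h"] in \<open>simp add: add scaleC norm_scaleC\<close>)
    also have "\<dots> \<le> 2 * M * norm a * norm h + 2 * M * norm a * norm h"
    proof (rule add_mono)
      show "norm (\<phi> x h) \<le> 2 * M * norm a * norm h"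
        using sab[OF s(1), of h] nx M(1) by (smt (verit) mult_left_mono mult_right_mono norm_ge_zero)
      show "norm (\<phi> y h) \<le> 2 * M * norm a * norm h"
        using sab[OF s(2), of h] ny M(1) by (smt (verit) mult_left_mono mult_right_mono norm_ge_zero)
    qed
    finally show ?thesis by simp
  qed
  then show ?thesis using M(1) by (intro exI[of _ "4 * M"]) auto
qed

lemma bounded_bilinear: "bounded_bilinear \<phi>"
proof -
  obtain M where "\<forall>a h. norm (\<phi> a h) \<le> M * norm a * norm h" using bounded_ex by blast
  then show ?thesis
    by (intro bounded_bilinear.intro exI[of _ M]) (auto simp: add apply_simps scaleR mult_ac)
qed

lemmas continuous_on_apply [continuous_intros] = bounded_bilinear.continuous_on [OF bounded_bilinear]

text \<open>For c = star a * a / r there is a self-adjoint w with (1 - w)^2 = 1 - c. Positivity of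
  the row b i - w * b i is then the claimed inequality; it makes left multiplication by a bounded on
  the dilation space.\<close>

lemma left_mult_contraction:
  "Re (\<Sum>i<n. \<Sum>j<n. cinner (h i) (\<phi> (star (a * b i) * (a * b j)) (h j))) \<le>
    (norm a)\<^sup>2 * Re (\<Sum>i<n. \<Sum>j<n. cinner (h i) (\<phi> (star (b i) * b j) (h j)))" for n :: nat
proof (cases "a = 0")
  case False
  define r where "r = (norm a)\<^sup>2"
  have r: "r > 0" using False by (simp add: r_def)
  define c where "c = (1/r) *\<^sub>R (star a * a)"
  have "norm c \<le> 1" using r by (simp add: c_def cstar_identity r_def)
  moreover have "star c = c" by (simp add: c_def star_scaleR star_mult star_star)
  ultimately obtain w where w: "2 *\<^sub>R w = c + w * w" "star w = w"
    using one_minus_contraction_root by blast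
  have eq: "star (b i - w * b i) * (b j - w * b j) = star (b i) * b j - (1/r) *\<^sub>R (star (a * b i) * (a * b j))" for i j
  proof -
    have "star (b i - w * b i) * (b j - w * b j) = star (b i) * b j - star (b i) * ((2 *\<^sub>R w - w * w) * b j)"
      by (simp add: star_diff star_mult w(2) algebra_simps scaleR_2)
    also have "2 *\<^sub>R w - w * w = c" using w(1) by simp
    finally show ?thesis by (simp add: c_def star_mult mult.assoc)
  qed
  have "0 \<le> Re (\<Sum>i<n. \<Sum>j<n. cinner (h i) (\<phi> (star (b i - w * b i) * (b j - w * b j)) (h j)))"
    using positive_row[where b = "\<lambda>i. b i - w * b i" and h = h and n = n] by (simp add: complex_nonneg_Reals_iff)
  also have "\<dots> = Re (\<Sum>i<n. \<Sum>j<n. cinner (h i) (\<phi> (star (b i) * b j) (h j))) -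
      (1/r) * Re (\<Sum>i<n. \<Sum>j<n. cinner (h i) (\<phi> (star (a * b i) * (a * b j)) (h j)))"
    unfolding eq diff scaleR cinner_diff_right cinner_scaleR_right sum_subtractf
    by (simp add: sum_distrib_left)
  finally show ?thesis using r by (simp add: r_def[symmetric] field_simps)
qed (simp add: zero)

end

section \<open>Vector-valued integrals of continuous compactly supported functions\<close>

lemma CcI:
  fixes f :: "'g::t2_space \<Rightarrow> 'b::real_normed_vector"
  assumes "continuous_on UNIV f" "compact K" "\<And>t. t \<notin> K \<Longrightarrow> f t = 0"
  shows "f \<in> Cc"
proof -
  have "closure {t. f t \<noteq> 0} \<subseteq> K"
    using assms(2,3) by (intro closure_minimal compact_imp_closed) auto
  then have "compact (closure {t. f t \<noteq> 0})"
    using assms(2) by (metis closed_closure compact_Int_closed inf.absorb2)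
  with assms(1) show ?thesis by (simp add: Cc_def)
qed

lemma CcD:
  assumes "f \<in> Cc"
  shows "continuous_on UNIV f" "\<exists>K. compact K \<and> (\<forall>t. t \<notin> K \<longrightarrow> f t = 0)"
  using assms closure_subset[of "{t. f t \<noteq> 0}"] by (auto simp: Cc_def)

lemma Cc_compose:
  fixes f :: "'g::t2_space \<Rightarrow> 'b::real_normed_vector"
  assumes f: "f \<in> Cc" and "continuous_on UNIV (\<lambda>t. T t (f t))" "\<And>t. T t 0 = 0"
  shows "(\<lambda>t. T t (f t)) \<in> Cc"
  using CcD(2)[OF f] assms(2,3) by (auto intro!: CcI)

section \<open>Bochner integrals with values in non-separable spaces\<close>

text \<open>Differences of Borel functions need not be Borel in a non-separable space. Subtracting a
  simple function is harmless: it subtracts a constant on each of finitely many measurable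
  pieces.\<close>

lemma borel_measurable_diff_simple_function:
  fixes f :: "'a \<Rightarrow> 'b::real_normed_vector"
  assumes f: "f \<in> borel_measurable M" and s: "simple_function M s"
  shows "(\<lambda>t. f t - s t) \<in> borel_measurable M"
proof (rule measurable_compose_countable'[where f = "\<lambda>y t. f t - y" and I = "s ` space M"])
  fix y show "(\<lambda>t. f t - y) \<in> borel_measurable M"
    by (rule borel_measurable_continuous_on[OF _ f]) (intro continuous_intros)
next
  show "s \<in> M \<rightarrow>\<^sub>M count_space (s ` space M)"
    using s by (subst measurable_count_space_eq2) (auto simp: simple_function_def)
next
  show "countable (s ` space M)" using s by (simp add: simple_function_def countable_finite)
qed

lemma borel_measurable_norm_diff_simple_function:
  fixes f :: "'a \<Rightarrow> 'b::real_normed_vector"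
  assumes "f \<in> borel_measurable M" "simple_function M s"
  shows "(\<lambda>t. ennreal (norm (f t - s t))) \<in> borel_measurable M"
  using borel_measurable_diff_simple_function[OF assms, measurable] by measurable

lemma simple_bochner_integral_dist:
  fixes s t :: "'a \<Rightarrow> 'b::real_normed_vector"
  assumes "Bochner_Integration.simple_bochner_integrable M s" "Bochner_Integration.simple_bochner_integrable M t"
  shows "ennreal (norm (Bochner_Integration.simple_bochner_integral M s - Bochner_Integration.simple_bochner_integral M t))
    \<le> (\<integral>\<^sup>+x. ennreal (norm (s x - t x)) \<partial>M)"
proof -
  have "ennreal (norm (Bochner_Integration.simple_bochner_integral M s - Bochner_Integration.simple_bochner_integral M t))
      = norm (Bochner_Integration.simple_bochner_integral M (\<lambda>x. s x - t x))"
    using assms by (simp add: simple_bochner_integral_diff)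
  also have "\<dots> \<le> Bochner_Integration.simple_bochner_integral M (\<lambda>x. norm (s x - t x))"
    using simple_bochner_integrable_compose2[of "(-)" M s t] assms
    by (intro ennreal_leI simple_bochner_integral_norm_bound) simp
  also have "\<dots> = (\<integral>\<^sup>+x. norm (s x - t x) \<partial>M)"
    using simple_bochner_integrable_compose2[of "\<lambda>x y. norm (x - y)" M s t] assms
    by (intro simple_bochner_integral_eq_nn_integral) auto
  finally show ?thesis .
qed

lemma norm_has_vector_integral_le:
  assumes "has_vector_integral M f v"
  shows "ennreal (norm v) \<le> (\<integral>\<^sup>+t. ennreal (norm (f t)) \<partial>M)"
proof -
  obtain s where f: "f \<in> borel_measurable M"
    and s: "\<And>i. Bochner_Integration.simple_bochner_integrable M (s i)"
      "(\<lambda>i. \<integral>\<^sup>+t. ennreal (norm (f t - s i t)) \<partial>M) \<longlonglongrightarrow> 0"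
      "(\<lambda>i. Bochner_Integration.simple_bochner_integral M (s i)) \<longlonglongrightarrow> v"
    using assms unfolding has_vector_integral_def by blast
  have sf: "simple_function M (s i)" for i using s(1)[of i] by (auto elim: simple_bochner_integrable.cases)
  have z: "Bochner_Integration.simple_bochner_integrable M (\<lambda>_. 0::'b)"
    by (auto intro: simple_bochner_integrable.intros)
  have z0: "Bochner_Integration.simple_bochner_integral M (\<lambda>_. 0::'b) = 0"
    by (auto simp: simple_bochner_integral_def intro!: sum.neutral)
  have *: "ennreal (norm (Bochner_Integration.simple_bochner_integral M (s i)))
      \<le> (\<integral>\<^sup>+t. ennreal (norm (f t)) \<partial>M) + (\<integral>\<^sup>+t. ennreal (norm (f t - s i t)) \<partial>M)" for i
  proof -
    have "ennreal (norm (Bochner_Integration.simple_bochner_integral M (s i))) \<le> (\<integral>\<^sup>+t. ennreal (norm (s i t)) \<partial>M)"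
      using simple_bochner_integral_dist[OF s(1) z, of i] by (simp add: z0)
    also have "\<dots> \<le> (\<integral>\<^sup>+t. ennreal (norm (f t)) + ennreal (norm (f t - s i t)) \<partial>M)"
    proof (rule nn_integral_mono)
      fix t
      have "norm (s i t) \<le> norm (f t) + norm (f t - s i t)"
        using norm_triangle_ineq4[of "f t" "f t - s i t"] by simp
      then show "ennreal (norm (s i t)) \<le> ennreal (norm (f t)) + ennreal (norm (f t - s i t))"
        by (simp flip: ennreal_plus)
    qed
    also have "\<dots> = (\<integral>\<^sup>+t. ennreal (norm (f t)) \<partial>M) + (\<integral>\<^sup>+t. ennreal (norm (f t - s i t)) \<partial>M)"
      using f by (intro nn_integral_add borel_measurable_norm_diff_simple_function sf) measurable
    finally show ?thesis .
  qed
  have A: "(\<lambda>i. (\<integral>\<^sup>+t. ennreal (norm (f t)) \<partial>M) + (\<integral>\<^sup>+t. ennreal (norm (f t - s i t)) \<partial>M))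
      \<longlonglongrightarrow> (\<integral>\<^sup>+t. ennreal (norm (f t)) \<partial>M) + 0"
    by (intro tendsto_add tendsto_const s(2))
  have B: "(\<lambda>i. ennreal (norm (Bochner_Integration.simple_bochner_integral M (s i)))) \<longlonglongrightarrow> ennreal (norm v)"
    by (intro tendsto_ennrealI tendsto_norm s(3))
  have "ennreal (norm v) \<le> (\<integral>\<^sup>+t. ennreal (norm (f t)) \<partial>M) + 0"
    by (rule LIMSEQ_le[OF B A]) (use * in blast)
  then show ?thesis by simp
qed

text \<open>Measurability of the difference is an assumption because it does not follow from that of
  f and g. It is immediate for f = g, which gives uniqueness, and for continuous functions.\<close>

lemma has_vector_integral_diff:
  assumes f: "has_vector_integral M f v" and g: "has_vector_integral M g w"
    and m: "(\<lambda>t. f t - g t) \<in> borel_measurable M"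
  shows "has_vector_integral M (\<lambda>t. f t - g t) (v - w)"
proof -
  obtain s where mf: "f \<in> borel_measurable M"
    and s: "\<And>i. Bochner_Integration.simple_bochner_integrable M (s i)"
      "(\<lambda>i. \<integral>\<^sup>+t. ennreal (norm (f t - s i t)) \<partial>M) \<longlonglongrightarrow> 0"
      "(\<lambda>i. Bochner_Integration.simple_bochner_integral M (s i)) \<longlonglongrightarrow> v"
    using f unfolding has_vector_integral_def by blast
  obtain r where mg: "g \<in> borel_measurable M"
    and r: "\<And>i. Bochner_Integration.simple_bochner_integrable M (r i)"
      "(\<lambda>i. \<integral>\<^sup>+t. ennreal (norm (g t - r i t)) \<partial>M) \<longlonglongrightarrow> 0"
      "(\<lambda>i. Bochner_Integration.simple_bochner_integral M (r i)) \<longlonglongrightarrow> w"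
    using g unfolding has_vector_integral_def by blast
  have sf: "simple_function M (s i)" "simple_function M (r i)" for i
    using s(1)[of i] r(1)[of i] by (auto elim: simple_bochner_integrable.cases)
  show ?thesis
    unfolding has_vector_integral_def
  proof (intro conjI m exI[of _ "\<lambda>i t. s i t - r i t"] allI)
    show "Bochner_Integration.simple_bochner_integrable M (\<lambda>t. s i t - r i t)" for i
      by (rule simple_bochner_integrable_compose2[OF _ s(1) r(1)]) simp
    show "(\<lambda>i. Bochner_Integration.simple_bochner_integral M (\<lambda>t. s i t - r i t)) \<longlonglongrightarrow> v - w"
      unfolding simple_bochner_integral_diff[OF s(1) r(1)] by (intro tendsto_intros s r)
    let ?u = "\<lambda>i. (\<integral>\<^sup>+t. ennreal (norm (f t - s i t)) \<partial>M) + (\<integral>\<^sup>+t. ennreal (norm (g t - r i t)) \<partial>M)"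
    show "(\<lambda>i. \<integral>\<^sup>+t. ennreal (norm (f t - g t - (s i t - r i t))) \<partial>M) \<longlonglongrightarrow> 0"
    proof (rule tendsto_sandwich[where f = "\<lambda>_. 0" and h = ?u])
      show "\<forall>\<^sub>F i in sequentially. (\<integral>\<^sup>+t. ennreal (norm (f t - g t - (s i t - r i t))) \<partial>M) \<le> ?u i"
      proof (intro always_eventually allI)
        fix i
        have "(\<integral>\<^sup>+t. ennreal (norm (f t - g t - (s i t - r i t))) \<partial>M)
            \<le> (\<integral>\<^sup>+t. ennreal (norm (f t - s i t)) + ennreal (norm (g t - r i t)) \<partial>M)"
        proof (rule nn_integral_mono)
          fix t
          have "f t - g t - (s i t - r i t) = (f t - s i t) - (g t - r i t)" by simp
          then have "norm (f t - g t - (s i t - r i t)) \<le> norm (f t - s i t) + norm (g t - r i t)"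
            by (metis norm_triangle_ineq4)
          then show "ennreal (norm (f t - g t - (s i t - r i t))) \<le> ennreal (norm (f t - s i t)) + ennreal (norm (g t - r i t))"
            by (simp flip: ennreal_plus)
        qed
        also have "\<dots> = ?u i"
          by (intro nn_integral_add borel_measurable_norm_diff_simple_function mf mg sf)
        finally show "(\<integral>\<^sup>+t. ennreal (norm (f t - g t - (s i t - r i t))) \<partial>M) \<le> ?u i" .
      qed
      show "?u \<longlonglongrightarrow> 0" using tendsto_add[OF s(2) r(2)] by simp
    qed (auto intro!: always_eventually)
  qed
qed

lemma has_vector_integral_unique:
  assumes "has_vector_integral M f v" "has_vector_integral M f w"
  shows "v = w"
proof -
  have "has_vector_integral M (\<lambda>t. f t - f t) (v - w)"
    using assms by (rule has_vector_integral_diff) simp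
  from norm_has_vector_integral_le[OF this] show ?thesis by simp
qed

lemma vector_integral_eq: "has_vector_integral M f v \<Longrightarrow> vector_integral M f = v"
  unfolding vector_integral_def using has_vector_integral_unique by blast

lemma has_vector_integral_linear:
  assumes T: "bounded_linear T" and f: "has_vector_integral M f v"
  shows "has_vector_integral M (\<lambda>t. T (f t)) (T v)"
proof -
  interpret T: bounded_linear T by fact
  obtain s where mf: "f \<in> borel_measurable M"
    and s: "\<And>i. Bochner_Integration.simple_bochner_integrable M (s i)"
      "(\<lambda>i. \<integral>\<^sup>+t. ennreal (norm (f t - s i t)) \<partial>M) \<longlonglongrightarrow> 0"
      "(\<lambda>i. Bochner_Integration.simple_bochner_integral M (s i)) \<longlonglongrightarrow> v"
    using f unfolding has_vector_integral_def by blast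
  have sf: "simple_function M (s i)" for i
    using s(1)[of i] by (auto elim: simple_bochner_integrable.cases)
  obtain K where K: "K > 0" "\<And>x. norm (T x) \<le> norm x * K" using T.pos_bounded by blast
  show ?thesis
    unfolding has_vector_integral_def
  proof (intro conjI exI[of _ "\<lambda>i t. T (s i t)"] allI)
    show "(\<lambda>t. T (f t)) \<in> borel_measurable M"
      by (rule borel_measurable_continuous_on[OF T.continuous_on mf]) (rule continuous_on_id)
    show "Bochner_Integration.simple_bochner_integrable M (\<lambda>t. T (s i t))" for i
      using simple_bochner_integrable_compose2[where p = "\<lambda>x _. T x" and f = "s i" and g = "s i"] s(1) T.zero by simp
    show "(\<lambda>i. Bochner_Integration.simple_bochner_integral M (\<lambda>t. T (s i t))) \<longlonglongrightarrow> T v"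
      unfolding simple_bochner_integral_linear[OF T.linear_axioms s(1)] by (rule T.tendsto[OF s(3)])
    show "(\<lambda>i. \<integral>\<^sup>+t. ennreal (norm (T (f t) - T (s i t))) \<partial>M) \<longlonglongrightarrow> 0"
    proof (rule tendsto_sandwich[where f = "\<lambda>_. 0" and h = "\<lambda>i. ennreal K * (\<integral>\<^sup>+t. ennreal (norm (f t - s i t)) \<partial>M)"])
      show "\<forall>\<^sub>F i in sequentially. (\<integral>\<^sup>+t. ennreal (norm (T (f t) - T (s i t))) \<partial>M)
          \<le> ennreal K * (\<integral>\<^sup>+t. ennreal (norm (f t - s i t)) \<partial>M)"
      proof (intro always_eventually allI)
        fix i
        have "(\<integral>\<^sup>+t. ennreal (norm (T (f t) - T (s i t))) \<partial>M) \<le> (\<integral>\<^sup>+t. ennreal K * ennreal (norm (f t - s i t)) \<partial>M)"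
          using K(1) by (intro nn_integral_mono)
             (simp add: K(2)[unfolded mult.commute[of _ K]] flip: ennreal_mult T.diff)
        also have "\<dots> = ennreal K * (\<integral>\<^sup>+t. ennreal (norm (f t - s i t)) \<partial>M)"
          by (intro nn_integral_cmult borel_measurable_norm_diff_simple_function mf sf)
        finally show "(\<integral>\<^sup>+t. ennreal (norm (T (f t) - T (s i t))) \<partial>M)
          \<le> ennreal K * (\<integral>\<^sup>+t. ennreal (norm (f t - s i t)) \<partial>M)" .
      qed
      show "(\<lambda>i. ennreal K * (\<integral>\<^sup>+t. ennreal (norm (f t - s i t)) \<partial>M)) \<longlonglongrightarrow> 0"
        using ennreal_tendsto_cmult[OF _ s(2), of "ennreal K"] by simp
    qed (auto intro!: always_eventually)
  qed
qed

lemma has_vector_integral_iff_bochner: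
  "has_vector_integral M f v \<longleftrightarrow> has_bochner_integral M f v"
  unfolding has_vector_integral_def has_bochner_integral.simps by auto

section \<open>Fine partitions and Riemann sums\<close>

lemma continuous_on_prod_compact_ex:
  fixes F :: "'a::topological_space \<times> 'b::topological_space \<Rightarrow> 'c::metric_space"
  assumes "continuous_on (U \<times> C) F" "compact C" "x0 \<in> U" "e > 0"
  shows "\<exists>V. x0 \<in> V \<and> open V \<and> (\<forall>x\<in>V \<inter> U. \<forall>t\<in>C. dist (F (x, t)) (F (x0, t)) \<le> e)"
  by (rule continuous_on_prod_compactE[OF assms]) blast

text \<open>One partition with one choice of tags serves both variables. Double integrals can then
  be replaced by quadratic forms in finitely many vectors, which is how positivity and norm
  estimates enter.\<close>

lemma fine_partition:
  fixes F :: "'g::t2_space \<times> 'g \<Rightarrow> 'm::metric_space"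
  assumes F: "continuous_on (K \<times> K) F" and K: "compact K" and e: "e > 0"
  obtains P \<tau> where "finite P" "disjoint P" "\<Union>P = K" "\<And>E. E \<in> P \<Longrightarrow> E \<in> sets borel \<and> \<tau> E \<in> E"
    "\<And>E E' s t. E \<in> P \<Longrightarrow> E' \<in> P \<Longrightarrow> s \<in> E \<Longrightarrow> t \<in> E' \<Longrightarrow> dist (F (s, t)) (F (\<tau> E, \<tau> E')) < e"
proof -
  have F': "continuous_on (K \<times> K) (\<lambda>p. F (snd p, fst p))"
    by (rule continuous_on_compose2[OF F])
       (intro continuous_on_Pair continuous_on_fst continuous_on_snd continuous_on_id, auto)
  \<comment> \<open>Two points of a cell are compared through the centre of a common cover set. This
    costs 2 e / 5 in each variable, hence 4 e / 5 in total.\<close>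
  have "\<exists>U. x \<in> U \<and> open U \<and> (\<forall>y\<in>U \<inter> K. \<forall>t\<in>K. dist (F (y, t)) (F (x, t)) \<le> e/5 \<and> dist (F (t, y)) (F (t, x)) \<le> e/5)"
    if xK: "x \<in> K" for x
  proof -
    obtain U where "x \<in> U" "open U" "\<forall>y\<in>U \<inter> K. \<forall>t\<in>K. dist (F (y, t)) (F (x, t)) \<le> e/5"
      using continuous_on_prod_compact_ex[OF F K xK, of "e/5"] e by (simp; blast)
    moreover obtain V where "x \<in> V" "open V" "\<forall>y\<in>V \<inter> K. \<forall>t\<in>K. dist (F (t, y)) (F (t, x)) \<le> e/5"
      using continuous_on_prod_compact_ex[OF F' K xK, of "e/5"] e by (simp; blast)
    ultimately show ?thesis by (intro exI[of _ "U \<inter> V"]) auto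
  qed
  then have "\<exists>U. \<forall>x\<in>K. x \<in> U x \<and> open (U x) \<and>
      (\<forall>y\<in>U x \<inter> K. \<forall>t\<in>K. dist (F (y, t)) (F (x, t)) \<le> e/5 \<and> dist (F (t, y)) (F (t, x)) \<le> e/5)"
    by (intro bchoice) blast
  then obtain U where U: "\<And>x. x \<in> K \<Longrightarrow> x \<in> U x" "\<And>x. x \<in> K \<Longrightarrow> open (U x)"
    "\<And>x y t. x \<in> K \<Longrightarrow> y \<in> U x \<inter> K \<Longrightarrow> t \<in> K \<Longrightarrow> dist (F (y, t)) (F (x, t)) \<le> e/5"
    "\<And>x y t. x \<in> K \<Longrightarrow> y \<in> U x \<inter> K \<Longrightarrow> t \<in> K \<Longrightarrow> dist (F (t, y)) (F (t, x)) \<le> e/5"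
    by blast
  obtain D where D: "D \<subseteq> K" "finite D" "K \<subseteq> (\<Union>x\<in>D. U x)"
  proof (rule compactE_image[OF K, of K U])
    show "K \<subseteq> (\<Union>c\<in>K. U c)" using U(1) by blast
  qed (use U(2) in auto)
  \<comment> \<open>The atoms of the finite cover: points lying in exactly the same cover
    sets.\<close>
  define cell where "cell A = {x \<in> K. {s \<in> D. x \<in> U s} = A}" for A
  define P where "P = cell ` Pow D - {{}}"
  define \<tau> where "\<tau> E = (SOME x. x \<in> E)" for E :: "'g set"
  have \<tau>: "\<tau> E \<in> E" if "E \<in> P" for E
    using that some_in_eq[of E] by (auto simp: P_def \<tau>_def)
  have cellK: "E \<subseteq> K" if "E \<in> P" for E using that by (auto simp: P_def cell_def)
  have near: "\<exists>s\<in>K. x \<in> U s \<inter> K \<and> y \<in> U s \<inter> K" if E: "E \<in> P" and x: "x \<in> E" and y: "y \<in> E" for E x y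
  proof -
    obtain s where s: "s \<in> D" "x \<in> U s" using D(3) cellK[OF E] x by blast
    have "y \<in> U s" using E x y s by (auto simp: P_def cell_def)
    then show ?thesis using s D(1) cellK[OF E] x y by blast
  qed
  have near1: "dist (F (x, t)) (F (y, t)) \<le> 2 * e / 5" "dist (F (t, x)) (F (t, y)) \<le> 2 * e / 5"
    if mem: "E \<in> P" "x \<in> E" "y \<in> E" "t \<in> K" for E x y t
  proof -
    obtain s where s: "s \<in> K" "x \<in> U s \<inter> K" "y \<in> U s \<inter> K" using near[OF mem(1-3)] by blast
    show "dist (F (x, t)) (F (y, t)) \<le> 2 * e / 5"
      using dist_triangle2[of "F (x, t)" "F (y, t)" "F (s, t)"] U(3)[OF s(1,2) mem(4)] U(3)[OF s(1,3) mem(4)] by linarith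
    show "dist (F (t, x)) (F (t, y)) \<le> 2 * e / 5"
      using dist_triangle2[of "F (t, x)" "F (t, y)" "F (t, s)"] U(4)[OF s(1,2) mem(4)] U(4)[OF s(1,3) mem(4)] by linarith
  qed
  show thesis
  proof (rule that[of P \<tau>])
    show "finite P" using D(2) by (simp add: P_def)
    show "disjoint P"
      unfolding disjoint_def
    proof (intro ballI impI)
      fix E E' assume "E \<in> P" "E' \<in> P" "E \<noteq> E'"
      then obtain A A' where "E = cell A" "E' = cell A'" "A \<noteq> A'" by (auto simp: P_def)
      then show "E \<inter> E' = {}" unfolding cell_def by blast
    qed
    show "\<Union>P = K"
    proof
      show "K \<subseteq> \<Union>P"
      proof
        fix x assume "x \<in> K"
        then have "x \<in> cell {s \<in> D. x \<in> U s}" "{s \<in> D. x \<in> U s} \<in> Pow D" by (auto simp: cell_def)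
        then show "x \<in> \<Union>P" unfolding P_def by blast
      qed
    qed (use cellK in blast)
    fix E assume E: "E \<in> P"
    then obtain A where A: "E = cell A" "A \<subseteq> D" by (auto simp: P_def)
    have "E = K - (\<Union>s\<in>A. K - U s) - (\<Union>s\<in>D - A. U s)"
      using A(2) unfolding A(1) cell_def by blast
    moreover have "K - (\<Union>s\<in>A. K - U s) - (\<Union>s\<in>D - A. U s) \<in> sets borel"
    proof (intro sets.Diff sets.finite_UN)
      show "finite A" "finite (D - A)" using A(2) D(2) finite_subset by auto
      show "K \<in> sets borel" "K \<in> sets borel" using K by (auto intro: borel_compact)
      show "U s \<in> sets borel" if "s \<in> A" for s using that A(2) D(1) U(2) by (intro borel_open) auto
      show "U s \<in> sets borel" if "s \<in> D - A" for s using that D(1) U(2) by (intro borel_open) auto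
    qed
    ultimately show "E \<in> sets borel \<and> \<tau> E \<in> E" using \<tau>[OF E] by simp
    fix E' s t assume E': "E' \<in> P" and st: "s \<in> E" "t \<in> E'"
    have "dist (F (s, t)) (F (\<tau> E, t)) \<le> 2 * e / 5" by (rule near1(1)[OF E st(1) \<tau>[OF E]]) (use cellK E' st in blast)
    moreover have "dist (F (\<tau> E, t)) (F (\<tau> E, \<tau> E')) \<le> 2 * e / 5"
      by (rule near1(2)[OF E' st(2) \<tau>[OF E']]) (use cellK E \<tau>[OF E] in blast)
    ultimately show "dist (F (s, t)) (F (\<tau> E, \<tau> E')) < e"
      using dist_triangle[of "F (s, t)" "F (\<tau> E, \<tau> E')" "F (\<tau> E, t)"] e by linarith
  qed
qed

locale compact_finite_measure =
  fixes \<mu> :: "'g::t2_space measure"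
  assumes sets_eq: "sets \<mu> = sets borel" and finite_compact: "compact K \<Longrightarrow> emeasure \<mu> K < \<infinity>"
begin

lemma space_eq: "space \<mu> = UNIV" using sets_eq_imp_space_eq[OF sets_eq] by simp

lemma continuous_borel: "continuous_on UNIV f \<Longrightarrow> f \<in> borel_measurable \<mu>"
  using borel_measurable_continuous_onI[of f] by (simp add: measurable_cong_sets[OF sets_eq refl])

lemma compact_sets: "compact K \<Longrightarrow> K \<in> sets \<mu>" by (simp add: sets_eq borel_compact)

text \<open>Reading f as a function of the first of two variables makes
  \<open>fine_partition\<close> applicable.\<close>

lemma simple_approximation:
  fixes f :: "'g \<Rightarrow> 'b::real_normed_vector"
  assumes f: "continuous_on UNIV f" and K: "compact K" and z: "\<And>t. t \<notin> K \<Longrightarrow> f t = 0" and e: "e > 0"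
  obtains s where "Bochner_Integration.simple_bochner_integrable \<mu> s"
    "\<And>t. norm (f t - s t) \<le> e * indicator K t"
proof -
  have "continuous_on (K \<times> K) (\<lambda>p. f (fst p))"
    by (rule continuous_on_compose2[OF f]) (intro continuous_on_fst continuous_on_id, auto)
  then obtain P \<tau> where P: "finite P" "disjoint P" "\<Union>P = K" "\<And>E. E \<in> P \<Longrightarrow> E \<in> sets borel \<and> \<tau> E \<in> E"
    "\<And>E E' s t. E \<in> P \<Longrightarrow> E' \<in> P \<Longrightarrow> s \<in> E \<Longrightarrow> t \<in> E' \<Longrightarrow> dist (f s) (f (\<tau> E)) < e"
    by (rule fine_partition[OF _ K e]) auto
  define s where "s t = (\<Sum>E\<in>P. indicator E t *\<^sub>R f (\<tau> E))" for t
  have s_eq: "s t = f (\<tau> E)" if "E \<in> P" "t \<in> E" for E t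
  proof -
    have "s t = (\<Sum>E'\<in>P. if E' = E then f (\<tau> E) else 0)"
      unfolding s_def using that P(2) by (intro sum.cong) (auto simp: disjoint_def indicator_def)
    then show ?thesis using that P(1) by simp
  qed
  have s0: "s t = 0" if "t \<notin> K" for t
    unfolding s_def using that P(3) by (intro sum.neutral) auto
  show thesis
  proof (rule that[of s])
    have "simple_function \<mu> (\<lambda>t. indicator E t *\<^sub>R f (\<tau> E))" if "E \<in> P" for E
      using P(4)[OF that] by (intro simple_function_compose1[where g = "\<lambda>r. r *\<^sub>R f (\<tau> E)"] simple_function_indicator)
        (simp add: sets_eq)
    then have "simple_function \<mu> s" unfolding s_def by (rule simple_function_sum)
    moreover have "emeasure \<mu> {t \<in> space \<mu>. s t \<noteq> 0} \<le> emeasure \<mu> K"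
      using s0 by (intro emeasure_mono compact_sets K) auto
    then have "emeasure \<mu> {t \<in> space \<mu>. s t \<noteq> 0} \<noteq> \<infinity>"
      using finite_compact[OF K] by auto
    ultimately show "Bochner_Integration.simple_bochner_integrable \<mu> s"
      by (rule simple_bochner_integrable.intros)
    show "norm (f t - s t) \<le> e * indicator K t" for t
    proof (cases "t \<in> K")
      case True
      then obtain E where E: "E \<in> P" "t \<in> E" using P(3) by blast
      then show ?thesis using P(5)[OF E(1) E(1) E(2) E(2)] True by (simp add: s_eq[OF E] dist_norm)
    qed (simp add: s0 z)
  qed
qed

lemma nn_integral_const_compact:
  assumes "compact K" "e \<ge> 0"
  shows "(\<integral>\<^sup>+t. ennreal (e * indicator K t) \<partial>\<mu>) = ennreal (e * measure \<mu> K)"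
proof -
  have "(\<integral>\<^sup>+t. ennreal (e * indicator K t) \<partial>\<mu>) = (\<integral>\<^sup>+t. ennreal e * indicator K t \<partial>\<mu>)"
    by (intro nn_integral_cong) (auto simp: indicator_def)
  also have "\<dots> = ennreal e * emeasure \<mu> K" by (rule nn_integral_cmult_indicator[OF compact_sets[OF assms(1)]])
  also have "emeasure \<mu> K = ennreal (measure \<mu> K)"
    using finite_compact[OF assms(1)] by (intro emeasure_eq_ennreal_measure) auto
  finally show ?thesis using assms(2) by (simp add: ennreal_mult)
qed

text \<open>Uniform approximation on a compact set of finite measure makes the integrals of the
  simple functions Cauchy, and completeness of the target supplies the value.\<close>

lemma has_vector_integral_Cc:
  fixes f :: "'g \<Rightarrow> 'b::banach"
  assumes "f \<in> Cc"
  shows "has_vector_integral \<mu> f (vector_integral \<mu> f)"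
proof -
  obtain K where K: "compact K" "\<And>t. t \<notin> K \<Longrightarrow> f t = 0" and f: "continuous_on UNIV f"
    using CcD[OF assms] by blast
  define e where "e n = inverse (real (Suc n))" for n
  have e: "e n > 0" for n by (simp add: e_def)
  have "\<exists>s. Bochner_Integration.simple_bochner_integrable \<mu> s \<and> (\<forall>t. norm (f t - s t) \<le> e n * indicator K t)" for n
    using simple_approximation[OF f K e] by blast
  then obtain s where s: "\<And>n. Bochner_Integration.simple_bochner_integrable \<mu> (s n)"
    "\<And>n t. norm (f t - s n t) \<le> e n * indicator K t" by metis
  let ?m = "measure \<mu> K"
  let ?I = "\<lambda>n. Bochner_Integration.simple_bochner_integral \<mu> (s n)"
  have d: "norm (?I n - ?I k) \<le> (e n + e k) * ?m" for n k
  proof -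
    have "ennreal (norm (?I n - ?I k)) \<le> (\<integral>\<^sup>+t. ennreal (norm (s n t - s k t)) \<partial>\<mu>)"
      by (rule simple_bochner_integral_dist[OF s(1) s(1)])
    also have "\<dots> \<le> (\<integral>\<^sup>+t. ennreal ((e n + e k) * indicator K t) \<partial>\<mu>)"
    proof (intro nn_integral_mono ennreal_leI)
      fix t show "norm (s n t - s k t) \<le> (e n + e k) * indicator K t"
        using s(2)[of t n] s(2)[of t k] norm_triangle_ineq4[of "f t - s k t" "f t - s n t"]
        by (simp add: distrib_right)
    qed
    also have "\<dots> = ennreal ((e n + e k) * ?m)"
      using e[of n] e[of k] by (intro nn_integral_const_compact K) simp
    finally show ?thesis using e[of n] e[of k] by (subst (asm) ennreal_le_iff) auto
  qed
  have "Cauchy ?I"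
  proof (rule metric_CauchyI)
    fix r :: real assume r: "r > 0"
    \<comment> \<open>The added 1 covers the case that K is a null set.\<close>
    have "r / (2 * (?m + 1)) > 0" using r by (simp add: add_nonneg_pos)
    then obtain N where N: "e N < r / (2 * (?m + 1))" using reals_Archimedean unfolding e_def by blast
    show "\<exists>N. \<forall>n\<ge>N. \<forall>k\<ge>N. dist (?I n) (?I k) < r"
    proof (intro exI allI impI)
      fix n k assume "n \<ge> N" "k \<ge> N"
      then have "e n \<le> e N" "e k \<le> e N" by (auto simp: e_def)
      then have "(e n + e k) * ?m \<le> (2 * e N) * (?m + 1)" using e[of n] e[of k] by (intro mult_mono) auto
      also have "\<dots> < r" using N by (simp add: pos_less_divide_eq add_nonneg_pos mult_ac)
      finally show "dist (?I n) (?I k) < r" using d[of n k] by (simp add: dist_norm)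
    qed
  qed
  then obtain v where v: "?I \<longlonglongrightarrow> v" using Cauchy_convergent_iff by (auto simp: convergent_def)
  have "has_vector_integral \<mu> f v"
    unfolding has_vector_integral_def
  proof (intro conjI exI[of _ s] allI s(1) v continuous_borel f)
    show "(\<lambda>i. \<integral>\<^sup>+t. ennreal (norm (f t - s i t)) \<partial>\<mu>) \<longlonglongrightarrow> 0"
    proof (rule tendsto_sandwich[where f = "\<lambda>_. 0" and h = "\<lambda>n. ennreal (e n * ?m)"])
      show "\<forall>\<^sub>F i in sequentially. (\<integral>\<^sup>+t. ennreal (norm (f t - s i t)) \<partial>\<mu>) \<le> ennreal (e i * ?m)"
        using e by (intro always_eventually allI)
          (auto simp: nn_integral_const_compact[OF K(1), symmetric] less_imp_le intro!: nn_integral_mono ennreal_leI s(2))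
      have "(\<lambda>n. e n * ?m) \<longlonglongrightarrow> 0 * ?m" unfolding e_def by (intro tendsto_intros LIMSEQ_inverse_real_of_nat)
      then show "(\<lambda>n. ennreal (e n * ?m)) \<longlonglongrightarrow> 0" using tendsto_ennrealI by fastforce
    qed auto
  qed
  then show ?thesis using vector_integral_eq by metis
qed

lemma has_bochner_integral_Cc:
  fixes f :: "'g \<Rightarrow> 'b::{banach, second_countable_topology}"
  assumes "f \<in> Cc"
  shows "has_bochner_integral \<mu> f (vector_integral \<mu> f)"
  using has_vector_integral_Cc[OF assms] by (simp add: has_vector_integral_iff_bochner)

lemma integrable_Cc:
  fixes f :: "'g \<Rightarrow> 'b::{banach, second_countable_topology}"
  shows "f \<in> Cc \<Longrightarrow> integrable \<mu> f"
  using has_bochner_integral_Cc integrable.intros by blast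

lemma vector_integral_eq_integral:
  fixes f :: "'g \<Rightarrow> 'b::{banach, second_countable_topology}"
  shows "f \<in> Cc \<Longrightarrow> vector_integral \<mu> f = integral\<^sup>L \<mu> f"
  using has_bochner_integral_Cc has_bochner_integral_integral_eq by metis

lemma linear_vector_integral:
  fixes f :: "'g \<Rightarrow> 'b::banach" and T :: "'b \<Rightarrow> 'd::{banach, second_countable_topology}"
  assumes "bounded_linear T" "f \<in> Cc"
  shows "T (vector_integral \<mu> f) = (\<integral>t. T (f t) \<partial>\<mu>)"
  using has_vector_integral_linear[OF assms(1) has_vector_integral_Cc[OF assms(2)]]
  by (simp add: has_vector_integral_iff_bochner has_bochner_integral_integral_eq)

lemma linear_vector_integral':
  fixes f :: "'g \<Rightarrow> 'b::banach" and T :: "'b \<Rightarrow> 'd::banach"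
  assumes "bounded_linear T" "f \<in> Cc"
  shows "vector_integral \<mu> (\<lambda>t. T (f t)) = T (vector_integral \<mu> f)"
  using has_vector_integral_linear[OF assms(1) has_vector_integral_Cc[OF assms(2)]] by (rule vector_integral_eq)

lemma Cc_norm: "f \<in> Cc \<Longrightarrow> (\<lambda>t. norm (f t :: 'b::real_normed_vector)) \<in> (Cc :: ('g \<Rightarrow> real) set)"
  by (rule Cc_compose[where T = "\<lambda>_. norm"]) (auto intro: continuous_on_norm CcD(1))

lemma norm_vector_integral_le:
  fixes f :: "'g \<Rightarrow> 'b::banach"
  assumes "f \<in> Cc"
  shows "norm (vector_integral \<mu> f) \<le> (\<integral>t. norm (f t) \<partial>\<mu>)"
proof -
  have "(\<integral>\<^sup>+t. ennreal (norm (f t)) \<partial>\<mu>) = ennreal (\<integral>t. norm (f t) \<partial>\<mu>)"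
    by (rule nn_integral_eq_integral[OF integrable_Cc[OF Cc_norm[OF assms]]]) simp
  then show ?thesis
    using norm_has_vector_integral_le[OF has_vector_integral_Cc[OF assms]] by (simp add: ennreal_le_iff)
qed

lemma integrable_const_compact: "compact K \<Longrightarrow> integrable \<mu> (\<lambda>t. e * indicator K t :: real)"
  using finite_compact by (intro integrable_mult_right integrable_real_indicator compact_sets) auto

lemma integral_const_compact: "compact K \<Longrightarrow> (\<integral>t. e * indicator K t \<partial>\<mu>) = e * measure \<mu> K"
  by (simp add: space_eq)

lemma integral_norm_le_const:
  fixes f :: "'g \<Rightarrow> 'b::real_normed_vector"
  assumes "f \<in> Cc" and K: "compact K" and "\<And>t. t \<notin> K \<Longrightarrow> f t = 0" and "\<And>t. t \<in> K \<Longrightarrow> norm (f t) \<le> e"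
  shows "(\<integral>t. norm (f t) \<partial>\<mu>) \<le> e * measure \<mu> K"
  unfolding integral_const_compact[OF K, symmetric]
  by (intro integral_mono integrable_Cc Cc_norm integrable_const_compact assms)
     (auto simp: indicator_def assms)

lemma norm_vector_integral_le_const:
  fixes f :: "'g \<Rightarrow> 'b::banach"
  assumes "f \<in> Cc" "compact K" "\<And>t. t \<notin> K \<Longrightarrow> f t = 0" "\<And>t. t \<in> K \<Longrightarrow> norm (f t) \<le> e"
  shows "norm (vector_integral \<mu> f) \<le> e * measure \<mu> K"
  using norm_vector_integral_le[OF assms(1)] integral_norm_le_const[OF assms] by linarith

lemma Cc_diff: "f \<in> Cc \<Longrightarrow> g \<in> Cc \<Longrightarrow> (\<lambda>t. f t - g t :: 'b::real_normed_vector) \<in> (Cc :: ('g \<Rightarrow> 'b) set)"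
proof -
  assume fg: "f \<in> Cc" "g \<in> (Cc :: ('g \<Rightarrow> 'b) set)"
  obtain K L where "compact K" "\<forall>t. t \<notin> K \<longrightarrow> f t = 0" "compact L" "\<forall>t. t \<notin> L \<longrightarrow> g t = 0"
    using CcD(2)[OF fg(1)] CcD(2)[OF fg(2)] by metis
  then show ?thesis using fg by (intro CcI[of _ "K \<union> L"]) (auto intro: continuous_on_diff CcD(1))
qed

lemma Cc_add: "f \<in> Cc \<Longrightarrow> g \<in> Cc \<Longrightarrow> (\<lambda>t. f t + g t :: 'b::real_normed_vector) \<in> (Cc :: ('g \<Rightarrow> 'b) set)"
  using Cc_diff[of f "\<lambda>t. - g t"] Cc_compose[of g "\<lambda>_ v. - v"] by (auto intro: continuous_on_minus CcD(1))

lemma Cc_sum: "(\<And>i. i \<in> I \<Longrightarrow> f i \<in> Cc) \<Longrightarrow> (\<lambda>t. \<Sum>i\<in>I. f i t :: 'b::real_normed_vector) \<in> (Cc :: ('g \<Rightarrow> 'b) set)"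
  by (induction I rule: infinite_finite_induct) (auto intro!: Cc_add CcI[of "\<lambda>_. 0" "{}"])

lemma vector_integral_diff:
  fixes f :: "'g \<Rightarrow> 'b::banach"
  assumes "f \<in> Cc" "g \<in> Cc"
  shows "vector_integral \<mu> (\<lambda>t. f t - g t) = vector_integral \<mu> f - vector_integral \<mu> g"
  by (intro vector_integral_eq has_vector_integral_diff has_vector_integral_Cc assms continuous_borel
      continuous_on_diff CcD(1))

text \<open>The common support is required only over U because translates of a compactly supported
  function share one near each point, but not globally.\<close>

lemma continuous_on_vector_integral:
  fixes F :: "'p::topological_space \<times> 'g \<Rightarrow> 'b::banach"
  assumes F: "continuous_on UNIV F" and K: "compact K" and z: "\<And>p t. p \<in> U \<Longrightarrow> t \<notin> K \<Longrightarrow> F (p, t) = 0"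
  shows "continuous_on U (\<lambda>p. vector_integral \<mu> (\<lambda>t. F (p, t)))"
proof -
  have Fp: "continuous_on UNIV (\<lambda>t. F (p, t))" for p
    by (rule continuous_on_compose2[OF F]) (intro continuous_on_Pair continuous_on_const continuous_on_id, auto)
  have Cc: "(\<lambda>t. F (p, t)) \<in> Cc" if "p \<in> U" for p by (rule CcI[OF Fp K]) (use z that in blast)
  show ?thesis
    unfolding continuous_on_def
  proof
    fix p0 assume p0: "p0 \<in> U"
    show "((\<lambda>p. vector_integral \<mu> (\<lambda>t. F (p, t))) \<longlongrightarrow> vector_integral \<mu> (\<lambda>t. F (p0, t))) (at p0 within U)"
    proof (rule tendstoI)
      fix e :: real assume e: "e > 0"
      define r where "r = e / (2 * (measure \<mu> K + 1))"
      have m: "measure \<mu> K + 1 > 0" by (simp add: add_nonneg_pos)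
      have r: "r > 0" using e m by (simp add: r_def)
      have rm: "r * measure \<mu> K < e"
      proof -
        have "r * measure \<mu> K \<le> r * (measure \<mu> K + 1)" using r by simp
        also have "\<dots> = e / 2" using m by (simp add: r_def field_simps)
        finally show ?thesis using e by simp
      qed
      have "continuous_on (U \<times> K) F" using F continuous_on_subset by blast
      then obtain X0 where X0: "p0 \<in> X0" "open X0" "\<forall>x\<in>X0 \<inter> U. \<forall>t\<in>K. dist (F (x, t)) (F (p0, t)) \<le> r"
        using continuous_on_prod_compact_ex[OF _ K p0 r] by blast
      have "dist (vector_integral \<mu> (\<lambda>t. F (p, t))) (vector_integral \<mu> (\<lambda>t. F (p0, t))) < e"
        if p: "p \<in> X0" "p \<in> U" for p
      proof -
        have "norm (vector_integral \<mu> (\<lambda>t. F (p, t) - F (p0, t))) \<le> r * measure \<mu> K"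
          by (rule norm_vector_integral_le_const[OF Cc_diff[OF Cc[OF p(2)] Cc[OF p0]] K])
             (use z p p0 X0(3) in \<open>auto simp: dist_norm\<close>)
        then show ?thesis
          using rm by (simp add: vector_integral_diff[OF Cc[OF p(2)] Cc[OF p0]] dist_norm)
      qed
      then show "\<forall>\<^sub>F p in at p0 within U. dist (vector_integral \<mu> (\<lambda>t. F (p, t))) (vector_integral \<mu> (\<lambda>t. F (p0, t))) < e"
        unfolding eventually_at_topological using X0(1,2) by blast
    qed
  qed
qed

definition fine_for :: "'g set set \<Rightarrow> ('g set \<Rightarrow> 'g) \<Rightarrow> 'g set \<Rightarrow> bool"
  where "fine_for P \<tau> K \<longleftrightarrow> finite P \<and> disjoint P \<and> \<Union>P = K \<and> (\<forall>E\<in>P. E \<in> sets borel \<and> \<tau> E \<in> E)"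

text \<open>The number c E need not be a value of f: for double integrals it is itself a Riemann sum
  of the inner integral.\<close>

lemma riemann_sum:
  fixes f :: "'g \<Rightarrow> 'b::{banach, second_countable_topology}"
  assumes f: "f \<in> Cc" and K: "compact K" and z: "\<And>t. t \<notin> K \<Longrightarrow> f t = 0" and P: "fine_for P \<tau> K"
    and c: "\<And>E t. E \<in> P \<Longrightarrow> t \<in> E \<Longrightarrow> norm (f t - c E) \<le> e"
  shows "norm ((\<integral>t. f t \<partial>\<mu>) - (\<Sum>E\<in>P. measure \<mu> E *\<^sub>R c E)) \<le> e * measure \<mu> K"
proof -
  have P': "finite P" "disjoint P" "\<Union>P = K" "\<And>E. E \<in> P \<Longrightarrow> E \<in> sets \<mu>"
    using P by (auto simp: fine_for_def sets_eq)
  define s where "s t = (\<Sum>E\<in>P. indicator E t *\<^sub>R c E)" for t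
  have s_eq: "s t = c E" if "E \<in> P" "t \<in> E" for E t
  proof -
    have "s t = (\<Sum>E'\<in>P. if E' = E then c E else 0)"
      unfolding s_def using that P'(2) by (intro sum.cong) (auto simp: disjoint_def indicator_def)
    then show ?thesis using that P'(1) by simp
  qed
  have s0: "s t = 0" if "t \<notin> K" for t
    unfolding s_def using that P'(3) by (intro sum.neutral) auto
  have fin: "emeasure \<mu> E < \<infinity>" if "E \<in> P" for E
    using emeasure_mono[of E K \<mu>] P'(3) that finite_compact[OF K] compact_sets[OF K] by (metis Union_upper le_less_trans)
  have iE: "integrable \<mu> (\<lambda>t. indicator E t *\<^sub>R c E)" if "E \<in> P" for E
    using fin[OF that] P'(4)[OF that] by (intro integrable_scaleR_left integrable_real_indicator) auto
  have is': "integrable \<mu> s" unfolding s_def by (rule Bochner_Integration.integrable_sum) (rule iE)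
  have "(\<integral>t. s t \<partial>\<mu>) = (\<Sum>E\<in>P. \<integral>t. indicator E t *\<^sub>R c E \<partial>\<mu>)"
    unfolding s_def by (intro Bochner_Integration.integral_sum iE)
  also have "\<dots> = (\<Sum>E\<in>P. measure \<mu> E *\<^sub>R c E)"
    using fin P'(4) by (intro sum.cong refl) (auto simp: space_eq)
  finally have "(\<integral>t. f t \<partial>\<mu>) - (\<Sum>E\<in>P. measure \<mu> E *\<^sub>R c E) = (\<integral>t. f t - s t \<partial>\<mu>)"
    by (simp add: Bochner_Integration.integral_diff[OF integrable_Cc[OF f] is'])
  also have "norm \<dots> \<le> (\<integral>t. norm (f t - s t) \<partial>\<mu>)" by (rule integral_norm_bound)
  also have "\<dots> \<le> (\<integral>t. e * indicator K t \<partial>\<mu>)"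
  proof (rule integral_mono)
    fix t show "norm (f t - s t) \<le> e * indicator K t"
    proof (cases "t \<in> K")
      case True
      then obtain E where E: "E \<in> P" "t \<in> E" using P'(3) by blast
      then show ?thesis using c[OF E] True by (simp add: s_eq[OF E])
    qed (simp add: s0 z)
  qed (intro integrable_norm Bochner_Integration.integrable_diff integrable_Cc f is' integrable_const_compact K)+
  finally show ?thesis by (simp only: integral_const_compact[OF K])
qed

lemma Cc_slice:
  fixes F :: "'g \<times> 'g \<Rightarrow> 'b::real_normed_vector"
  assumes F: "continuous_on UNIV F" and K: "compact K" and z: "\<And>s t. s \<notin> K \<or> t \<notin> K \<Longrightarrow> F (s, t) = 0"
  shows "(\<lambda>t. F (s, t)) \<in> Cc" "(\<lambda>s. F (s, t)) \<in> Cc"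
proof -
  have "continuous_on UNIV (\<lambda>t. F (s, t))" "continuous_on UNIV (\<lambda>s. F (s, t))"
    by (rule continuous_on_compose2[OF F]; (intro continuous_on_Pair continuous_on_const continuous_on_id)?; auto)+
  then show "(\<lambda>t. F (s, t)) \<in> Cc" "(\<lambda>s. F (s, t)) \<in> Cc"
    using z by (auto intro!: CcI[OF _ K])
qed

lemma Cc_integral:
  fixes F :: "'g \<times> 'g \<Rightarrow> 'b::{banach, second_countable_topology}"
  assumes F: "continuous_on UNIV F" and K: "compact K" and z: "\<And>s t. s \<notin> K \<or> t \<notin> K \<Longrightarrow> F (s, t) = 0"
  shows "(\<lambda>s. \<integral>t. F (s, t) \<partial>\<mu>) \<in> Cc"
proof (rule CcI[OF _ K])
  show "continuous_on UNIV (\<lambda>s. \<integral>t. F (s, t) \<partial>\<mu>)"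
  proof -
    have "vector_integral \<mu> (\<lambda>t. F (s, t)) = (\<integral>t. F (s, t) \<partial>\<mu>)" for s
      by (rule vector_integral_eq_integral[OF Cc_slice(1)[OF F K]]) (use z in auto)
    then show ?thesis using continuous_on_vector_integral[OF F K, of UNIV] z by simp
  qed
  show "(\<integral>t. F (s, t) \<partial>\<mu>) = 0" if "s \<notin> K" for s using z that by simp
qed

lemma double_riemann_sum:
  fixes F :: "'g \<times> 'g \<Rightarrow> 'b::{banach, second_countable_topology}"
  assumes F: "continuous_on UNIV F" and K: "compact K" and z: "\<And>s t. s \<notin> K \<or> t \<notin> K \<Longrightarrow> F (s, t) = 0"
    and P: "fine_for P \<tau> K"
    and c: "\<And>E E' s t. E \<in> P \<Longrightarrow> E' \<in> P \<Longrightarrow> s \<in> E \<Longrightarrow> t \<in> E' \<Longrightarrow> norm (F (s, t) - F (\<tau> E, \<tau> E')) \<le> e"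
  shows "norm ((\<integral>s. \<integral>t. F (s, t) \<partial>\<mu> \<partial>\<mu>) - (\<Sum>E\<in>P. \<Sum>E'\<in>P. (measure \<mu> E * measure \<mu> E') *\<^sub>R F (\<tau> E, \<tau> E')))
    \<le> e * measure \<mu> K * measure \<mu> K"
proof -
  have "norm ((\<integral>s. \<integral>t. F (s, t) \<partial>\<mu> \<partial>\<mu>) - (\<Sum>E\<in>P. measure \<mu> E *\<^sub>R (\<Sum>E'\<in>P. measure \<mu> E' *\<^sub>R F (\<tau> E, \<tau> E'))))
    \<le> e * measure \<mu> K * measure \<mu> K"
  proof (rule riemann_sum[OF Cc_integral[OF F K z] K _ P])
    show "(\<integral>t. F (s, t) \<partial>\<mu>) = 0" if "s \<notin> K" for s using z that by simp
    show "norm ((\<integral>t. F (s, t) \<partial>\<mu>) - (\<Sum>E'\<in>P. measure \<mu> E' *\<^sub>R F (\<tau> E, \<tau> E'))) \<le> e * measure \<mu> K"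
      if "E \<in> P" "s \<in> E" for E s
      by (rule riemann_sum[OF Cc_slice(1)[OF F K z] K _ P]) (use c[OF that(1) _ that(2)] z in auto)
  qed
  then show ?thesis by (simp add: scaleR_sum_right)
qed

lemma fine_for_ex:
  fixes F :: "'g \<times> 'g \<Rightarrow> 'm::metric_space"
  assumes "continuous_on UNIV F" "compact K" "e > 0"
  shows "\<exists>P \<tau>. fine_for P \<tau> K \<and>
    (\<forall>E\<in>P. \<forall>E'\<in>P. \<forall>s\<in>E. \<forall>t\<in>E'. dist (F (s, t)) (F (\<tau> E, \<tau> E')) < e)"
proof (rule fine_partition[OF continuous_on_subset[OF assms(1) subset_UNIV] assms(2,3)])
  fix P \<tau>
  assume "finite P" "disjoint P" "\<Union>P = K" "\<And>E. E \<in> P \<Longrightarrow> E \<in> sets borel \<and> \<tau> E \<in> E"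
    "\<And>E E' s t. E \<in> P \<Longrightarrow> E' \<in> P \<Longrightarrow> s \<in> E \<Longrightarrow> t \<in> E' \<Longrightarrow> dist (F (s, t)) (F (\<tau> E, \<tau> E')) < e"
  then show ?thesis unfolding fine_for_def by (intro exI[of _ P] exI[of _ \<tau>]) blast
qed

text \<open>Haar measure need not be sigma-finite. Both iterated integrals are compared with the
  same double Riemann sum, so they differ by an arbitrarily small multiple of the squared measure of
  K.\<close>

lemma Fubini_Cc:
  fixes F :: "'g \<times> 'g \<Rightarrow> 'b::{banach, second_countable_topology}"
  assumes F: "continuous_on UNIV F" and K: "compact K" and z: "\<And>s t. s \<notin> K \<or> t \<notin> K \<Longrightarrow> F (s, t) = 0"
  shows "(\<integral>s. \<integral>t. F (s, t) \<partial>\<mu> \<partial>\<mu>) = (\<integral>t. \<integral>s. F (s, t) \<partial>\<mu> \<partial>\<mu>)" (is "?X = ?Y")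
proof -
  have F': "continuous_on UNIV (\<lambda>p. F (snd p, fst p))"
    by (rule continuous_on_compose2[OF F])
       (intro continuous_on_Pair continuous_on_fst continuous_on_snd continuous_on_id, auto)
  let ?m = "measure \<mu> K"
  have le: "norm (?X - ?Y) \<le> 2 * (e * ?m * ?m)" if e: "e > 0" for e
  proof -
    obtain P \<tau> where P: "fine_for P \<tau> K"
      and c: "\<forall>E\<in>P. \<forall>E'\<in>P. \<forall>s\<in>E. \<forall>t\<in>E'. dist (F (s, t)) (F (\<tau> E, \<tau> E')) < e"
      using fine_for_ex[OF F K e] by blast
    let ?S = "\<Sum>E\<in>P. \<Sum>E'\<in>P. (measure \<mu> E * measure \<mu> E') *\<^sub>R F (\<tau> E, \<tau> E')"
    have "norm (?X - ?S) \<le> e * ?m * ?m"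
      by (rule double_riemann_sum[OF F K z P]) (use c in \<open>auto simp: dist_norm less_imp_le\<close>)
    moreover have "norm (?Y - (\<Sum>E\<in>P. \<Sum>E'\<in>P. (measure \<mu> E * measure \<mu> E') *\<^sub>R F (\<tau> E', \<tau> E))) \<le> e * ?m * ?m"
      using double_riemann_sum[OF F' K _ P, of e] z c by (auto simp: dist_norm less_imp_le)
    moreover have "(\<Sum>E\<in>P. \<Sum>E'\<in>P. (measure \<mu> E * measure \<mu> E') *\<^sub>R F (\<tau> E', \<tau> E)) = ?S"
      by (subst sum.swap) (simp add: mult.commute)
    ultimately show ?thesis using norm_triangle_ineq4[of "?X - ?S" "?Y - ?S"] by simp
  qed
  have "norm (?X - ?Y) \<le> 0 + d" if d: "d > 0" for d
  proof -
    have pos: "?m * ?m + 1 > 0" by (simp add: add_nonneg_pos)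
    define q where "q = ?m * ?m + 1"
    have "2 * (d / (2 * q) * ?m * ?m) = d * (?m * ?m / q)" by simp
    then have "2 * (d / (2 * (?m * ?m + 1)) * ?m * ?m) = d * (?m * ?m / (?m * ?m + 1))" unfolding q_def .
    also have "\<dots> \<le> d * 1" using d pos by (intro mult_left_mono) (auto simp: divide_le_eq)
    finally show ?thesis using le[of "d / (2 * (?m * ?m + 1))"] d pos by simp
  qed
  then have "norm (?X - ?Y) \<le> 0" by (rule field_le_epsilon)
  then show ?thesis by simp
qed

text \<open>Double Riemann sums with equal tags and weights in both variables are assumed
  nonnegative, and the nonnegative half-line is closed.\<close>

lemma double_integral_positive:
  fixes F :: "'g \<times> 'g \<Rightarrow> complex"
  assumes F: "continuous_on UNIV F" and K: "compact K" and z: "\<And>s t. s \<notin> K \<or> t \<notin> K \<Longrightarrow> F (s, t) = 0"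
    and pos: "\<And>(P :: 'g set set) w \<tau>. finite P \<Longrightarrow> (\<Sum>E\<in>P. \<Sum>E'\<in>P. (w E * w E') *\<^sub>R F (\<tau> E, \<tau> E')) \<in> \<real>\<^sub>\<ge>\<^sub>0"
  shows "(\<integral>s. \<integral>t. F (s, t) \<partial>\<mu> \<partial>\<mu>) \<in> \<real>\<^sub>\<ge>\<^sub>0" (is "?X \<in> _")
proof -
  let ?m = "measure \<mu> K"
  have le: "\<exists>S\<in>\<real>\<^sub>\<ge>\<^sub>0. norm (?X - S) \<le> e * ?m * ?m" if e: "e > 0" for e
  proof -
    obtain P \<tau> where P: "fine_for P \<tau> K"
      and c: "\<forall>E\<in>P. \<forall>E'\<in>P. \<forall>s\<in>E. \<forall>t\<in>E'. dist (F (s, t)) (F (\<tau> E, \<tau> E')) < e"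
      using fine_for_ex[OF F K e] by blast
    show ?thesis
    proof (rule bexI[of _ "\<Sum>E\<in>P. \<Sum>E'\<in>P. (measure \<mu> E * measure \<mu> E') *\<^sub>R F (\<tau> E, \<tau> E')"])
      show "norm (?X - (\<Sum>E\<in>P. \<Sum>E'\<in>P. (measure \<mu> E * measure \<mu> E') *\<^sub>R F (\<tau> E, \<tau> E'))) \<le> e * ?m * ?m"
        by (rule double_riemann_sum[OF F K z P]) (use c in \<open>auto simp: dist_norm less_imp_le\<close>)
    qed (use P in \<open>auto simp: fine_for_def intro!: pos\<close>)
  qed
  have "\<bar>Im ?X\<bar> \<le> 0 + d \<and> - Re ?X \<le> 0 + d" if d: "d > 0" for d
  proof -
    have p: "?m * ?m + 1 > 0" by (simp add: add_nonneg_pos)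
    obtain S where S: "S \<in> \<real>\<^sub>\<ge>\<^sub>0" "norm (?X - S) \<le> d / (?m * ?m + 1) * ?m * ?m"
      using le[of "d / (?m * ?m + 1)"] d p by auto
    have "d / (?m * ?m + 1) * ?m * ?m = d * (?m * ?m / (?m * ?m + 1))" by simp
    also have "\<dots> \<le> d * 1" using d p by (intro mult_left_mono) (auto simp: divide_le_eq)
    finally have "norm (?X - S) \<le> d" using S(2) by simp
    then show ?thesis
      using S(1) abs_Im_le_cmod[of "?X - S"] abs_Re_le_cmod[of "?X - S"]
      unfolding complex_nonneg_Reals_iff minus_complex.sel by (intro conjI; linarith)
  qed
  then have "\<bar>Im ?X\<bar> \<le> 0" "- Re ?X \<le> 0" by (blast intro: field_le_epsilon)+
  then show ?thesis by (simp add: complex_nonneg_Reals_iff)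
qed

end

section \<open>Haar measure and the modular function\<close>

lemma compact_plus:
  fixes K L :: "'g::topological_group_add set"
  assumes "compact K" "compact L"
  shows "compact ((\<lambda>p. fst p + snd p) ` (K \<times> L))"
  by (intro compact_continuous_image compact_Times assms continuous_on_add continuous_on_fst continuous_on_snd continuous_on_id)

lemma compact_minus:
  fixes K :: "'g::topological_group_add set"
  assumes "compact K"
  shows "compact (uminus ` K)"
  by (intro compact_continuous_image assms continuous_on_minus continuous_on_id)

lemma continuous_on_UNIV_compose:
  "continuous_on UNIV f \<Longrightarrow> continuous_on UNIV g \<Longrightarrow> continuous_on UNIV (\<lambda>x. f (g x))"
  by (rule continuous_on_compose2) auto

lemmas continuous_on_pairs = continuous_on_Pair continuous_on_fst continuous_on_snd continuous_on_id
  continuous_on_const continuous_on_add continuous_on_minus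

locale haar_measure =
  fixes \<mu> :: "'g::{topological_group_add, t2_space} measure"
  assumes locally_compact: "locally_compact_space (euclidean :: 'g topology)"
    and haar: "left_haar_measure \<mu>"
begin

sublocale compact_finite_measure \<mu>
  using haar by unfold_locales (auto simp: left_haar_measure_def)

lemma compact_neighbourhood:
  obtains U K where "open U" "compact K" "x \<in> U" "U \<subseteq> (K :: 'g set)"
proof -
  have "\<exists>U K. open U \<and> compact K \<and> x \<in> U \<and> U \<subseteq> K"
    using locally_compact unfolding locally_compact_space_def by auto
  then show thesis using that by blast
qed

lemma emeasure_translate: "E \<in> sets borel \<Longrightarrow> emeasure \<mu> ((\<lambda>s. t + s) ` E) = emeasure \<mu> E"
  using haar by (auto simp: left_haar_measure_def)

lemma translate_image: "(\<lambda>s. t + s) ` E = (\<lambda>s. - t + s) -` (E :: 'g set)"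
  by (force simp: image_iff add.assoc[symmetric])

lemma measurable_translate: "(\<lambda>s. t + s) \<in> measurable \<mu> \<mu>"
proof -
  have "(\<lambda>s. t + s) \<in> measurable borel (borel :: 'g measure)"
    by (intro borel_measurable_continuous_onI continuous_on_add continuous_on_const continuous_on_id)
  then show ?thesis by (simp add: measurable_cong_sets[OF sets_eq sets_eq])
qed

lemma distr_translate: "distr \<mu> \<mu> (\<lambda>s. t + s) = \<mu>"
proof (rule measure_eqI)
  fix A assume "A \<in> sets (distr \<mu> \<mu> (\<lambda>s. t + s))"
  then have A: "A \<in> sets \<mu>" by simp
  have "emeasure (distr \<mu> \<mu> (\<lambda>s. t + s)) A = emeasure \<mu> ((\<lambda>s. t + s) -` A)"
    using A by (simp add: emeasure_distr[OF measurable_translate] space_eq)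
  also have "(\<lambda>s. t + s) -` A = (\<lambda>s. - t + s) ` A" using translate_image[of "- t" A] by simp
  finally show "emeasure (distr \<mu> \<mu> (\<lambda>s. t + s)) A = emeasure \<mu> A"
    using emeasure_translate[of A "- t"] A by (simp add: sets_eq)
qed simp

lemma integral_translate:
  fixes f :: "'g \<Rightarrow> 'b::{banach, second_countable_topology}"
  assumes "continuous_on UNIV f"
  shows "(\<integral>s. f (t + s) \<partial>\<mu>) = (\<integral>s. f s \<partial>\<mu>)"
  using integral_distr[OF measurable_translate continuous_borel[OF assms], of t]
  by (simp add: distr_translate)

section \<open>Open sets and bump functions\<close>

text \<open>Finitely many translates of a null open set would cover any compact set, and inner
  regularity would make the whole group null.\<close>

lemma emeasure_open_pos:
  assumes "open U" "U \<noteq> {}"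
  shows "emeasure \<mu> U \<noteq> 0"
proof
  assume 0: "emeasure \<mu> U = 0"
  obtain x where x: "x \<in> U" using assms(2) by blast
  have op: "open ((\<lambda>s. t + s) ` U)" for t
    unfolding translate_image
    by (intro open_vimage assms continuous_on_add continuous_on_const continuous_on_id)
  have "emeasure \<mu> C = 0" if C: "compact C" for C
  proof -
    obtain D where D: "finite D" "D \<subseteq> C" "C \<subseteq> (\<Union>c\<in>D. (\<lambda>s. (c - x) + s) ` U)"
    proof (rule compactE_image[OF C, of C "\<lambda>c. (\<lambda>s. (c - x) + s) ` U"])
      show "C \<subseteq> (\<Union>c\<in>C. (\<lambda>s. (c - x) + s) ` U)"
        using x by (auto intro!: bexI image_eqI[of _ _ x])
    qed (use op in auto)
    have "emeasure \<mu> C \<le> emeasure \<mu> (\<Union>c\<in>D. (\<lambda>s. (c - x) + s) ` U)"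
    proof (rule emeasure_mono[OF D(3)])
      show "(\<Union>c\<in>D. (\<lambda>s. (c - x) + s) ` U) \<in> sets \<mu>" unfolding sets_eq by (intro borel_open open_UN ballI op)
    qed
    also have "\<dots> \<le> (\<Sum>c\<in>D. emeasure \<mu> ((\<lambda>s. (c - x) + s) ` U))"
      using D(1) op by (intro emeasure_subadditive_finite) (auto simp: sets_eq)
    also have "\<dots> = 0" using assms(1) 0 by (simp add: emeasure_translate)
    finally show ?thesis by simp
  qed
  moreover have "emeasure \<mu> UNIV = (SUP C\<in>{C. compact C \<and> C \<subseteq> UNIV}. emeasure \<mu> C)"
    using haar open_UNIV unfolding left_haar_measure_def by blast
  moreover have "(SUP C\<in>{C. compact C \<and> C \<subseteq> UNIV}. emeasure \<mu> C) \<le> 0"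
    by (intro SUP_least) (auto simp: calculation(1))
  ultimately have "emeasure \<mu> UNIV = 0" by simp
  then show False using haar by (simp add: left_haar_measure_def)
qed

lemma integral_Cc_pos:
  fixes f :: "'g \<Rightarrow> real"
  assumes f: "f \<in> Cc" and nn: "\<And>t. f t \<ge> 0" and x: "f x \<noteq> 0"
  shows "(\<integral>t. f t \<partial>\<mu>) > 0"
proof -
  have "(\<integral>t. f t \<partial>\<mu>) \<noteq> 0"
  proof
    assume "(\<integral>t. f t \<partial>\<mu>) = 0"
    then have "AE t in \<mu>. f t = 0" using integral_nonneg_eq_0_iff_AE[OF integrable_Cc[OF f]] nn by auto
    moreover have op: "open {t. f t \<noteq> 0}"
      by (rule open_Collect_neq[OF CcD(1)[OF f] continuous_on_const])
    ultimately have "emeasure \<mu> {t. f t \<noteq> 0} = 0"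
      by (subst (asm) AE_iff_measurable[of "{t. f t \<noteq> 0}"]) (auto simp: sets_eq space_eq)
    then show False using emeasure_open_pos[OF op] x by blast
  qed
  moreover have "(\<integral>t. f t \<partial>\<mu>) \<ge> 0" using nn by (intro Bochner_Integration.integral_nonneg) auto
  ultimately show ?thesis by simp
qed

text \<open>Locally compact Hausdorff spaces are completely regular. Shrinking V to a neighbourhood
  contained in a compact set provides the compact support.\<close>

lemma bump:
  assumes "open V" "x \<in> V"
  shows "\<exists>f :: 'g \<Rightarrow> real. f \<in> Cc \<and> (\<forall>t. 0 \<le> f t \<and> f t \<le> 1) \<and> f x = 1 \<and> (\<forall>t. t \<notin> V \<longrightarrow> f t = 0)"
proof -
  obtain U K where UK: "open U" "compact K" "x \<in> U" "U \<subseteq> K" by (rule compact_neighbourhood)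
  have "Hausdorff_space (euclidean :: 'g topology)"
    unfolding Hausdorff_space_def by (auto simp: disjnt_def) (metis hausdorff)
  then have "completely_regular_space (euclidean :: 'g topology)"
    using locally_compact_regular_imp_completely_regular_space locally_compact by blast
  moreover have "closedin euclidean (- (V \<inter> U))" using assms UK by (simp add: closed_def open_Int)
  ultimately obtain g :: "'g \<Rightarrow> real" where g: "continuous_map euclidean (top_of_set {0..1}) g" "g x = 0" "g ` (- (V \<inter> U)) \<subseteq> {1}"
    using assms UK unfolding completely_regular_space_def by (metis Compl_iff DiffI IntI UNIV_I topspace_euclidean)
  have gc: "continuous_on UNIV g" and g01: "0 \<le> g t \<and> g t \<le> 1" for t
    using g(1) by (auto simp: continuous_map_in_subtopology image_subset_iff Pi_iff)
  show ?thesis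
  proof (intro exI[of _ "\<lambda>t. 1 - g t"] conjI allI impI)
    show "(\<lambda>t. 1 - g t) \<in> Cc"
      by (rule CcI[OF _ UK(2)]) (use g(3) UK(4) in \<open>auto intro!: continuous_intros gc\<close>)
  qed (use g g01 in auto)
qed

text \<open>The finitely many bumps add up to more than 1/2 on C, so doubling and cutting at 1 gives
  the value 1 there.\<close>

lemma urysohn_compact:
  assumes C: "compact C" and V: "open V" "C \<subseteq> V"
  shows "\<exists>f :: 'g \<Rightarrow> real. f \<in> Cc \<and> (\<forall>t. 0 \<le> f t \<and> f t \<le> 1) \<and> (\<forall>t\<in>C. f t = 1) \<and> (\<forall>t. t \<notin> V \<longrightarrow> f t = 0)"
proof -
  have "\<exists>b. \<forall>x\<in>C. b x \<in> Cc \<and> (\<forall>t. 0 \<le> b x t \<and> b x t \<le> 1) \<and> b x x = (1::real) \<and> (\<forall>t. t \<notin> V \<longrightarrow> b x t = 0)"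
    using bump[OF V(1)] V(2) by (intro bchoice) blast
  then obtain b where b: "\<And>x. x \<in> C \<Longrightarrow> b x \<in> Cc" "\<And>x t. x \<in> C \<Longrightarrow> 0 \<le> b x t" "\<And>x. x \<in> C \<Longrightarrow> b x x = (1::real)"
    "\<And>x t. x \<in> C \<Longrightarrow> t \<notin> V \<Longrightarrow> b x t = 0" by blast
  obtain D where D: "D \<subseteq> C" "finite D" "C \<subseteq> (\<Union>x\<in>D. {t. 1/2 < b x t})"
  proof (rule compactE_image[OF C, of C "\<lambda>x. {t. 1/2 < b x t}"])
    show "open {t. 1/2 < b x t}" if "x \<in> C" for x
      by (rule open_Collect_less[OF continuous_on_const CcD(1)[OF b(1)[OF that]]])
    show "C \<subseteq> (\<Union>x\<in>C. {t. 1/2 < b x t})" using b(3) by force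
  qed auto
  let ?s = "\<lambda>t. \<Sum>x\<in>D. b x t"
  have s0: "?s t \<ge> 0" for t using b(2) D(1) by (intro sum_nonneg) auto
  show ?thesis
  proof (intro exI[of _ "\<lambda>t. min 1 (2 * ?s t)"] conjI allI ballI impI)
    have sC: "?s \<in> Cc" using b(1) D(1) by (intro Cc_sum) auto
    show "(\<lambda>t. min 1 (2 * ?s t)) \<in> Cc"
      using Cc_compose[OF sC, of "\<lambda>_ v. min 1 (2 * v)"] CcD(1)[OF sC]
      by (simp add: continuous_on_min continuous_on_mult_left)
    fix t assume "t \<in> C"
    then obtain x where x: "x \<in> D" "1/2 < b x t" using D(3) by blast
    have "b x t \<le> ?s t" using x(1) D b(2) by (intro member_le_sum) auto
    then show "min 1 (2 * ?s t) = 1" using x(2) by simp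
  next
    fix t assume "t \<notin> V"
    then have "?s t = 0" using b(4) D(1) by (intro sum.neutral) auto
    then show "min 1 (2 * ?s t) = 0" by simp
  qed (use s0 in auto)
qed

text \<open>For s in a compact neighbourhood N of s0, all translates of f vanish off the single
  compact set K + (- N).\<close>

lemma continuous_right_translate:
  fixes f :: "'g \<Rightarrow> real"
  assumes f: "f \<in> Cc"
  shows "continuous_on UNIV (\<lambda>s. \<integral>t. f (t + s) \<partial>\<mu>)"
proof -
  obtain K where K: "compact K" "\<And>t. t \<notin> K \<Longrightarrow> f t = 0" using CcD(2)[OF f] by blast
  have F: "continuous_on UNIV (\<lambda>p. f (snd p + fst p))"
    by (rule continuous_on_UNIV_compose[OF CcD(1)[OF f]]) (intro continuous_on_pairs)
  have "isCont (\<lambda>s. \<integral>t. f (t + s) \<partial>\<mu>) s0" for s0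
  proof -
    obtain U N where U: "open U" "compact N" "s0 \<in> U" "U \<subseteq> N" by (rule compact_neighbourhood)
    let ?K = "(\<lambda>p. fst p + snd p) ` (K \<times> uminus ` N)"
    have cK: "compact ?K" by (intro compact_plus compact_minus K U)
    have z: "f (t + s) = 0" if "s \<in> U" "t \<notin> ?K" for s t
    proof (rule K(2), rule)
      assume "t + s \<in> K"
      moreover have "t = (t + s) + - s" by (simp add: add.assoc)
      ultimately have "t \<in> ?K" using that(1) U(4) by (intro image_eqI[of _ _ "(t + s, - s)"]) auto
      with that(2) show False ..
    qed
    have fs: "(\<lambda>t. f (t + s)) \<in> Cc" if "s \<in> U" for s
      by (rule CcI[OF continuous_on_UNIV_compose[OF CcD(1)[OF f]] cK]) (intro continuous_on_pairs, rule z[OF that])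
    have "continuous_on U (\<lambda>s. vector_integral \<mu> (\<lambda>t. f (t + s)))"
      using continuous_on_vector_integral[OF F cK, of U] z by simp
    then have "continuous_on U (\<lambda>s. \<integral>t. f (t + s) \<partial>\<mu>)"
      by (rule continuous_on_eq) (simp add: vector_integral_eq_integral fs)
    then show ?thesis using U continuous_on_eq_continuous_at by blast
  qed
  then show ?thesis by (simp add: continuous_at_imp_continuous_on)
qed

section \<open>Right translation and inversion of Haar integrals\<close>

text \<open>Left invariance puts g (- s + t) in place of g t; after the exchange, replacing s by t +
  s turns - s + t into - s. Keeping g and varying f gives proportionality of right translates,
  keeping f and varying g gives the inversion formula.\<close>

lemma haar_exchange:
  fixes f g :: "'g \<Rightarrow> real"
  assumes f: "f \<in> Cc" and g: "g \<in> Cc"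
  shows "(\<integral>t. f t \<partial>\<mu>) * (\<integral>t. g t \<partial>\<mu>) = (\<integral>s. g (- s) * (\<integral>t. f (t + s) \<partial>\<mu>) \<partial>\<mu>)"
proof -
  obtain K where K: "compact K" "\<And>t. t \<notin> K \<Longrightarrow> f t = 0" using CcD(2)[OF f] by blast
  obtain L where L: "compact L" "\<And>t. t \<notin> L \<Longrightarrow> g t = 0" using CcD(2)[OF g] by blast
  let ?P = "(\<lambda>p. fst p + snd p) ` (K \<times> L)"
  let ?K = "K \<union> ?P \<union> uminus ` L"
  have cK: "compact ?K" by (intro compact_Un compact_plus compact_minus K L)
  note cf = continuous_on_UNIV_compose[OF CcD(1)[OF f]] and cg = continuous_on_UNIV_compose[OF CcD(1)[OF g]]
  have F1: "continuous_on UNIV (\<lambda>p. f (fst p) * g (- fst p + snd p))"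
    by (intro continuous_on_mult cf cg continuous_on_pairs)
  have z1: "f s * g (- s + t) = 0" if "s \<notin> ?K \<or> t \<notin> ?K" for s t
  proof (rule ccontr)
    assume "f s * g (- s + t) \<noteq> 0"
    then have "s \<in> K" "- s + t \<in> L" using K(2) L(2) by auto
    moreover have "t = s + (- s + t)" by (simp add: add.assoc[symmetric])
    ultimately have "t \<in> ?P" by (intro image_eqI[of _ _ "(s, - s + t)"]) auto
    with \<open>s \<in> K\<close> that show False by blast
  qed
  have F2: "continuous_on UNIV (\<lambda>p. f (fst p + snd p) * g (- snd p))"
    by (intro continuous_on_mult cf cg continuous_on_pairs)
  have z2: "f (t + s) * g (- s) = 0" if "t \<notin> ?K \<or> s \<notin> ?K" for s t
  proof (rule ccontr)
    assume "f (t + s) * g (- s) \<noteq> 0"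
    then have ks: "t + s \<in> K" "- s \<in> L" using K(2) L(2) by auto
    moreover have "t = (t + s) + - s" by (simp add: add.assoc)
    ultimately have "t \<in> ?P" by (intro image_eqI[of _ _ "(t + s, - s)"]) auto
    moreover have "s \<in> uminus ` L" using ks(2) by (intro image_eqI[of _ _ "- s"]) auto
    ultimately show False using that by blast
  qed
  have "(\<integral>t. f t \<partial>\<mu>) * (\<integral>t. g t \<partial>\<mu>) = (\<integral>s. f s * (\<integral>t. g (- s + t) \<partial>\<mu>) \<partial>\<mu>)"
    by (simp add: integral_translate[OF CcD(1)[OF g]])
  also have "\<dots> = (\<integral>s. \<integral>t. f s * g (- s + t) \<partial>\<mu> \<partial>\<mu>)" by simp
  also have "\<dots> = (\<integral>t. \<integral>s. f s * g (- s + t) \<partial>\<mu> \<partial>\<mu>)"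
    using Fubini_Cc[OF F1 cK] z1 by simp
  also have "\<dots> = (\<integral>t. \<integral>s. f (t + s) * g (- s) \<partial>\<mu> \<partial>\<mu>)"
  proof (rule Bochner_Integration.integral_cong[OF refl])
    fix t
    have "continuous_on UNIV (\<lambda>s. f s * g (- s + t))"
      by (intro continuous_on_mult CcD(1)[OF f] cg continuous_on_pairs)
    from integral_translate[OF this, of t]
    show "(\<integral>s. f s * g (- s + t) \<partial>\<mu>) = (\<integral>s. f (t + s) * g (- s) \<partial>\<mu>)"
      by (simp add: minus_add add.assoc)
  qed
  also have "\<dots> = (\<integral>s. \<integral>t. f (t + s) * g (- s) \<partial>\<mu> \<partial>\<mu>)"
    using Fubini_Cc[OF F2 cK] z2 by simp
  also have "\<dots> = (\<integral>s. g (- s) * (\<integral>t. f (t + s) \<partial>\<mu>) \<partial>\<mu>)"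
    by (simp add: mult.commute)
  finally show ?thesis .
qed

lemma Cc_reflect: "f \<in> Cc \<Longrightarrow> (\<lambda>s. f (- s) :: 'b::real_normed_vector) \<in> (Cc :: ('g \<Rightarrow> 'b) set)"
proof -
  assume f: "f \<in> (Cc :: ('g \<Rightarrow> 'b) set)"
  then obtain K where K: "compact K" "\<And>t. t \<notin> K \<Longrightarrow> f t = 0" using CcD(2) by blast
  show ?thesis
    by (rule CcI[OF continuous_on_UNIV_compose[OF CcD(1)[OF f]] compact_minus[OF K(1)]])
       (intro continuous_on_pairs, rule K(2), force simp: image_iff)
qed

lemma Cc_mult_left:
  fixes f h :: "'g \<Rightarrow> real"
  assumes "f \<in> Cc" "continuous_on UNIV h"
  shows "(\<lambda>s. f s * h s) \<in> Cc"
  using Cc_compose[OF assms(1), of "\<lambda>s v. v * h s"] assms by (simp add: continuous_on_mult CcD(1))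

text \<open>By \<open>haar_exchange\<close>, the two sides as functions of s have equal integrals
  against every test function. If h is their difference, testing with b h makes the integral of b
  h^2 vanish although the integrand is positive at s.\<close>

lemma right_translate_proportional:
  fixes f g :: "'g \<Rightarrow> real"
  assumes f: "f \<in> Cc" and g: "g \<in> Cc"
  shows "(\<integral>t. g t \<partial>\<mu>) * (\<integral>t. f (t + s) \<partial>\<mu>) = (\<integral>t. f t \<partial>\<mu>) * (\<integral>t. g (t + s) \<partial>\<mu>)"
proof (rule ccontr)
  let ?R = "\<lambda>f s. \<integral>t. f (t + s) \<partial>\<mu>"
  define h where "h s = (\<integral>t. g t \<partial>\<mu>) * ?R f s - (\<integral>t. f t \<partial>\<mu>) * ?R g s" for s
  assume "\<not> ?thesis"
  then have hs: "h s \<noteq> 0" by (simp add: h_def)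
  have ch: "continuous_on UNIV h"
    unfolding h_def by (intro continuous_on_diff continuous_on_mult_left continuous_right_translate f g)
  obtain b :: "'g \<Rightarrow> real" where b: "b \<in> Cc" "\<And>t. 0 \<le> b t" "b s = 1"
    using bump[of UNIV s] by auto
  have bh: "(\<lambda>r. b r * h r) \<in> Cc" by (rule Cc_mult_left[OF b(1) ch])
  have int: "integrable \<mu> (\<lambda>r. b r * h r * ?R k r)" if "k \<in> Cc" for k
    by (intro integrable_Cc Cc_mult_left bh continuous_right_translate that)
  have ex: "(\<integral>t. k t \<partial>\<mu>) * (\<integral>t. b (- t) * h (- t) \<partial>\<mu>) = (\<integral>r. b r * h r * ?R k r \<partial>\<mu>)" if "k \<in> Cc" for k
    using haar_exchange[OF that Cc_reflect[OF bh]] by simp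
  have "(\<integral>r. b r * h r * h r \<partial>\<mu>) = (\<integral>r. (\<integral>t. g t \<partial>\<mu>) * (b r * h r * ?R f r) - (\<integral>t. f t \<partial>\<mu>) * (b r * h r * ?R g r) \<partial>\<mu>)"
    by (rule Bochner_Integration.integral_cong[OF refl]) (subst (2) h_def, simp add: algebra_simps)
  also have "\<dots> = 0"
    using int[OF f] int[OF g] by (simp add: ex[OF f, symmetric] ex[OF g, symmetric])
  finally have "(\<integral>r. b r * h r * h r \<partial>\<mu>) = 0" .
  moreover have "(\<integral>r. b r * h r * h r \<partial>\<mu>) > 0"
    by (rule integral_Cc_pos[OF Cc_mult_left[OF bh ch], of s]) (use b hs in \<open>auto simp: mult.assoc\<close>)
  ultimately show False by simp
qed

definition reference :: "'g \<Rightarrow> real"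
  where "reference = (SOME f. f \<in> Cc \<and> (\<forall>t. 0 \<le> f t) \<and> f 0 = 1)"

lemma reference: "reference \<in> Cc" "0 \<le> reference t" "reference 0 = 1"
proof -
  have "\<exists>f :: 'g \<Rightarrow> real. f \<in> Cc \<and> (\<forall>t. 0 \<le> f t) \<and> f 0 = 1" using bump[of UNIV 0] by auto
  from someI_ex[OF this] show "reference \<in> Cc" "0 \<le> reference t" "reference 0 = 1"
    unfolding reference_def by auto
qed

lemma integral_reference_pos: "(\<integral>t. reference t \<partial>\<mu>) > 0"
  by (rule integral_Cc_pos[OF reference(1,2), of 0]) (simp add: reference(3))

text \<open>The factor gained by integrals under right translation, and the reciprocal of the
  modular function. Defined through one reference function, it is visibly continuous.\<close>

definition density :: "'g \<Rightarrow> real"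
  where "density s = (\<integral>t. reference (t + s) \<partial>\<mu>) / (\<integral>t. reference t \<partial>\<mu>)"

lemma integral_right_translate:
  fixes f :: "'g \<Rightarrow> real"
  shows "f \<in> Cc \<Longrightarrow> (\<integral>t. f (t + s) \<partial>\<mu>) = density s * (\<integral>t. f t \<partial>\<mu>)"
  using right_translate_proportional[OF _ reference(1), of f s] integral_reference_pos
  by (simp add: density_def field_simps)

lemma Cc_right_translate: "f \<in> Cc \<Longrightarrow> (\<lambda>t. f (t + s) :: 'b::real_normed_vector) \<in> (Cc :: ('g \<Rightarrow> 'b) set)"
proof -
  assume f: "f \<in> (Cc :: ('g \<Rightarrow> 'b) set)"
  then obtain K where K: "compact K" "\<And>t. t \<notin> K \<Longrightarrow> f t = 0" using CcD(2) by blast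
  have z: "f (t + s) = 0" if "t \<notin> (\<lambda>p. fst p + snd p) ` (K \<times> {- s})" for t
  proof (rule K(2), rule)
    assume "t + s \<in> K"
    then have "t \<in> (\<lambda>p. fst p + snd p) ` (K \<times> {- s})"
      by (intro image_eqI[of _ _ "(t + s, - s)"]) (auto simp: add.assoc)
    with that show False ..
  qed
  have "compact ((\<lambda>p. fst p + snd p) ` (K \<times> {- s}))" by (intro compact_plus K) simp
  moreover have "continuous_on UNIV (\<lambda>t. f (t + s))"
    by (rule continuous_on_UNIV_compose[OF CcD(1)[OF f]]) (intro continuous_on_pairs)
  ultimately show ?thesis using z by (intro CcI) auto
qed

lemma density_pos: "density s > 0"
proof -
  have "(\<integral>t. reference (t + s) \<partial>\<mu>) > 0"
    by (rule integral_Cc_pos[OF Cc_right_translate[OF reference(1)], of _ "- s"]) (auto simp: reference)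
  then show ?thesis using integral_reference_pos by (simp add: density_def)
qed

lemma density_add: "density (s + r) = density s * density r"
proof -
  have "(\<integral>t. reference (t + (s + r)) \<partial>\<mu>) = (\<integral>t. reference ((t + s) + r) \<partial>\<mu>)" by (simp add: add.assoc)
  also have "\<dots> = density s * (\<integral>t. reference (t + r) \<partial>\<mu>)"
    by (rule integral_right_translate[OF Cc_right_translate[OF reference(1)]])
  also have "\<dots> = density s * (density r * (\<integral>t. reference t \<partial>\<mu>))"
    by (simp only: integral_right_translate[OF reference(1)])
  finally show ?thesis using integral_reference_pos by (simp add: density_def)
qed

lemma density_minus: "density (- s) = inverse (density s)"
proof -
  have "density 0 = 1" using density_add[of 0 0] density_pos[of 0] by simp
  then have "density (- s) * density s = 1" using density_add[of "- s" s] by simp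
  then show ?thesis by (metis inverse_unique mult.commute)
qed

lemma continuous_density: "continuous_on UNIV density"
  unfolding density_def using integral_reference_pos
  by (intro continuous_on_divide continuous_right_translate reference(1) continuous_on_const) auto

text \<open>Taking the reference function for f in \<open>haar_exchange\<close> turns the inner
  integral into density s times a nonzero constant.\<close>

lemma integral_reflect_real:
  fixes g :: "'g \<Rightarrow> real"
  assumes "g \<in> Cc"
  shows "(\<integral>s. density s * g (- s) \<partial>\<mu>) = (\<integral>s. g s \<partial>\<mu>)"
proof -
  let ?I = "\<integral>t. reference t \<partial>\<mu>"
  have "?I * (\<integral>t. g t \<partial>\<mu>) = (\<integral>s. g (- s) * (density s * ?I) \<partial>\<mu>)"
    using haar_exchange[OF reference(1) assms] by (simp add: integral_right_translate[OF reference(1)])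
  also have "\<dots> = (\<integral>s. density s * g (- s) * ?I \<partial>\<mu>)" by (simp add: mult_ac)
  also have "\<dots> = (\<integral>s. density s * g (- s) \<partial>\<mu>) * ?I" by simp
  finally show ?thesis using integral_reference_pos by simp
qed

lemma integral_reflect:
  fixes g :: "'g \<Rightarrow> complex"
  assumes g: "g \<in> Cc"
  shows "(\<integral>s. density s *\<^sub>R g (- s) \<partial>\<mu>) = (\<integral>s. g s \<partial>\<mu>)"
proof -
  have gr: "(\<lambda>s. density s *\<^sub>R g (- s)) \<in> Cc"
    using Cc_compose[OF Cc_reflect[OF g], of "\<lambda>s v. density s *\<^sub>R v"] CcD(1)[OF Cc_reflect[OF g]]
    by (simp add: continuous_on_scaleR continuous_density)
  have "(\<lambda>s. Re (g s)) \<in> Cc" "(\<lambda>s. Im (g s)) \<in> Cc"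
    using Cc_compose[OF g, of "\<lambda>_. Re"] Cc_compose[OF g, of "\<lambda>_. Im"] CcD(1)[OF g]
    by (simp_all add: continuous_on_Re continuous_on_Im)
  from integral_reflect_real[OF this(1)] integral_reflect_real[OF this(2)]
  show ?thesis
    by (intro complex_eqI) (simp_all flip: integral_Re[OF integrable_Cc[OF gr]] integral_Re[OF integrable_Cc[OF g]]
        integral_Im[OF integrable_Cc[OF gr]] integral_Im[OF integrable_Cc[OF g]])
qed

section \<open>Right translates of Borel sets and the modular function\<close>

lemma right_translate_image: "(\<lambda>r. r + s) ` E = (\<lambda>r. r + - s) -` (E :: 'g set)"
  by (force simp: image_iff add.assoc)

lemma right_translate_open: "open U \<Longrightarrow> open ((\<lambda>r. r + s) ` (U :: 'g set))"
  unfolding right_translate_image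
  by (intro open_vimage continuous_on_add continuous_on_const continuous_on_id)

lemma right_translate_borel: "E \<in> sets borel \<Longrightarrow> (\<lambda>r. r + s) ` (E :: 'g set) \<in> sets borel"
proof -
  assume E: "E \<in> sets (borel :: 'g measure)"
  have "(\<lambda>r. r + - s) \<in> borel_measurable (borel :: 'g measure)"
    by (intro borel_measurable_continuous_onI continuous_on_add continuous_on_const continuous_on_id)
  from measurable_sets[OF this E] show ?thesis unfolding right_translate_image by simp
qed

text \<open>Inner regularity reduces the translate of U to a compact subset C; a Urysohn function
  between C and that translate carries the integral formula over to sets.\<close>

lemma emeasure_right_translate_open_le:
  assumes U: "open U"
  shows "ennreal (density s) * emeasure \<mu> ((\<lambda>r. r + s) ` U) \<le> emeasure \<mu> U"
proof -
  have inner: "\<And>U. open U \<Longrightarrow> emeasure \<mu> U = (SUP C\<in>{C. compact C \<and> C \<subseteq> U}. emeasure \<mu> C)"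
    using haar unfolding left_haar_measure_def by blast
  have "ennreal (density s) * emeasure \<mu> C \<le> emeasure \<mu> U" if C: "compact C" "C \<subseteq> (\<lambda>r. r + s) ` U" for C
  proof -
    obtain f :: "'g \<Rightarrow> real" where f: "f \<in> Cc" "\<And>t. 0 \<le> f t \<and> f t \<le> 1" "\<And>t. t \<in> C \<Longrightarrow> f t = 1"
      "\<And>t. t \<notin> (\<lambda>r. r + s) ` U \<Longrightarrow> f t = 0"
      using urysohn_compact[OF C(1) right_translate_open[OF U] C(2)] by blast
    have "emeasure \<mu> C = (\<integral>\<^sup>+t. indicator C t \<partial>\<mu>)" by (simp add: compact_sets[OF C(1)])
    also have "\<dots> \<le> (\<integral>\<^sup>+t. ennreal (f t) \<partial>\<mu>)"
      using f(2,3) by (intro nn_integral_mono) (auto simp: indicator_def)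
    also have "\<dots> = ennreal (\<integral>t. f t \<partial>\<mu>)"
      using f(2) by (intro nn_integral_eq_integral integrable_Cc f(1)) auto
    finally have "ennreal (density s) * emeasure \<mu> C \<le> ennreal (density s) * ennreal (\<integral>t. f t \<partial>\<mu>)"
      by (rule mult_left_mono) simp
    also have "\<dots> = ennreal (\<integral>t. f (t + s) \<partial>\<mu>)"
      unfolding integral_right_translate[OF f(1)] using density_pos[of s] f(2)
      by (subst ennreal_mult) (auto intro!: Bochner_Integration.integral_nonneg simp: less_imp_le)
    also have "\<dots> = (\<integral>\<^sup>+t. ennreal (f (t + s)) \<partial>\<mu>)"
      using f(2) by (intro nn_integral_eq_integral[symmetric] integrable_Cc Cc_right_translate f(1)) auto
    also have "\<dots> \<le> (\<integral>\<^sup>+t. indicator U t \<partial>\<mu>)"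
    proof (rule nn_integral_mono)
      fix t
      have "t + s \<in> (\<lambda>r. r + s) ` U \<longleftrightarrow> t \<in> U" by auto
      then show "ennreal (f (t + s)) \<le> indicator U t"
        using f(2)[of "t + s"] f(4)[of "t + s"] by (cases "t \<in> U") auto
    qed
    also have "\<dots> = emeasure \<mu> U" using U by (simp add: sets_eq)
    finally show ?thesis .
  qed
  then show ?thesis
    unfolding inner[OF right_translate_open[OF U]] by (subst SUP_mult_left_ennreal) (auto intro!: SUP_least)
qed

lemma emeasure_right_translate_le:
  assumes E: "E \<in> sets borel"
  shows "ennreal (density s) * emeasure \<mu> ((\<lambda>r. r + s) ` E) \<le> emeasure \<mu> E"
proof -
  have "emeasure \<mu> E = (INF U\<in>{U. open U \<and> E \<subseteq> U}. emeasure \<mu> U)"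
    using haar E unfolding left_haar_measure_def by blast
  also have "\<dots> \<ge> ennreal (density s) * emeasure \<mu> ((\<lambda>r. r + s) ` E)"
  proof (rule INF_greatest)
    fix U assume "U \<in> {U. open U \<and> E \<subseteq> U}"
    then have U: "open U" "E \<subseteq> U" by auto
    have "ennreal (density s) * emeasure \<mu> ((\<lambda>r. r + s) ` E) \<le> ennreal (density s) * emeasure \<mu> ((\<lambda>r. r + s) ` U)"
      using U right_translate_open[OF U(1), of s] by (intro mult_left_mono emeasure_mono) (auto simp: sets_eq)
    also have "\<dots> \<le> emeasure \<mu> U" by (rule emeasure_right_translate_open_le[OF U(1)])
    finally show "ennreal (density s) * emeasure \<mu> ((\<lambda>r. r + s) ` E) \<le> emeasure \<mu> U" .
  qed
  finally show ?thesis .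
qed

text \<open>The inequality for s, and the same inequality for - s applied to the translated set, are
  reciprocal because \<open>density\<close> is multiplicative.\<close>

lemma emeasure_right_translate:
  assumes E: "E \<in> sets borel"
  shows "emeasure \<mu> ((\<lambda>r. r + s) ` E) = ennreal (inverse (density s)) * emeasure \<mu> E"
proof (rule antisym)
  have d: "ennreal (inverse (density s)) * ennreal (density s) = 1"
    using density_pos[of s] by (simp flip: ennreal_mult)
  have "emeasure \<mu> ((\<lambda>r. r + s) ` E) = ennreal (inverse (density s)) * (ennreal (density s) * emeasure \<mu> ((\<lambda>r. r + s) ` E))"
    by (simp add: d flip: mult.assoc)
  also have "\<dots> \<le> ennreal (inverse (density s)) * emeasure \<mu> E"
    by (intro mult_left_mono emeasure_right_translate_le E) simp
  finally show "emeasure \<mu> ((\<lambda>r. r + s) ` E) \<le> ennreal (inverse (density s)) * emeasure \<mu> E" .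
  have "(\<lambda>r. r + - s) ` (\<lambda>r. r + s) ` E = E" by (force simp: image_iff add.assoc)
  then show "ennreal (inverse (density s)) * emeasure \<mu> E \<le> emeasure \<mu> ((\<lambda>r. r + s) ` E)"
    using emeasure_right_translate_le[OF right_translate_borel[OF E], of "- s" s] by (simp add: density_minus)
qed

lemma inverse_modular_function: "inverse (modular_function \<mu> s) = density s"
proof -
  have "modular_function \<mu> s = inverse (density s)"
    unfolding modular_function_def
  proof (rule the_equality)
    show "0 < inverse (density s) \<and> (\<forall>E\<in>sets borel. emeasure \<mu> ((\<lambda>r. r + s) ` E) = ennreal (inverse (density s)) * emeasure \<mu> E)"
      using density_pos[of s] emeasure_right_translate by simp
    fix d assume d: "0 < d \<and> (\<forall>E\<in>sets borel. emeasure \<mu> ((\<lambda>r. r + s) ` E) = ennreal d * emeasure \<mu> E)"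
    \<comment> \<open>Uniqueness of the factor is read off a set of positive finite measure; measure
      0 or \<infinity> would admit every d.\<close>
    obtain U K where U: "open U" "compact K" "(0::'g) \<in> U" "U \<subseteq> K" by (rule compact_neighbourhood)
    have K: "K \<in> sets borel" using U(2) by (rule borel_compact)
    have "emeasure \<mu> U \<le> emeasure \<mu> K" using U(4) K by (intro emeasure_mono) (auto simp: sets_eq)
    then have pos: "emeasure \<mu> K \<noteq> 0" using emeasure_open_pos[OF U(1)] U(3) by (metis empty_iff le_zero_eq)
    have fin: "emeasure \<mu> K = ennreal (measure \<mu> K)"
      using finite_compact[OF U(2)] by (intro emeasure_eq_ennreal_measure) auto
    have "ennreal d * emeasure \<mu> K = ennreal (inverse (density s)) * emeasure \<mu> K"
      using d K emeasure_right_translate[OF K, of s] by metis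
    then have "d * measure \<mu> K = inverse (density s) * measure \<mu> K"
      using d density_pos[of s] by (simp add: fin flip: ennreal_mult)
    then show "d = inverse (density s)" using pos fin by auto
  qed
  then show ?thesis by simp
qed

end

section \<open>The integrated form of a covariant completely positive map\<close>

text \<open>The optimal c is - cnj z / b. For b = 0 the linear term must vanish, since a large
  negative multiple of cnj z would violate the inequality. This is Cauchy-Schwarz for a possibly
  degenerate form.\<close>

lemma quadratic_nonneg_imp:
  fixes z :: complex
  assumes b: "b \<ge> 0" and q: "\<And>c. 0 \<le> a + 2 * Re (c * z) + (cmod c)\<^sup>2 * b"
  shows "(cmod z)\<^sup>2 \<le> a * b"
proof (cases "b = 0")
  case True
  have "z = 0"
  proof (rule ccontr)
    assume z: "z \<noteq> 0"
    have a: "a \<ge> 0" using q[of 0] by simp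
    have re: "Re (complex_of_real r * cnj z * z) = r * (cmod z)\<^sup>2" for r
      unfolding cmod_power2 by (simp add: power2_eq_square algebra_simps)
    have "0 \<le> a + 2 * (- (a + 1) / (cmod z)\<^sup>2 * (cmod z)\<^sup>2)"
      using q[of "complex_of_real (- (a + 1) / (cmod z)\<^sup>2) * cnj z"] True unfolding re by simp
    also have "- (a + 1) / (cmod z)\<^sup>2 * (cmod z)\<^sup>2 = - (a + 1)" using z by simp
    finally show False using a by simp
  qed
  then show ?thesis using True by simp
next
  case False
  have re: "Re (complex_of_real r * cnj z * z) = r * (cmod z)\<^sup>2" for r
    unfolding cmod_power2 by (simp add: power2_eq_square algebra_simps)
  have "0 \<le> a + 2 * (- 1 / b * (cmod z)\<^sup>2) + (cmod (complex_of_real (- 1 / b) * cnj z))\<^sup>2 * b"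
    using q[of "complex_of_real (- 1 / b) * cnj z"] unfolding re .
  also have "\<dots> = a - (cmod z)\<^sup>2 / b"
    using False b by (simp add: norm_mult norm_divide power_mult_distrib power_divide power2_eq_square field_simps)
  finally show ?thesis using False b by (simp add: field_simps)
qed

text \<open>Resolves an estimate in which a norm occurs on both sides.\<close>

lemma le_add_sqrt_if_square_le:
  fixes x a b :: real
  assumes "x\<^sup>2 \<le> a * x + b" "x \<ge> 0" "a \<ge> 0" "b \<ge> 0"
  shows "x \<le> a + sqrt b"
proof (rule ccontr)
  assume "\<not> ?thesis"
  then have x: "x > a + sqrt b" by simp
  have sb: "sqrt b \<ge> 0" "sqrt b * sqrt b = b" using assms(4) by auto
  then have "x > 0" "sqrt b \<le> x" using x assms(3) real_sqrt_gt_0_iff[of b] assms(2) by (smt (verit))+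
  then have "(a + sqrt b) * x < x * x" "sqrt b * sqrt b \<le> sqrt b * x"
    using x sb(1) by (auto intro: mult_strict_right_mono mult_left_mono simp del: real_sqrt_mult_self)
  then have "x * x > a * x + b" using sb(2) by (simp add: distrib_right)
  with assms(1) show False by (simp add: power2_eq_square)
qed

lemma sum_list_nth_lessThan: "sum_list (map f xs) = (\<Sum>i<length xs. f (xs ! i))"
  by (simp add: sum_list_sum_nth atLeast0LessThan)

lemma continuous_on_compose_pair:
  assumes "continuous_on UNIV (\<lambda>p. T (fst p) (snd p))" "continuous_on S f" "continuous_on S g"
  shows "continuous_on S (\<lambda>x. T (f x) (g x))"
  using continuous_on_compose2[OF assms(1) continuous_on_Pair[OF assms(2,3)]] by simp

locale unitary_rep =
  fixes u :: "'g::topological_group_add \<Rightarrow> 'h::chilbert_space \<Rightarrow> 'h"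
  assumes rep: "unitary_representation u"
begin

lemma clinear: "bounded_clinear (u t)"
  using rep by (auto simp: unitary_representation_def unitary_op_def)

lemmas apply_simps = bounded_clinearD(2-)[OF clinear]

lemma plus: "u (s + t) h = u s (u t h)"
  using rep by (auto simp: unitary_representation_def)

lemma cinner_eq: "cinner (u t h) (u t k) = cinner h k"
proof -
  have "adjoint_op (u t) (u t h) = h"
    using rep unfolding unitary_representation_def unitary_op_def by (metis comp_apply id_apply)
  then show ?thesis using adjoint_op[OF clinear, of t "u t h" k] by simp
qed

lemma norm_eq: "norm (u t h) = norm h"
proof -
  have "complex_of_real ((norm (u t h))\<^sup>2) = complex_of_real ((norm h)\<^sup>2)"
    using cinner_eq[of t h h] unfolding cinner_self .
  then have "(norm (u t h))\<^sup>2 = (norm h)\<^sup>2" unfolding of_real_eq_iff .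
  then show ?thesis by simp
qed

lemma zero: "u 0 h = h"
proof -
  have "norm (u 0 h - h) = norm (u 0 (u 0 h - h))" by (simp add: norm_eq)
  also have "\<dots> = 0" using plus[of 0 0 h] by (simp add: apply_simps)
  finally show ?thesis by simp
qed

lemma inverse [simp]: "u (- t) (u t h) = h" "u t (u (- t) h) = h"
  using plus[of "- t" t h] plus[of t "- t" h] by (simp_all add: zero)

lemma adjoint: "adjoint_op (u t) = u (- t)"
proof
  fix h show "adjoint_op (u t) h = u (- t) h"
    by (rule adjoint_op_eqI[OF clinear]) (metis cinner_eq inverse(2))
qed

lemma cinner_left: "cinner (u t h) k = cinner h (u (- t) k)"
  by (metis cinner_eq inverse(2))

text \<open>Strong continuity of isometries is joint continuity: u (t y) (f y - f x) is small
  regardless of t y, and u (t y) (f x) is covered by strong continuity.\<close>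

lemma continuous_apply:
  assumes t: "continuous_on S t" and f: "continuous_on S f"
  shows "continuous_on S (\<lambda>x. u (t x) (f x))"
  unfolding continuous_on_def
proof
  fix x assume x: "x \<in> S"
  have "((\<lambda>y. norm (f y - f x)) \<longlongrightarrow> norm (f x - f x)) (at x within S)"
    by (intro tendsto_norm tendsto_diff tendsto_const) (use f x in \<open>simp add: continuous_on_def\<close>)
  then have "((\<lambda>y. u (t y) (f y - f x)) \<longlongrightarrow> 0) (at x within S)"
    by (rule_tac tendsto_norm_zero_cancel) (simp add: norm_eq)
  moreover have "continuous_on S (\<lambda>y. u (t y) (f x))"
    using rep by (intro continuous_on_compose2[OF _ t, of UNIV "\<lambda>t. u t (f x)"]) (auto simp: unitary_representation_def)
  then have "((\<lambda>y. u (t y) (f x)) \<longlongrightarrow> u (t x) (f x)) (at x within S)"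
    using x by (auto simp: continuous_on_def)
  ultimately have "((\<lambda>y. u (t y) (f y - f x) + u (t y) (f x)) \<longlongrightarrow> 0 + u (t x) (f x)) (at x within S)"
    by (rule tendsto_add)
  then show "((\<lambda>y. u (t y) (f y)) \<longlongrightarrow> u (t x) (f x)) (at x within S)"
    by (simp add: apply_simps)
qed

end

locale covariant_cp = haar_measure \<mu> + phi: cp_map \<phi> + u: unitary_rep u
  for \<mu> :: "'g::{topological_group_add, t2_space} measure"
    and \<phi> :: "'a::cstar_algebra \<Rightarrow> 'h::chilbert_space \<Rightarrow> 'h"
    and u :: "'g \<Rightarrow> 'h \<Rightarrow> 'h" +
  fixes \<alpha> :: "'g \<Rightarrow> 'a \<Rightarrow> 'a"
  assumes action: "algebra_action \<alpha>"
    and covariant: "\<phi> (\<alpha> t a) (u t h) = u t (\<phi> a h)"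
begin

lemma alpha_simps: "\<alpha> t (a + b) = \<alpha> t a + \<alpha> t b" "\<alpha> t (c *\<^sub>C a) = c *\<^sub>C \<alpha> t a"
  "\<alpha> t (a * b) = \<alpha> t a * \<alpha> t b" "\<alpha> t (star a) = star (\<alpha> t a)"
  using action by (auto simp: algebra_action_def star_homomorphism_def)

lemma alpha_plus: "\<alpha> (s + t) a = \<alpha> s (\<alpha> t a)"
  using action by (auto simp: algebra_action_def)

lemma alpha_scaleR: "\<alpha> t (r *\<^sub>R a) = r *\<^sub>R \<alpha> t a"
  by (simp add: scaleR_scaleC alpha_simps)

lemma alpha_zero_right [simp]: "\<alpha> t 0 = 0"
  using alpha_scaleR[of t 0 0] by simp

lemma alpha_zero_left [simp]: "\<alpha> 0 a = a"
proof -
  have "bij (\<alpha> 0)" using action by (auto simp: algebra_action_def)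
  then show ?thesis using alpha_plus[of 0 0 a] by (simp add: bij_def inj_eq)
qed

lemma alpha_inverse [simp]: "\<alpha> (- t) (\<alpha> t a) = a" "\<alpha> t (\<alpha> (- t) a) = a"
  by (simp_all flip: alpha_plus)

lemma continuous_alpha:
  "continuous_on S t \<Longrightarrow> continuous_on S f \<Longrightarrow> continuous_on S (\<lambda>x. \<alpha> (t x) (f x))"
  by (rule continuous_on_compose_pair[of \<alpha>]) (use action in \<open>auto simp: algebra_action_def case_prod_unfold\<close>)

lemma covariant': "\<phi> (\<alpha> t a) h = u t (\<phi> a (u (- t) h))"
  using covariant[of t a "u (- t) h"] by simp

lemma continuous_phi:
  "continuous_on S f \<Longrightarrow> continuous_on S g \<Longrightarrow> continuous_on S (\<lambda>x. \<phi> (f x) (g x))"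
  by (rule phi.continuous_on_apply)

section \<open>Convolution and involution under test functionals\<close>

text \<open>Integrands depending linearly on the algebra element and jointly continuously on it and
  the group element. Coefficients of \<phi> and of the dilation are both of this kind, so the
  integral formulas are derived once for both.\<close>

definition functional :: "('a \<Rightarrow> 'g \<Rightarrow> complex) \<Rightarrow> bool"
  where "functional b \<longleftrightarrow> (\<forall>t. bounded_linear (\<lambda>a. b a t)) \<and> continuous_on UNIV (\<lambda>p. b (fst p) (snd p))"

lemma functional_simps:
  assumes "functional b"
  shows "bounded_linear (\<lambda>a. b a t)" "b 0 t = 0" "b (r *\<^sub>R a) t = r *\<^sub>R b a t"
    "continuous_on S f \<Longrightarrow> continuous_on S g \<Longrightarrow> continuous_on S (\<lambda>x. b (f x) (g x))"
proof -
  show bl: "bounded_linear (\<lambda>a. b a t)" for t using assms by (simp add: functional_def)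
  show "b 0 t = 0" "b (r *\<^sub>R a) t = r *\<^sub>R b a t" using linear_simps[OF bl] by auto
  show "continuous_on S f \<Longrightarrow> continuous_on S g \<Longrightarrow> continuous_on S (\<lambda>x. b (f x) (g x))"
    using assms by (rule_tac continuous_on_compose_pair[of b]) (simp_all add: functional_def)
qed

text \<open>Convolutions and the inner product of the crossed product module both have the form
  \<open>s \<mapsto> \<integral> F(s,t) dt\<close> with \<open>F\<close> supported in a compact rectangle.\<close>

lemma Cc_parameter_integral:
  fixes F :: "'g \<times> 'g \<Rightarrow> 'a"
  assumes F: "continuous_on UNIV F" and K: "compact K" and z: "\<And>s t. s \<notin> K \<or> t \<notin> K \<Longrightarrow> F (s, t) = 0"
  shows "(\<lambda>s. vector_integral \<mu> (\<lambda>t. F (s, t))) \<in> Cc"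
proof (rule CcI[OF _ K])
  show "continuous_on UNIV (\<lambda>s. vector_integral \<mu> (\<lambda>t. F (s, t)))"
    by (rule continuous_on_vector_integral[OF F K]) (use z in blast)
  show "vector_integral \<mu> (\<lambda>t. F (s, t)) = 0" if "s \<notin> K" for s
  proof -
    have "(\<lambda>t. F (s, t)) = (\<lambda>t. 0)" using z that by auto
    moreover have "vector_integral \<mu> (\<lambda>t. 0 :: 'a) = 0"
      using linear_vector_integral'[OF bounded_linear_zero, of "\<lambda>t. 0 :: 'a"] by (simp add: CcI[of _ "{}"])
    ultimately show ?thesis by simp
  qed
qed

lemma functional_parameter_integral:
  fixes F :: "'g \<times> 'g \<Rightarrow> 'a"
  assumes F: "continuous_on UNIV F" and K: "compact K" and z: "\<And>s t. s \<notin> K \<or> t \<notin> K \<Longrightarrow> F (s, t) = 0"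
    and b: "functional b"
  shows "(\<integral>s. b (vector_integral \<mu> (\<lambda>t. F (s, t))) s \<partial>\<mu>) = (\<integral>t. \<integral>s. b (F (s, t)) s \<partial>\<mu> \<partial>\<mu>)"
proof -
  have "(\<integral>s. b (vector_integral \<mu> (\<lambda>t. F (s, t))) s \<partial>\<mu>) = (\<integral>s. \<integral>t. b (F (s, t)) s \<partial>\<mu> \<partial>\<mu>)"
  proof (rule Bochner_Integration.integral_cong[OF refl])
    fix s
    have "(\<lambda>t. F (s, t)) \<in> Cc" by (rule Cc_slice(1)[OF F K]) (use z in blast)
    then show "b (vector_integral \<mu> (\<lambda>t. F (s, t))) s = (\<integral>t. b (F (s, t)) s \<partial>\<mu>)"
      by (rule linear_vector_integral[OF functional_simps(1)[OF b]])
  qed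
  also have "\<dots> = (\<integral>t. \<integral>s. b (F (s, t)) s \<partial>\<mu> \<partial>\<mu>)"
  proof -
    have "continuous_on UNIV (\<lambda>p. b (F p) (fst p))"
      by (intro functional_simps(4)[OF b] F continuous_on_fst continuous_on_id)
    from Fubini_Cc[OF this K] show ?thesis using z by (simp add: functional_simps(2)[OF b])
  qed
  finally show ?thesis .
qed

lemma convolution_kernel:
  assumes f: "f \<in> Cc" and g: "g \<in> Cc"
  obtains K where "compact K" "continuous_on UNIV (\<lambda>p. f (snd p) * \<alpha> (snd p) (g (- snd p + fst p)))"
    "\<And>s t. s \<notin> K \<or> t \<notin> K \<Longrightarrow> f t * \<alpha> t (g (- t + s)) = 0"
proof -
  obtain K where K: "compact K" "\<And>t. t \<notin> K \<Longrightarrow> f t = 0" using CcD(2)[OF f] by blast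
  obtain L where L: "compact L" "\<And>t. t \<notin> L \<Longrightarrow> g t = 0" using CcD(2)[OF g] by blast
  let ?P = "(\<lambda>p. fst p + snd p) ` (K \<times> L)"
  show thesis
  proof (rule that)
    show "compact (K \<union> ?P)" by (intro compact_Un compact_plus K L)
    show "continuous_on UNIV (\<lambda>p. f (snd p) * \<alpha> (snd p) (g (- snd p + fst p)))"
      by (intro continuous_on_mult continuous_alpha continuous_on_UNIV_compose[OF CcD(1)[OF f]]
          continuous_on_UNIV_compose[OF CcD(1)[OF g]] continuous_on_pairs)
    fix s t assume st: "s \<notin> K \<union> ?P \<or> t \<notin> K \<union> ?P"
    show "f t * \<alpha> t (g (- t + s)) = 0"
    proof (rule ccontr)
      assume "f t * \<alpha> t (g (- t + s)) \<noteq> 0"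
      then have "f t \<noteq> 0" "g (- t + s) \<noteq> 0" by auto
      then have ts: "t \<in> K" "- t + s \<in> L" using K(2) L(2) by blast+
      moreover have "s = t + (- t + s)" by (simp add: add.assoc[symmetric])
      ultimately have "s \<in> ?P" by (intro image_eqI[of _ _ "(t, - t + s)"]) auto
      with st ts(1) show False by blast
    qed
  qed
qed

lemma convolution_Cc: "f \<in> Cc \<Longrightarrow> g \<in> Cc \<Longrightarrow> convolution \<mu> \<alpha> f g \<in> Cc"
proof -
  assume "f \<in> Cc" "g \<in> Cc"
  then obtain K where K: "compact K" "continuous_on UNIV (\<lambda>p. f (snd p) * \<alpha> (snd p) (g (- snd p + fst p)))"
    "\<And>s t. s \<notin> K \<or> t \<notin> K \<Longrightarrow> f t * \<alpha> t (g (- t + s)) = 0"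
    using convolution_kernel by blast
  have "(\<lambda>s. vector_integral \<mu> (\<lambda>t. f (snd (s, t)) * \<alpha> (snd (s, t)) (g (- snd (s, t) + fst (s, t))))) \<in> Cc"
    by (rule Cc_parameter_integral[OF K(2,1)]) (use K(3) in simp)
  then show ?thesis by (simp add: convolution_def)
qed

lemma functional_convolution:
  assumes f: "f \<in> Cc" and g: "g \<in> Cc" and b: "functional b"
  shows "(\<integral>s. b (convolution \<mu> \<alpha> f g s) s \<partial>\<mu>) = (\<integral>t. \<integral>s. b (f t * \<alpha> t (g s)) (t + s) \<partial>\<mu> \<partial>\<mu>)"
proof -
  obtain K where K: "compact K" "continuous_on UNIV (\<lambda>p. f (snd p) * \<alpha> (snd p) (g (- snd p + fst p)))"
    "\<And>s t. s \<notin> K \<or> t \<notin> K \<Longrightarrow> f t * \<alpha> t (g (- t + s)) = 0"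
    using convolution_kernel[OF f g] by blast
  have "(\<integral>s. b (convolution \<mu> \<alpha> f g s) s \<partial>\<mu>) = (\<integral>t. \<integral>s. b (f t * \<alpha> t (g (- t + s))) s \<partial>\<mu> \<partial>\<mu>)"
    unfolding convolution_def using functional_parameter_integral[OF K(2,1) _ b] K(3) by simp
  also have "\<dots> = (\<integral>t. \<integral>s. b (f t * \<alpha> t (g s)) (t + s) \<partial>\<mu> \<partial>\<mu>)"
  proof (rule Bochner_Integration.integral_cong[OF refl])
    fix t
    have "continuous_on UNIV (\<lambda>s. b (f t * \<alpha> t (g (- t + s))) s)"
      by (intro functional_simps(4)[OF b] continuous_on_mult continuous_alpha
          continuous_on_UNIV_compose[OF CcD(1)[OF g]] continuous_on_pairs)
    from integral_translate[OF this, of t]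
    show "(\<integral>s. b (f t * \<alpha> t (g (- t + s))) s \<partial>\<mu>) = (\<integral>s. b (f t * \<alpha> t (g s)) (t + s) \<partial>\<mu>)"
      by (simp add: add.assoc[symmetric])
  qed
  finally show ?thesis .
qed

lemma involution_eq: "involution \<mu> \<alpha> f = (\<lambda>s. density s *\<^sub>R \<alpha> s (star (f (- s))))"
  by (simp add: involution_def inverse_modular_function)

lemma involution_Cc: "f \<in> Cc \<Longrightarrow> involution \<mu> \<alpha> f \<in> Cc"
  unfolding involution_eq
  by (rule Cc_compose[OF Cc_reflect, of f "\<lambda>s v. density s *\<^sub>R \<alpha> s (star v)"])
     (simp_all add: continuous_on_scaleR continuous_density continuous_alpha continuous_on_star continuous_on_id CcD(1) Cc_reflect)

text \<open>The substitution of - s for s produces exactly the density that the involution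
  carries.\<close>

lemma functional_involution:
  assumes f: "f \<in> Cc" and b: "functional b"
  shows "(\<integral>s. b (involution \<mu> \<alpha> f s) s \<partial>\<mu>) = (\<integral>s. b (\<alpha> (- s) (star (f s))) (- s) \<partial>\<mu>)"
proof -
  have "(\<lambda>s. b (\<alpha> (- s) (star (f s))) (- s)) \<in> Cc"
    by (rule Cc_compose[OF f, of "\<lambda>s v. b (\<alpha> (- s) (star v)) (- s)"])
       (auto intro!: functional_simps(4)[OF b] continuous_alpha continuous_on_star continuous_on_id continuous_on_minus
         CcD(1)[OF f] simp: functional_simps(2)[OF b])
  from integral_reflect[OF this] show ?thesis by (simp add: involution_eq functional_simps(3)[OF b])
qed

text \<open>The density is absorbed by the inversion formula, which leaves two plain integrals over
  star (f t) * g s. Positivity and the C*-identity both start from this form.\<close>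

lemma functional_involution_convolution:
  assumes f: "f \<in> Cc" and g: "g \<in> Cc" and b: "functional b"
  shows "(\<integral>s. b (convolution \<mu> \<alpha> (involution \<mu> \<alpha> f) g s) s \<partial>\<mu>)
    = (\<integral>t. \<integral>s. b (\<alpha> (- t) (star (f t) * g s)) (- t + s) \<partial>\<mu> \<partial>\<mu>)"
proof -
  obtain K where K: "compact K" "\<And>t. t \<notin> K \<Longrightarrow> f t = 0" using CcD(2)[OF f] by blast
  obtain L where L: "compact L" "\<And>t. t \<notin> L \<Longrightarrow> g t = 0" using CcD(2)[OF g] by blast
  have F: "continuous_on UNIV (\<lambda>p. b (\<alpha> (- fst p) (star (f (fst p)) * g (snd p))) (- fst p + snd p))"
    by (intro functional_simps(4)[OF b] continuous_on_mult continuous_alpha continuous_on_star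
        continuous_on_UNIV_compose[OF CcD(1)[OF f]] continuous_on_UNIV_compose[OF CcD(1)[OF g]] continuous_on_pairs)
  have "(\<lambda>t. \<integral>s. b (\<alpha> (- t) (star (f t) * g s)) (- t + s) \<partial>\<mu>) \<in> Cc"
  proof -
    have z: "b (\<alpha> (- fst (s, t)) (star (f (fst (s, t))) * g (snd (s, t)))) (- fst (s, t) + snd (s, t)) = 0"
      if "s \<notin> K \<union> L \<or> t \<notin> K \<union> L" for s t
      using that K(2) L(2) by (auto simp: functional_simps(2)[OF b])
    from Cc_integral[OF F compact_Un[OF K(1) L(1)] z] show ?thesis by simp
  qed
  from integral_reflect[OF this]
  have "(\<integral>t. density t *\<^sub>R (\<integral>s. b (\<alpha> t (star (f (- t)) * g s)) (t + s) \<partial>\<mu>) \<partial>\<mu>)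
      = (\<integral>t. \<integral>s. b (\<alpha> (- t) (star (f t) * g s)) (- t + s) \<partial>\<mu> \<partial>\<mu>)" by simp
  moreover have "(\<integral>s. b (convolution \<mu> \<alpha> (involution \<mu> \<alpha> f) g s) s \<partial>\<mu>)
      = (\<integral>t. density t *\<^sub>R (\<integral>s. b (\<alpha> t (star (f (- t)) * g s)) (t + s) \<partial>\<mu>) \<partial>\<mu>)"
    unfolding functional_convolution[OF involution_Cc[OF f] g b]
    by (simp add: involution_eq functional_simps(3)[OF b] alpha_simps)
  ultimately show ?thesis by simp
qed

section \<open>The C*-seminorm of the dilation\<close>

text \<open>Finite lists represent vectors \<open>\<Sum> b \<otimes> h\<close> of the Stinespring space of \<open>\<phi>\<close>, which is not completed
  and not divided by its null vectors; \<open>shift (f t) t\<close> is the integrand of the integrated form.\<close>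

definition form :: "'a \<times> 'h \<Rightarrow> 'a \<times> 'h \<Rightarrow> complex"
  where "form x y = cinner (snd x) (\<phi> (star (fst x) * fst y) (snd y))"

definition sesq :: "('a \<times> 'h) list \<Rightarrow> ('a \<times> 'h) list \<Rightarrow> complex"
  where "sesq xs ys = sum_list (map (\<lambda>x. sum_list (map (form x) ys)) xs)"

definition shift :: "'a \<Rightarrow> 'g \<Rightarrow> 'a \<times> 'h \<Rightarrow> 'a \<times> 'h"
  where "shift a t x = (a * \<alpha> t (fst x), u t (snd x))"

definition scale :: "complex \<Rightarrow> 'a \<times> 'h \<Rightarrow> 'a \<times> 'h"
  where "scale c x = (fst x, c *\<^sub>C snd x)"

definition nrm :: "('a \<times> 'h) list \<Rightarrow> real"
  where "nrm xs = sqrt (Re (sesq xs xs))"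

lemma sesq_index: "sesq xs ys = (\<Sum>i<length xs. \<Sum>j<length ys. form (xs ! i) (ys ! j))"
  by (simp add: sesq_def sum_list_nth_lessThan)

lemma form_commute: "form x y = cnj (form y x)"
  unfolding form_def by (subst phi.hermitian) (simp add: star_mult star_star)

lemma sesq_commute: "sesq xs ys = cnj (sesq ys xs)"
  unfolding sesq_index by (subst sum.swap) (simp add: form_commute[symmetric])

lemma sesq_positive: "sesq xs xs \<in> \<real>\<^sub>\<ge>\<^sub>0"
  unfolding sesq_index form_def using phi.positive_row by simp

lemma sesq_append: "sesq (xs @ ys) zs = sesq xs zs + sesq ys zs" "sesq zs (xs @ ys) = sesq zs xs + sesq zs ys"
  by (simp_all add: sesq_def sum_list_addf)

lemma form_scale: "form x (scale c y) = c * form x y" "form (scale c x) y = cnj c * form x y"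
  by (simp_all add: form_def scale_def phi.apply_simps cinner_scaleC_right cinner_scaleC_left)

lemma sesq_scale: "sesq xs (map (scale c) ys) = c * sesq xs ys" "sesq (map (scale c) xs) ys = cnj c * sesq xs ys"
  by (simp_all add: sesq_index form_scale sum_distrib_left)

lemma sesq_concat:
  "sesq zs (concat (map F ks)) = sum_list (map (\<lambda>k. sesq zs (F k)) ks)"
  "sesq (concat (map F ks)) zs = sum_list (map (\<lambda>k. sesq (F k) zs) ks)"
  by (induction ks) (simp_all add: sesq_append, simp_all add: sesq_def)

lemma nrm_nonneg: "nrm xs \<ge> 0"
  using sesq_positive[of xs] by (simp add: nrm_def complex_nonneg_Reals_iff)

lemma nrm_square: "(nrm xs)\<^sup>2 = Re (sesq xs xs)"
  using sesq_positive[of xs] by (simp add: nrm_def complex_nonneg_Reals_iff)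

lemma sesq_self: "sesq xs xs = complex_of_real ((nrm xs)\<^sup>2)"
  using sesq_positive[of xs] by (intro complex_eqI) (simp_all add: nrm_square complex_nonneg_Reals_iff del: of_real_power)

lemma norm_sesq_le: "cmod (sesq xs ys) \<le> nrm xs * nrm ys"
proof -
  have "(cmod (sesq xs ys))\<^sup>2 \<le> (nrm xs)\<^sup>2 * (nrm ys)\<^sup>2"
  proof (rule quadratic_nonneg_imp)
    fix c
    have "0 \<le> Re (sesq (xs @ map (scale c) ys) (xs @ map (scale c) ys))"
      using sesq_positive complex_nonneg_Reals_iff by blast
    also have "\<dots> = Re (sesq xs xs) + Re (c * sesq xs ys) + Re (cnj c * sesq ys xs) + Re (cnj c * c * sesq ys ys)"
      by (simp add: sesq_append sesq_scale algebra_simps)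
    also have "cnj c * sesq ys xs = cnj (c * sesq xs ys)" by (simp add: sesq_commute[of ys xs])
    also have "Re (cnj c * c * sesq ys ys) = (cmod c)\<^sup>2 * (nrm ys)\<^sup>2"
      unfolding sesq_self cmod_power2 by (simp add: power2_eq_square algebra_simps)
    finally show "0 \<le> (nrm xs)\<^sup>2 + 2 * Re (c * sesq xs ys) + (cmod c)\<^sup>2 * (nrm ys)\<^sup>2"
      by (simp add: nrm_square)
  qed simp
  then have "(cmod (sesq xs ys))\<^sup>2 \<le> (nrm xs * nrm ys)\<^sup>2" by (simp add: power_mult_distrib)
  then show ?thesis by (rule power2_le_imp_le) (simp add: nrm_nonneg)
qed

text \<open>In the dilation, the adjoint of \<pi>(a) v_t times \<pi>(b) v_s is
  \<pi>(\<alpha>_(-t)(star a * b)) v_(-t+s). The right-hand side is a form of two orbit vectors, so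
  coefficients of an involution convolved with a function become double integrals of inner
  products.\<close>

lemma form_shift:
  "form x (shift (\<alpha> (- t) (star a * b)) (- t + s) y) = form (shift a t x) (shift b s y)"
proof -
  have "star (fst x) * (\<alpha> (- t) (star a * b) * \<alpha> (- t + s) (fst y)) = \<alpha> (- t) (star (a * \<alpha> t (fst x)) * (b * \<alpha> s (fst y)))"
    by (simp add: alpha_simps star_mult alpha_plus mult.assoc)
  then show ?thesis
    by (simp add: form_def shift_def covariant' u.plus u.cinner_left)
qed

lemma shift_compose: "shift (a * \<alpha> t b) (t + s) y = shift a t (shift b s y)"
  by (simp add: shift_def alpha_plus alpha_simps u.plus mult.assoc)

lemma form_shift_adjoint: "form x (shift (\<alpha> (- t) (star a)) (- t) y) = form (shift a t x) y"
proof -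
  have "star (fst x) * (\<alpha> (- t) (star a) * \<alpha> (- t) (fst y)) = \<alpha> (- t) (star (a * \<alpha> t (fst x)) * fst y)"
    by (simp add: alpha_simps star_mult mult.assoc)
  then show ?thesis by (simp add: form_def shift_def covariant' u.cinner_left)
qed

text \<open>The formal adjoint of \<open>shift a t\<close> for the form.\<close>

definition unshift :: "'a \<Rightarrow> 'g \<Rightarrow> 'a \<times> 'h \<Rightarrow> 'a \<times> 'h"
  where "unshift a t = shift (\<alpha> (- t) (star a)) (- t)"

lemma form_unshift: "form x (shift a t y) = form (unshift a t x) y"
  by (metis form_shift_adjoint form_commute unshift_def)

lemma sesq_shift_shift:
  "sesq xs (map (shift (\<alpha> (- t) (star a * b)) (- t + s)) ys) = sesq (map (shift a t) xs) (map (shift b s) ys)"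
  by (simp add: sesq_index form_shift)

lemma sesq_unshift: "sesq xs (map (shift a t) ys) = sesq (map (unshift a t) xs) ys"
  by (simp add: sesq_index form_unshift)

text \<open>Covariance makes the group part isometric, and left multiplication is controlled by
  \<open>left_mult_contraction\<close>.\<close>

lemma nrm_shift_le: "nrm (map (shift a t) xs) \<le> norm a * nrm xs"
proof -
  let ?n = "length xs"
  have "Re (sesq (map (shift a t) xs) (map (shift a t) xs)) =
     Re (\<Sum>i<?n. \<Sum>j<?n. cinner (u t (snd (xs ! i))) (\<phi> (star (a * \<alpha> t (fst (xs ! i))) * (a * \<alpha> t (fst (xs ! j)))) (u t (snd (xs ! j)))))"
    by (simp add: sesq_index form_def shift_def)
  also have "\<dots> \<le> (norm a)\<^sup>2 * Re (\<Sum>i<?n. \<Sum>j<?n. cinner (u t (snd (xs ! i))) (\<phi> (star (\<alpha> t (fst (xs ! i))) * \<alpha> t (fst (xs ! j))) (u t (snd (xs ! j)))))"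
    by (rule phi.left_mult_contraction)
  also have "\<dots> = (norm a)\<^sup>2 * Re (sesq xs xs)"
    by (simp add: sesq_index form_def covariant u.cinner_eq flip: alpha_simps)
  finally have "(nrm (map (shift a t) xs))\<^sup>2 \<le> (norm a * nrm xs)\<^sup>2"
    by (simp add: nrm_square power_mult_distrib)
  then show ?thesis by (rule power2_le_imp_le) (simp add: nrm_nonneg)
qed

lemma norm_sesq_shift_le: "cmod (sesq xs (map (shift a t) ys)) \<le> norm a * (nrm xs * nrm ys)"
  using order_trans[OF norm_sesq_le mult_left_mono[OF nrm_shift_le nrm_nonneg]] by (simp add: mult_ac)

lemma sesq_shift_linear: "sesq xs (map (shift (a + b) t) ys) = sesq xs (map (shift a t) ys) + sesq xs (map (shift b t) ys)"
  "sesq xs (map (shift (c *\<^sub>C a) t) ys) = c * sesq xs (map (shift a t) ys)"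
  by (simp_all add: sesq_index form_def shift_def distrib_right distrib_left phi.add cinner_add_right sum.distrib
      scaleC_mult_left scaleC_mult_right phi.scaleC cinner_scaleC_right sum_distrib_left)

lemma functional_sesq: "functional (\<lambda>a t. sesq xs (map (shift a t) ys))"
  unfolding functional_def
proof (intro conjI allI)
  fix t show "bounded_linear (\<lambda>a. sesq xs (map (shift a t) ys))"
    using norm_sesq_shift_le[of xs _ t ys]
    by (intro bounded_linear_intro[of _ "nrm xs * nrm ys"])
       (auto simp: sesq_shift_linear scaleR_scaleC scaleR_conv_of_real)
  show "continuous_on UNIV (\<lambda>p. sesq xs (map (shift (fst p) (snd p)) ys))"
    by (simp add: sesq_index form_def shift_def)
       (intro continuous_on_sum continuous_on_cinner continuous_phi continuous_on_mult continuous_alpha u.continuous_apply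
         continuous_on_fst continuous_on_snd continuous_on_id continuous_on_const)
qed

section \<open>The integrated form and its operator seminorm\<close>

text \<open>The matrix coefficient of the integrated form: an ordinary complex integral, meaningful
  although the vectors are only formal lists.\<close>

definition rep_form :: "('g \<Rightarrow> 'a) \<Rightarrow> ('a \<times> 'h) list \<Rightarrow> ('a \<times> 'h) list \<Rightarrow> complex"
  where "rep_form f xs ys = (\<integral>t. sesq xs (map (shift (f t) t) ys) \<partial>\<mu>)"

lemma functional_Cc:
  assumes b: "functional b" and f: "f \<in> Cc"
  shows "(\<lambda>t. b (f t) t) \<in> Cc"
  by (rule Cc_compose[OF f]) (auto intro!: functional_simps(4)[OF b] continuous_on_id CcD(1)[OF f] simp: functional_simps(2)[OF b])

lemmas sesq_Cc = functional_Cc[OF functional_sesq]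

lemma L1_norm_nonneg: "L1_norm \<mu> f \<ge> 0"
  by (simp add: L1_norm_def)

lemma norm_rep_form_le_L1:
  assumes f: "f \<in> Cc"
  shows "cmod (rep_form f xs ys) \<le> L1_norm \<mu> f * (nrm xs * nrm ys)"
proof -
  have "cmod (rep_form f xs ys) \<le> (\<integral>t. cmod (sesq xs (map (shift (f t) t) ys)) \<partial>\<mu>)"
    unfolding rep_form_def by (rule integral_norm_bound)
  also have "\<dots> \<le> (\<integral>t. norm (f t) * (nrm xs * nrm ys) \<partial>\<mu>)"
    by (intro integral_mono integrable_Cc Cc_norm sesq_Cc f integrable_mult_left norm_sesq_shift_le)
  also have "\<dots> = L1_norm \<mu> f * (nrm xs * nrm ys)" by (simp add: L1_norm_def)
  finally show ?thesis .
qed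

text \<open>The operator norm as the least constant bounding the sesquilinear form, which makes
  sense on a space with null vectors.\<close>

definition rep_norm :: "('g \<Rightarrow> 'a) \<Rightarrow> real"
  where "rep_norm f = Inf {C. C \<ge> 0 \<and> (\<forall>xs ys. cmod (rep_form f xs ys) \<le> C * (nrm xs * nrm ys))}"

lemma rep_norm_le:
  assumes "C \<ge> 0" "\<And>xs ys. cmod (rep_form f xs ys) \<le> C * (nrm xs * nrm ys)"
  shows "rep_norm f \<le> C"
  unfolding rep_norm_def by (rule cInf_lower) (use assms in \<open>auto intro!: bdd_belowI[of _ 0]\<close>)

lemma rep_norm:
  assumes f: "f \<in> Cc"
  shows "rep_norm f \<ge> 0" "cmod (rep_form f xs ys) \<le> rep_norm f * (nrm xs * nrm ys)"
proof -
  let ?A = "{C. C \<ge> 0 \<and> (\<forall>xs ys. cmod (rep_form f xs ys) \<le> C * (nrm xs * nrm ys))}"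
  have ne: "?A \<noteq> {}" using norm_rep_form_le_L1[OF f] L1_norm_nonneg[of f] by blast
  show "rep_norm f \<ge> 0" unfolding rep_norm_def by (rule cInf_greatest[OF ne]) simp
  show "cmod (rep_form f xs ys) \<le> rep_norm f * (nrm xs * nrm ys)"
  \<comment> \<open>No quotient can be formed for null vectors, but there the L1 bound already makes
    the coefficient vanish.\<close>
  proof (cases "nrm xs * nrm ys = 0")
    case True
    then show ?thesis using norm_rep_form_le_L1[OF f, of xs ys] by (simp only: True mult_zero_right)
  next
    case False
    then have pos: "nrm xs * nrm ys > 0" using nrm_nonneg[of xs] nrm_nonneg[of ys] by (simp add: less_le)
    have "cmod (rep_form f xs ys) / (nrm xs * nrm ys) \<le> rep_norm f"
      unfolding rep_norm_def using pos by (intro cInf_greatest[OF ne]) (auto simp: pos_divide_le_eq)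
    then show ?thesis using pos by (simp add: pos_divide_le_eq)
  qed
qed

lemma rep_norm_le_L1: "f \<in> Cc \<Longrightarrow> rep_norm f \<le> L1_norm \<mu> f"
  by (intro rep_norm_le norm_rep_form_le_L1 L1_norm_nonneg)

lemma rep_form_add: "f \<in> Cc \<Longrightarrow> g \<in> Cc \<Longrightarrow> rep_form (\<lambda>t. f t + g t) xs ys = rep_form f xs ys + rep_form g xs ys"
  unfolding rep_form_def sesq_shift_linear
  by (intro Bochner_Integration.integral_add integrable_Cc sesq_Cc)

lemma rep_form_scaleC: "rep_form (\<lambda>t. c *\<^sub>C f t) xs ys = c * rep_form f xs ys"
  unfolding rep_form_def sesq_shift_linear by simp

lemma rep_norm_add:
  assumes "f \<in> Cc" "g \<in> Cc"
  shows "rep_norm (\<lambda>t. f t + g t) \<le> rep_norm f + rep_norm g"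
proof (rule rep_norm_le)
  show "0 \<le> rep_norm f + rep_norm g" using rep_norm(1) assms by simp
  show "cmod (rep_form (\<lambda>t. f t + g t) xs ys) \<le> (rep_norm f + rep_norm g) * (nrm xs * nrm ys)" for xs ys
    using rep_norm(2)[OF assms(1), of xs ys] rep_norm(2)[OF assms(2), of xs ys]
      norm_triangle_ineq[of "rep_form f xs ys" "rep_form g xs ys"]
    by (simp add: rep_form_add[OF assms] distrib_right)
qed

lemma Cc_scaleC: "f \<in> Cc \<Longrightarrow> (\<lambda>t. c *\<^sub>C f t :: 'b::complex_normed_vector) \<in> (Cc :: ('g \<Rightarrow> 'b) set)"
  by (rule Cc_compose[of f "\<lambda>_ v. c *\<^sub>C v"]) (auto intro: continuous_on_scaleC continuous_on_const CcD(1))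

lemma rep_norm_scaleC:
  assumes f: "f \<in> Cc"
  shows "rep_norm (\<lambda>t. c *\<^sub>C f t) = cmod c * rep_norm f"
proof -
  have le: "rep_norm (\<lambda>t. c *\<^sub>C f t) \<le> cmod c * rep_norm f" if f: "f \<in> Cc" for c f
  proof (rule rep_norm_le)
    show "cmod (rep_form (\<lambda>t. c *\<^sub>C f t) xs ys) \<le> cmod c * rep_norm f * (nrm xs * nrm ys)" for xs ys
      using mult_left_mono[OF rep_norm(2)[OF f, of xs ys], of "cmod c"]
      by (simp add: rep_form_scaleC norm_mult mult.assoc)
  qed (simp add: rep_norm(1)[OF f])
  show ?thesis
  proof (cases "c = 0")
    case True
    then show ?thesis using le[OF f, of 0] rep_norm(1)[OF Cc_scaleC[OF f, of 0]] by simp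
  next
    case False
    have "rep_norm f = rep_norm (\<lambda>t. inverse c *\<^sub>C (c *\<^sub>C f t))" using False by (simp add: scaleC_scaleC)
    also have "\<dots> \<le> cmod (inverse c) * rep_norm (\<lambda>t. c *\<^sub>C f t)" by (rule le[OF Cc_scaleC[OF f]])
    finally have "cmod c * rep_norm f \<le> rep_norm (\<lambda>t. c *\<^sub>C f t)"
      using False by (simp add: norm_divide norm_inverse field_simps)
    then show ?thesis using le[OF f, of c] by simp
  qed
qed

lemma rep_form_involution: 
  assumes f: "f \<in> Cc"
  shows "rep_form (involution \<mu> \<alpha> f) xs ys = cnj (rep_form f ys xs)"
proof -
  have "rep_form (involution \<mu> \<alpha> f) xs ys = (\<integral>t. sesq xs (map (shift (\<alpha> (- t) (star (f t))) (- t)) ys) \<partial>\<mu>)"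
    unfolding rep_form_def by (rule functional_involution[OF f functional_sesq])
  also have "\<dots> = (\<integral>t. cnj (sesq ys (map (shift (f t) t) xs)) \<partial>\<mu>)"
    by (intro Bochner_Integration.integral_cong[OF refl])
       (simp add: sesq_unshift[of ys] unshift_def flip: sesq_commute)
  also have "\<dots> = cnj (rep_form f ys xs)" unfolding rep_form_def by (rule Bochner_Integration.integral_cnj)
  finally show ?thesis .
qed

lemma rep_norm_involution:
  assumes f: "f \<in> Cc"
  shows "rep_norm (involution \<mu> \<alpha> f) = rep_norm f"
proof -
  have "(\<forall>xs ys. cmod (rep_form (involution \<mu> \<alpha> f) xs ys) \<le> C * (nrm xs * nrm ys)) \<longleftrightarrow>
    (\<forall>xs ys. cmod (rep_form f xs ys) \<le> C * (nrm xs * nrm ys))" for C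
    by (simp add: rep_form_involution[OF f]) (metis mult.commute)
  then show ?thesis unfolding rep_norm_def by simp
qed

end

text \<open>Riemann sum estimates hold for every mesh parameter e > 0 with a bound continuous in e;
  this takes them to e = 0.\<close>

lemma le_at_zeroI:
  fixes h :: "real \<Rightarrow> real"
  assumes "isCont h 0" "\<And>e. e > 0 \<Longrightarrow> a \<le> h e"
  shows "a \<le> h 0"
proof (rule tendsto_lowerbound[of h "h 0" "at_right 0"])
  show "(h \<longlongrightarrow> h 0) (at_right 0)" using assms(1) by (simp add: isCont_def filterlim_at_split)
  show "\<forall>\<^sub>F e in at_right 0. a \<le> h e"
    using assms(2) by (simp add: eventually_at_right_less eventually_at_filter)
qed simp

context compact_finite_measure
begin

lemma sum_measure_fine_for:
  assumes P: "fine_for P \<tau> K" and K: "compact K"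
  shows "(\<Sum>E\<in>P. measure \<mu> E) = measure \<mu> K"
proof -
  have P': "finite P" "disjoint P" "\<Union>P = K" "\<And>E. E \<in> P \<Longrightarrow> E \<in> sets \<mu>"
    using P by (auto simp: fine_for_def sets_eq)
  have "measure \<mu> (\<Union>E\<in>P. E) = (\<Sum>E\<in>P. measure \<mu> E)"
  proof (rule measure_finite_Union)
    show "disjoint_family_on (\<lambda>E. E) P" using P'(2) by (auto simp: disjoint_def disjoint_family_on_def)
    show "emeasure \<mu> E \<noteq> \<infinity>" if "E \<in> P" for E
      using emeasure_mono[of E K \<mu>] P'(3) that finite_compact[OF K] compact_sets[OF K]
      by (metis Union_upper le_less_trans less_irrefl)
  qed (use P' in auto)
  then show ?thesis using P'(3) by simp
qed

end

context covariant_cp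
begin

lemma alpha_diff: "\<alpha> t (a - b) = \<alpha> t a - \<alpha> t b"
  using alpha_simps(1)[of t "a - b" b] by simp

abbreviation orbit :: "('g \<Rightarrow> 'a) \<Rightarrow> ('a \<times> 'h) list \<Rightarrow> 'g \<Rightarrow> ('a \<times> 'h) list"
  where "orbit f xs t \<equiv> map (shift (f t) t) xs"

lemma rep_form_involution_convolution:
  assumes "f \<in> Cc" "g \<in> Cc"
  shows "rep_form (convolution \<mu> \<alpha> (involution \<mu> \<alpha> f) g) xs ys = (\<integral>t. \<integral>s. sesq (orbit f xs t) (orbit g ys s) \<partial>\<mu> \<partial>\<mu>)"
  unfolding rep_form_def functional_involution_convolution[OF assms functional_sesq] sesq_shift_shift ..

lemma rep_form_convolution:
  assumes "f \<in> Cc" "g \<in> Cc"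
  shows "rep_form (convolution \<mu> \<alpha> f g) xs ys = (\<integral>t. \<integral>s. sesq (map (unshift (f t) t) xs) (orbit g ys s) \<partial>\<mu> \<partial>\<mu>)"
proof -
  have "map (shift (f t * \<alpha> t (g s)) (t + s)) ys = map (shift (f t) t) (orbit g ys s)" for s t
    by (simp add: shift_compose)
  then show ?thesis
    unfolding rep_form_def functional_convolution[OF assms functional_sesq] by (simp only: sesq_unshift)
qed

text \<open>Lists form no vector space, but concatenation and scaling of the Hilbert space entries
  represent any finite linear combination as far as the form can tell.\<close>

lemma combination_ex:
  fixes P :: "'g set set"
  assumes "finite P"
  shows "\<exists>\<eta>. \<forall>zs. sesq zs \<eta> = (\<Sum>E\<in>P. w E *\<^sub>R sesq zs (F E)) \<and> sesq \<eta> zs = (\<Sum>E\<in>P. w E *\<^sub>R sesq (F E) zs)"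
proof -
  obtain Ps where Ps: "set Ps = P" "distinct Ps" using finite_distinct_list[OF assms] by blast
  show ?thesis
    by (rule exI[of _ "concat (map (\<lambda>E. map (scale (complex_of_real (w E))) (F E)) Ps)"])
       (simp add: sesq_concat sesq_scale scaleR_conv_of_real sum_list_distinct_conv_sum_set[OF Ps(2)] Ps(1))
qed

lemma continuous_sesq_shift:
  assumes "continuous_on S a" "continuous_on S t" "continuous_on S b" "continuous_on S s"
  shows "continuous_on S (\<lambda>p. sesq (map (shift (a p) (t p)) xs) (map (shift (b p) (s p)) ys))"
  unfolding sesq_index form_def shift_def
  by (simp, intro continuous_on_sum continuous_on_cinner continuous_phi continuous_on_mult continuous_alpha u.continuous_apply
         continuous_on_star continuous_on_const assms)

lemma continuous_sesq_unshift:
  assumes "continuous_on S a" "continuous_on S t" "continuous_on S b" "continuous_on S s"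
  shows "continuous_on S (\<lambda>p. sesq (map (unshift (a p) (t p)) xs) (map (shift (b p) (s p)) ys))"
  unfolding unshift_def
  by (intro continuous_sesq_shift continuous_alpha continuous_on_star continuous_on_minus assms)

lemma sesq_shift_zero [simp]: "sesq xs (map (shift 0 t) ys) = 0" "sesq (map (shift 0 t) ys) xs = 0"
  by (simp_all add: sesq_index form_def shift_def phi.zero)

lemma unshift_zero: "unshift 0 t = shift 0 (- t)"
  by (simp add: unshift_def)

text \<open>This is Cauchy-Schwarz for xs and \<pi>(f) ys, whose squared norm is the coefficient of
  the involution of f convolved with f at ys. As \<pi>(f) ys exists only in the completion, a
  Riemann combination \<eta> of orbit vectors takes its place.\<close>

lemma norm_rep_form_square_le:
  assumes f: "f \<in> Cc"
  shows "cmod (rep_form f xs ys) \<le> nrm xs * sqrt (cmod (rep_form (convolution \<mu> \<alpha> (involution \<mu> \<alpha> f) f) ys ys))"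
    (is "_ \<le> _ * sqrt (cmod ?X)")
proof -
  obtain K where K: "compact K" "\<And>t. t \<notin> K \<Longrightarrow> f t = 0" using CcD(2)[OF f] by blast
  let ?m = "measure \<mu> K"
  let ?F1 = "\<lambda>p. sesq (orbit f ys (fst p)) (orbit f ys (snd p))"
  let ?F2 = "\<lambda>p :: 'g \<times> 'g. sesq xs (orbit f ys (snd p))"
  note cf = continuous_on_UNIV_compose[OF CcD(1)[OF f]]
  have F1: "continuous_on UNIV ?F1" by (intro continuous_sesq_shift cf continuous_on_pairs)
  have F2: "continuous_on UNIV ?F2"
    by (intro functional_simps(4)[OF functional_sesq] cf continuous_on_pairs)
  have X: "?X = (\<integral>t. \<integral>s. ?F1 (t, s) \<partial>\<mu> \<partial>\<mu>)"
    by (simp add: rep_form_involution_convolution[OF f f])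
  define h where "h e = e * ?m + nrm xs * sqrt (cmod ?X + e * ?m * ?m)" for e
  have "cmod (rep_form f xs ys) \<le> h 0"
  proof (rule le_at_zeroI)
    show "isCont h 0" unfolding h_def by (intro continuous_intros)
    fix e :: real assume e: "e > 0"
    \<comment> \<open>The same \<eta> has to approximate both integrals, so the two integrands are
      paired into one function before partitioning.\<close>
    obtain P \<tau> where P: "fine_for P \<tau> K"
      and c: "\<forall>E\<in>P. \<forall>E'\<in>P. \<forall>s\<in>E. \<forall>t\<in>E'. dist (?F1 (s, t), ?F2 (s, t)) (?F1 (\<tau> E, \<tau> E'), ?F2 (\<tau> E, \<tau> E')) < e"
      using fine_for_ex[OF continuous_on_Pair[OF F1 F2] K(1) e] by blast
    have c1: "norm (?F1 (s, t) - ?F1 (\<tau> E, \<tau> E')) \<le> e" and c2: "norm (?F2 (s, t) - ?F2 (\<tau> E, \<tau> E')) \<le> e"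
      if "E \<in> P" "E' \<in> P" "s \<in> E" "t \<in> E'" for E E' s t
      using c[rule_format, OF that] dist_fst_le[of "(?F1 (s, t), ?F2 (s, t))" "(?F1 (\<tau> E, \<tau> E'), ?F2 (\<tau> E, \<tau> E'))"]
        dist_snd_le[of "(?F1 (s, t), ?F2 (s, t))" "(?F1 (\<tau> E, \<tau> E'), ?F2 (\<tau> E, \<tau> E'))"]
      by (simp_all add: dist_norm)
    have fin: "finite P" using P by (simp add: fine_for_def)
    obtain \<eta> where \<eta>: "\<And>zs. sesq zs \<eta> = (\<Sum>E\<in>P. measure \<mu> E *\<^sub>R sesq zs (orbit f ys (\<tau> E)))"
      "\<And>zs. sesq \<eta> zs = (\<Sum>E\<in>P. measure \<mu> E *\<^sub>R sesq (orbit f ys (\<tau> E)) zs)"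
      using combination_ex[OF fin, of "measure \<mu>" "\<lambda>E. orbit f ys (\<tau> E)"] by blast
    have 1: "norm (rep_form f xs ys - sesq xs \<eta>) \<le> e * ?m"
      unfolding rep_form_def \<eta>(1)
    proof (rule riemann_sum[OF sesq_Cc[OF f] K(1) _ P])
      show "norm (sesq xs (orbit f ys t) - sesq xs (orbit f ys (\<tau> E))) \<le> e" if "E \<in> P" "t \<in> E" for E t
        using c2[OF that(1) that(1) that(2) that(2)] by simp
    qed (simp add: K(2))
    have "norm ((\<integral>t. \<integral>s. ?F1 (t, s) \<partial>\<mu> \<partial>\<mu>) - (\<Sum>E\<in>P. \<Sum>E'\<in>P. (measure \<mu> E * measure \<mu> E') *\<^sub>R ?F1 (\<tau> E, \<tau> E'))) \<le> e * ?m * ?m"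
      by (rule double_riemann_sum[OF F1 K(1) _ P c1]) (auto simp: K(2))
    moreover have "(\<Sum>E\<in>P. \<Sum>E'\<in>P. (measure \<mu> E * measure \<mu> E') *\<^sub>R ?F1 (\<tau> E, \<tau> E')) = sesq \<eta> \<eta>"
      unfolding \<eta>(2)[of \<eta>] unfolding \<eta>(1)[of "orbit f ys (\<tau> E)" for E] by (simp add: scaleR_sum_right)
    ultimately have 2: "norm (?X - sesq \<eta> \<eta>) \<le> e * ?m * ?m" unfolding X by simp
    have "(nrm \<eta>)\<^sup>2 = cmod (sesq \<eta> \<eta>)" unfolding sesq_self norm_of_real by simp
    also have "\<dots> \<le> cmod ?X + e * ?m * ?m"
      using 2 norm_triangle_ineq2[of "sesq \<eta> \<eta>" ?X] by (simp add: norm_minus_commute)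
    finally have "nrm \<eta> \<le> sqrt (cmod ?X + e * ?m * ?m)" by (rule real_le_rsqrt)
    then have "cmod (sesq xs \<eta>) \<le> nrm xs * sqrt (cmod ?X + e * ?m * ?m)"
      using norm_sesq_le[of xs \<eta>] mult_left_mono[OF _ nrm_nonneg[of xs]] order_trans by blast
    then show "cmod (rep_form f xs ys) \<le> h e"
      unfolding h_def using 1 norm_triangle_ineq2[of "rep_form f xs ys" "sesq xs \<eta>"] by linarith
  qed
  then show ?thesis by (simp add: h_def)
qed

text \<open>Here \<eta> imitates \<pi>(g) ys. Its norm is found by self-improvement: the square is
  nearly the coefficient of g at \<eta> and ys, hence at most
  \<open>rep_norm g * nrm ys * nrm \<eta>\<close> plus an error, and one factor can be divided
  out.\<close>

lemma norm_rep_form_convolution_le: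
  assumes f: "f \<in> Cc" and g: "g \<in> Cc"
  shows "cmod (rep_form (convolution \<mu> \<alpha> f g) xs ys) \<le> rep_norm f * rep_norm g * (nrm xs * nrm ys)"
proof -
  obtain K0 where K0: "compact K0" "\<And>t. t \<notin> K0 \<Longrightarrow> f t = 0" using CcD(2)[OF f] by blast
  obtain L where L: "compact L" "\<And>t. t \<notin> L \<Longrightarrow> g t = 0" using CcD(2)[OF g] by blast
  define K where "K = K0 \<union> L"
  have K: "compact K" "\<And>t. t \<notin> K \<Longrightarrow> f t = 0" "\<And>t. t \<notin> K \<Longrightarrow> g t = 0"
    using K0 L by (auto simp: K_def)
  let ?m = "measure \<mu> K"
  let ?F1 = "\<lambda>p. sesq (map (unshift (f (fst p)) (fst p)) xs) (orbit g ys (snd p))"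
  let ?F2 = "\<lambda>p. sesq (orbit g ys (fst p)) (orbit g ys (snd p))"
  note cf = continuous_on_UNIV_compose[OF CcD(1)[OF f]] and cg = continuous_on_UNIV_compose[OF CcD(1)[OF g]]
  have F1: "continuous_on UNIV ?F1" by (intro continuous_sesq_unshift cf cg continuous_on_pairs)
  have F2: "continuous_on UNIV ?F2" by (intro continuous_sesq_shift cg continuous_on_pairs)
  have z1: "?F1 (s, t) = 0" if "s \<notin> K \<or> t \<notin> K" for s t using that by (auto simp: K(2,3) unshift_zero)
  let ?X = "\<integral>t. \<integral>s. ?F1 (t, s) \<partial>\<mu> \<partial>\<mu>"
  define h where "h e = 2 * e * ?m * ?m + rep_norm f * (nrm xs * (rep_norm g * nrm ys + sqrt (e * ?m * ?m)))" for e
  have "cmod ?X \<le> h 0"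
  proof (rule le_at_zeroI)
    show "isCont h 0" unfolding h_def by (intro continuous_intros)
    fix e :: real assume e: "e > 0"
    obtain P \<tau> where P: "fine_for P \<tau> K"
      and c: "\<forall>E\<in>P. \<forall>E'\<in>P. \<forall>s\<in>E. \<forall>t\<in>E'. dist (?F1 (s, t), ?F2 (s, t)) (?F1 (\<tau> E, \<tau> E'), ?F2 (\<tau> E, \<tau> E')) < e"
      using fine_for_ex[OF continuous_on_Pair[OF F1 F2] K(1) e] by blast
    have c1: "norm (?F1 (s, t) - ?F1 (\<tau> E, \<tau> E')) \<le> e" and c2: "norm (?F2 (s, t) - ?F2 (\<tau> E, \<tau> E')) \<le> e"
      if "E \<in> P" "E' \<in> P" "s \<in> E" "t \<in> E'" for E E' s t
      using c[rule_format, OF that] dist_fst_le[of "(?F1 (s, t), ?F2 (s, t))" "(?F1 (\<tau> E, \<tau> E'), ?F2 (\<tau> E, \<tau> E'))"]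
        dist_snd_le[of "(?F1 (s, t), ?F2 (s, t))" "(?F1 (\<tau> E, \<tau> E'), ?F2 (\<tau> E, \<tau> E'))"]
      by (simp_all add: dist_norm)
    have fin: "finite P" and \<tau>: "\<And>E. E \<in> P \<Longrightarrow> \<tau> E \<in> E" and UP: "\<Union>P = K" using P by (auto simp: fine_for_def)
    obtain \<eta> where \<eta>: "\<And>zs. sesq zs \<eta> = (\<Sum>E\<in>P. measure \<mu> E *\<^sub>R sesq zs (orbit g ys (\<tau> E)))"
      "\<And>zs. sesq \<eta> zs = (\<Sum>E\<in>P. measure \<mu> E *\<^sub>R sesq (orbit g ys (\<tau> E)) zs)"
      using combination_ex[OF fin, of "measure \<mu>" "\<lambda>E. orbit g ys (\<tau> E)"] by blast
    \<comment> \<open>The first variable stays at t, which is not a tag. Both values of the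
      integrand are compared with the tag of the cell of t, hence 2 e.\<close>
    have inner: "norm ((\<integral>s. ?F1 (t, s) \<partial>\<mu>) - sesq xs (orbit f \<eta> t)) \<le> 2 * e * ?m" for t
      unfolding sesq_unshift[of xs "f t" t \<eta>] \<eta>(1)
    proof (rule riemann_sum[OF Cc_slice(1)[OF F1 K(1) z1] K(1) _ P])
      fix E s assume E: "E \<in> P" "s \<in> E"
      show "norm (?F1 (t, s) - sesq (map (unshift (f t) t) xs) (orbit g ys (\<tau> E))) \<le> 2 * e"
      proof (cases "t \<in> K")
        case True
        then obtain E0 where E0: "E0 \<in> P" "t \<in> E0" using UP by blast
        show ?thesis
          using c1[OF E0(1) E(1) E0(2) E(2)] c1[OF E0(1) E(1) E0(2) \<tau>[OF E(1)]]
            norm_triangle_ineq4[of "?F1 (t, s) - ?F1 (\<tau> E0, \<tau> E)" "?F1 (t, \<tau> E) - ?F1 (\<tau> E0, \<tau> E)"] by simp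
      qed (use e in \<open>simp add: K(2) unshift_zero\<close>)
    qed (use z1 in auto)
    have outer: "norm (?X - rep_form f xs \<eta>) \<le> 2 * e * ?m * ?m"
    proof -
      have A: "(\<lambda>t. \<integral>s. ?F1 (t, s) \<partial>\<mu>) \<in> Cc" by (rule Cc_integral[OF F1 K(1) z1])
      have B: "(\<lambda>t. sesq xs (orbit f \<eta> t)) \<in> Cc" by (rule sesq_Cc[OF f])
      define a where "a t = (\<integral>s. ?F1 (t, s) \<partial>\<mu>)" for t
      define b where "b t = sesq xs (orbit f \<eta> t)" for t
      have ab: "a \<in> Cc" "b \<in> Cc" using A B unfolding a_def b_def .
      have z: "a t - b t = 0" if "t \<notin> K" for t using that by (simp add: a_def b_def K(2) unshift_zero)
      have "?X - rep_form f xs \<eta> = (\<integral>t. a t \<partial>\<mu>) - (\<integral>t. b t \<partial>\<mu>)"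
        by (simp add: a_def b_def rep_form_def)
      also have "\<dots> = (\<integral>t. a t - b t \<partial>\<mu>)"
        by (rule Bochner_Integration.integral_diff[symmetric]) (intro integrable_Cc ab)+
      also have "norm \<dots> \<le> (\<integral>t. norm (a t - b t) \<partial>\<mu>)" by (rule integral_norm_bound)
      also have "\<dots> \<le> 2 * e * ?m * ?m"
        by (rule integral_norm_le_const[OF Cc_diff[OF ab] K(1) z]) (use inner in \<open>simp_all add: a_def b_def\<close>)
      finally show ?thesis .
    qed
    have "norm (rep_form g \<eta> ys - sesq \<eta> \<eta>) \<le> e * ?m * ?m"
      unfolding rep_form_def \<eta>(1)[of \<eta>]
    proof (rule riemann_sum[OF sesq_Cc[OF g] K(1) _ P])
      fix E s assume E: "E \<in> P" "s \<in> E"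
      have "sesq \<eta> (orbit g ys s) - sesq \<eta> (orbit g ys (\<tau> E)) =
          (\<Sum>E'\<in>P. measure \<mu> E' *\<^sub>R (?F2 (\<tau> E', s) - ?F2 (\<tau> E', \<tau> E)))"
        unfolding \<eta>(2) by (simp add: scaleR_diff_right sum_subtractf)
      also have "norm \<dots> \<le> (\<Sum>E'\<in>P. measure \<mu> E' * e)"
        using c2[OF _ E(1) \<tau> E(2)] by (intro sum_norm_le) (simp add: mult_left_mono)
      also have "\<dots> = e * ?m"
        unfolding sum_distrib_right[symmetric] sum_measure_fine_for[OF P K(1)] by (rule mult.commute)
      finally show "norm (sesq \<eta> (orbit g ys s) - sesq \<eta> (orbit g ys (\<tau> E))) \<le> e * ?m" .
    qed (simp add: K(3))
    then have "cmod (sesq \<eta> \<eta>) \<le> cmod (rep_form g \<eta> ys) + e * ?m * ?m"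
      using norm_triangle_ineq2[of "sesq \<eta> \<eta>" "rep_form g \<eta> ys"] by (simp add: norm_minus_commute)
    also have "cmod (sesq \<eta> \<eta>) = (nrm \<eta>)\<^sup>2" unfolding sesq_self norm_of_real by simp
    finally have "(nrm \<eta>)\<^sup>2 \<le> (rep_norm g * nrm ys) * nrm \<eta> + e * ?m * ?m"
      using rep_norm(2)[OF g, of \<eta> ys] by (simp add: mult_ac)
    then have "nrm \<eta> \<le> rep_norm g * nrm ys + sqrt (e * ?m * ?m)"
      by (rule le_add_sqrt_if_square_le) (use nrm_nonneg rep_norm(1)[OF g] e in auto)
    then have "rep_norm f * (nrm xs * nrm \<eta>) \<le> rep_norm f * (nrm xs * (rep_norm g * nrm ys + sqrt (e * ?m * ?m)))"
      by (intro mult_left_mono nrm_nonneg rep_norm(1)[OF f])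
    then show "cmod ?X \<le> h e"
      unfolding h_def using outer rep_norm(2)[OF f, of xs \<eta>] norm_triangle_ineq2[of ?X "rep_form f xs \<eta>"] by linarith
  qed
  then show ?thesis by (simp add: h_def rep_form_convolution[OF f g] mult_ac)
qed

lemma rep_norm_convolution:
  assumes "f \<in> Cc" "g \<in> Cc"
  shows "rep_norm (convolution \<mu> \<alpha> f g) \<le> rep_norm f * rep_norm g"
  using assms by (intro rep_norm_le norm_rep_form_convolution_le mult_nonneg_nonneg rep_norm(1))

text \<open>Submultiplicativity and invariance under the involution give one inequality; the other
  is \<open>norm_rep_form_square_le\<close>.\<close>

lemma rep_norm_cstar:
  assumes f: "f \<in> Cc"
  shows "rep_norm (convolution \<mu> \<alpha> (involution \<mu> \<alpha> f) f) = (rep_norm f)\<^sup>2" (is "rep_norm ?g = _")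
proof (rule antisym)
  show "rep_norm ?g \<le> (rep_norm f)\<^sup>2"
    using rep_norm_convolution[OF involution_Cc[OF f] f] by (simp add: rep_norm_involution[OF f] power2_eq_square)
  have g: "?g \<in> Cc" by (intro convolution_Cc involution_Cc f)
  have "rep_norm f \<le> sqrt (rep_norm ?g)"
  proof (rule rep_norm_le)
    fix xs ys
    have "cmod (rep_form f xs ys) \<le> nrm xs * sqrt (cmod (rep_form ?g ys ys))" by (rule norm_rep_form_square_le[OF f])
    also have "\<dots> \<le> nrm xs * sqrt (rep_norm ?g * (nrm ys * nrm ys))"
      by (intro mult_left_mono real_sqrt_le_mono rep_norm(2)[OF g] nrm_nonneg)
    also have "\<dots> = sqrt (rep_norm ?g) * (nrm xs * nrm ys)"
      using nrm_nonneg[of ys] by (simp add: real_sqrt_mult)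
    finally show "cmod (rep_form f xs ys) \<le> sqrt (rep_norm ?g) * (nrm xs * nrm ys)" .
  qed (simp add: rep_norm(1)[OF g])
  then have "(rep_norm f)\<^sup>2 \<le> (sqrt (rep_norm ?g))\<^sup>2" by (rule power_mono) (rule rep_norm(1)[OF f])
  then show "(rep_norm f)\<^sup>2 \<le> rep_norm ?g" by (simp add: rep_norm(1)[OF g])
qed

lemma cstar_seminorm_rep_norm: "cstar_seminorm \<mu> \<alpha> rep_norm"
  unfolding cstar_seminorm_def
  by (auto simp: rep_norm(1) rep_norm_add rep_norm_scaleC rep_norm_convolution rep_norm_involution rep_norm_cstar)

text \<open>\<open>rep_norm\<close> is a member of the family, hence below the supremum; it also
  witnesses that the family is not empty, so the common L1 bound passes to the supremum.\<close>

lemma universal_norm_bounds: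
  assumes f: "f \<in> Cc"
  shows "rep_norm f \<le> universal_norm \<mu> \<alpha> f" "universal_norm \<mu> \<alpha> f \<le> L1_norm \<mu> f"
proof -
  let ?A = "{p. cstar_seminorm \<mu> \<alpha> p \<and> (\<forall>g\<in>Cc. p g \<le> L1_norm \<mu> g)}"
  have mem: "rep_norm \<in> ?A" using cstar_seminorm_rep_norm rep_norm_le_L1 by blast
  show "rep_norm f \<le> universal_norm \<mu> \<alpha> f"
    unfolding universal_norm_def
    by (rule cSUP_upper[OF mem]) (use f in \<open>auto intro!: bdd_aboveI[of _ "L1_norm \<mu> f"]\<close>)
  show "universal_norm \<mu> \<alpha> f \<le> L1_norm \<mu> f"
    unfolding universal_norm_def by (rule cSUP_least) (use f mem in auto)
qed

section \<open>The completely positive map on the crossed product\<close>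

definition phihat :: "('g \<Rightarrow> 'a) \<Rightarrow> 'h \<Rightarrow> 'h"
  where "phihat f h = vector_integral \<mu> (\<lambda>t. \<phi> (f t) (u t h))"

lemma functional_phi: "functional (\<lambda>a t. cinner k (\<phi> a (u t h)))"
  unfolding functional_def
proof (intro conjI allI)
  show "bounded_linear (\<lambda>a. cinner k (\<phi> a (u t h)))" for t
    by (rule bounded_linear_compose[OF bounded_linear_cinner_right bounded_bilinear.bounded_linear_left[OF phi.bounded_bilinear]])
  show "continuous_on UNIV (\<lambda>p. cinner k (\<phi> (fst p) (u (snd p) h)))"
    by (intro continuous_on_cinner continuous_phi u.continuous_apply continuous_on_fst continuous_on_snd continuous_on_id continuous_on_const)
qed

lemma phihat_Cc: "f \<in> Cc \<Longrightarrow> (\<lambda>t. \<phi> (f t) (u t h)) \<in> Cc"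
  by (rule Cc_compose[of f "\<lambda>t v. \<phi> v (u t h)"])
     (simp_all add: continuous_phi u.continuous_apply continuous_on_id continuous_on_const CcD(1) phi.zero)

lemma cinner_phihat: "f \<in> Cc \<Longrightarrow> cinner k (phihat f h) = (\<integral>t. cinner k (\<phi> (f t) (u t h)) \<partial>\<mu>)"
  unfolding phihat_def by (rule linear_vector_integral[OF bounded_linear_cinner_right phihat_Cc])

text \<open>An approximate unit is only known to have norm at most 2, whose square is the 4.\<close>

lemma nrm_single_le:
  assumes M: "M \<ge> 0" "\<And>a h. norm (\<phi> a h) \<le> M * norm a * norm h" and "norm e \<le> 2"
  shows "nrm [(e, h)] \<le> sqrt (4 * M) * norm h"
proof -
  have "(nrm [(e, h)])\<^sup>2 = Re (cinner h (\<phi> (star e * e) h))" by (simp add: nrm_square sesq_def form_def)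
  also have "\<dots> \<le> norm h * norm (\<phi> (star e * e) h)" by (rule Re_cinner_le)
  also have "\<dots> \<le> norm h * (M * norm (star e * e) * norm h)" by (intro mult_left_mono M(2)) simp
  also have "\<dots> = M * (norm e)\<^sup>2 * (norm h)\<^sup>2" by (simp add: cstar_identity power2_eq_square)
  also have "\<dots> \<le> M * 2\<^sup>2 * (norm h)\<^sup>2" using M(1) assms(3) by (intro mult_right_mono mult_left_mono power_mono) auto
  finally have "(nrm [(e, h)])\<^sup>2 \<le> (sqrt (4 * M) * norm h)\<^sup>2" using M(1) by (simp add: power_mult_distrib)
  then show ?thesis by (rule power2_le_imp_le) (use M(1) in simp)
qed

text \<open>Compressing by approximate units \<open>e\<close> and \<open>d\<close> on both sides replaces the missing vectors \<open>1 \<otimes> h\<close>.\<close>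

lemma norm_cinner_phihat_le:
  assumes M: "M \<ge> 0" "\<And>a h. norm (\<phi> a h) \<le> M * norm a * norm h" and f: "f \<in> Cc"
  shows "cmod (cinner k (phihat f h)) \<le> 4 * M * rep_norm f * norm k * norm h"
proof -
  obtain K where K: "compact K" "\<And>t. t \<notin> K \<Longrightarrow> f t = 0" using CcD(2)[OF f] by blast
  let ?m = "measure \<mu> K"
  define C where "C e = 2 * (M * e * norm k * norm h) * ?m + 4 * M * rep_norm f * norm k * norm h" for e
  have "cmod (cinner k (phihat f h)) \<le> C 0"
  proof (rule le_at_zeroI)
    show "isCont C 0" unfolding C_def by (intro continuous_intros)
    fix \<epsilon> :: real assume \<epsilon>: "\<epsilon> > 0"
    have "compact (f ` K)" using CcD(1)[OF f] K(1) compact_continuous_image continuous_on_subset by blast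
    then obtain e where e: "\<And>b. norm (b - e * b) \<le> norm b" "\<And>y. y \<in> f ` K \<Longrightarrow> norm (y - e * y) \<le> \<epsilon>"
      using approximate_unit_compact[OF _ \<epsilon>] by metis
    \<comment> \<open>d has to act on f(t) from the right through \<alpha>_t. Undoing \<alpha>_t and
      taking adjoints makes this an approximation from the left, on a compact set that depends on e;
      hence d is chosen after e.\<close>
    have "continuous_on K (\<lambda>t. star (\<alpha> (- t) (e * f t)))"
      by (intro continuous_on_star continuous_alpha continuous_on_mult continuous_on_minus continuous_on_id continuous_on_const
          continuous_on_subset[OF CcD(1)[OF f]]) simp
    then have "compact ((\<lambda>t. star (\<alpha> (- t) (e * f t))) ` K)" using K(1) compact_continuous_image by blast
    then obtain d where d: "\<And>b. norm (b - d * b) \<le> norm b"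
      "\<And>y. y \<in> (\<lambda>t. star (\<alpha> (- t) (e * f t))) ` K \<Longrightarrow> norm (y - d * y) \<le> \<epsilon>"
      using approximate_unit_compact[OF _ \<epsilon>] by metis
    have d': "norm (\<alpha> (- t) (e * f t) - \<alpha> (- t) (e * f t) * star d) \<le> \<epsilon>" if "t \<in> K" for t
    proof -
      have "\<alpha> (- t) (e * f t) - \<alpha> (- t) (e * f t) * star d = star (star (\<alpha> (- t) (e * f t)) - d * star (\<alpha> (- t) (e * f t)))"
        by (simp add: star_diff star_mult star_star)
      then show ?thesis using d(2)[of "star (\<alpha> (- t) (e * f t))"] that by simp
    qed
    let ?x = "[(star e, k)]" and ?y = "[(star d, h)]"
    have integrand: "sesq ?x (orbit f ?y t) = cinner k (\<phi> (e * (f t * \<alpha> t (star d))) (u t h))" for t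
      by (simp add: sesq_def form_def shift_def star_star)
    \<comment> \<open>One error comes from inserting e on the left, one from inserting d on the
      right; covariance brings the second to the set for which d was chosen.\<close>
    have close: "norm (cinner k (\<phi> (f t) (u t h)) - sesq ?x (orbit f ?y t)) \<le> 2 * (M * \<epsilon> * norm k * norm h)" if t: "t \<in> K" for t
    proof -
      have "cmod (cinner k (\<phi> (f t - e * f t) (u t h))) \<le> norm k * (M * norm (f t - e * f t) * norm h)"
        using order_trans[OF norm_cinner_le mult_left_mono[OF M(2)]] by (metis norm_ge_zero u.norm_eq)
      also have "\<dots> \<le> norm k * (M * \<epsilon> * norm h)"
        using e(2)[of "f t"] t M(1) by (intro mult_left_mono mult_right_mono) auto
      finally have 1: "cmod (cinner k (\<phi> (f t - e * f t) (u t h))) \<le> M * \<epsilon> * norm k * norm h" by (simp add: mult_ac)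
      let ?b = "\<alpha> (- t) (e * f t)"
      have "e * f t - e * (f t * \<alpha> t (star d)) = \<alpha> t (?b - ?b * star d)"
        by (simp add: alpha_diff alpha_simps(3)[of t ?b] mult.assoc)
      then have "cinner k (\<phi> (e * f t - e * (f t * \<alpha> t (star d))) (u t h)) = cinner (u (- t) k) (\<phi> (?b - ?b * star d) h)"
        by (simp add: covariant u.cinner_left)
      also have "cmod \<dots> \<le> norm k * (M * norm (?b - ?b * star d) * norm h)"
        using order_trans[OF norm_cinner_le mult_left_mono[OF M(2)]] by (metis norm_ge_zero u.norm_eq)
      also have "\<dots> \<le> norm k * (M * \<epsilon> * norm h)"
        using d'[OF t] M(1) by (intro mult_left_mono mult_right_mono) auto
      finally have 2: "cmod (cinner k (\<phi> (e * f t - e * (f t * \<alpha> t (star d))) (u t h))) \<le> M * \<epsilon> * norm k * norm h" by (simp add: mult_ac)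
      have "cinner k (\<phi> (f t) (u t h)) - sesq ?x (orbit f ?y t) =
         cinner k (\<phi> (f t - e * f t) (u t h)) + cinner k (\<phi> (e * f t - e * (f t * \<alpha> t (star d))) (u t h))"
        unfolding integrand by (simp add: phi.diff cinner_diff_right)
      then show ?thesis using 1 2 norm_triangle_ineq[of "cinner k (\<phi> (f t - e * f t) (u t h))"] by (smt (verit))
    qed
    have A: "(\<lambda>t. cinner k (\<phi> (f t) (u t h))) \<in> Cc" by (rule functional_Cc[OF functional_phi f])
    have B: "(\<lambda>t. sesq ?x (orbit f ?y t)) \<in> Cc" by (rule sesq_Cc[OF f])
    have "cinner k (phihat f h) - rep_form f ?x ?y = (\<integral>t. cinner k (\<phi> (f t) (u t h)) - sesq ?x (orbit f ?y t) \<partial>\<mu>)"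
      unfolding rep_form_def cinner_phihat[OF f]
      by (rule Bochner_Integration.integral_diff[OF integrable_Cc[OF A] integrable_Cc[OF B], symmetric])
    also have "norm \<dots> \<le> (\<integral>t. norm (cinner k (\<phi> (f t) (u t h)) - sesq ?x (orbit f ?y t)) \<partial>\<mu>)" by (rule integral_norm_bound)
    also have "\<dots> \<le> 2 * (M * \<epsilon> * norm k * norm h) * ?m"
      by (rule integral_norm_le_const[OF Cc_diff[OF A B] K(1) _ close])
         (use sesq_shift_zero(1)[of ?x _ ?y] in \<open>simp_all add: K(2) phi.zero\<close>)
    finally have 1: "cmod (cinner k (phihat f h) - rep_form f ?x ?y) \<le> 2 * (M * \<epsilon> * norm k * norm h) * ?m" .
    have "norm e \<le> 2" "norm d \<le> 2" using norm_le_2_if_contraction e(1) d(1) by blast+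
    then have "nrm ?x \<le> sqrt (4 * M) * norm k" "nrm ?y \<le> sqrt (4 * M) * norm h"
      by (intro nrm_single_le[OF M]; simp)+
    then have "nrm ?x * nrm ?y \<le> (sqrt (4 * M) * norm k) * (sqrt (4 * M) * norm h)"
      using M(1) nrm_nonneg by (intro mult_mono) auto
    also have "\<dots> = (sqrt (4 * M) * sqrt (4 * M)) * norm k * norm h" by (simp only: mult_ac)
    also have "sqrt (4 * M) * sqrt (4 * M) = 4 * M" using M(1) by (intro real_sqrt_mult_self[THEN trans]) simp
    finally have "rep_norm f * (nrm ?x * nrm ?y) \<le> rep_norm f * (4 * M * norm k * norm h)"
      by (rule mult_left_mono) (rule rep_norm(1)[OF f])
    then show "cmod (cinner k (phihat f h)) \<le> C \<epsilon>"
      unfolding C_def using 1 rep_norm(2)[OF f, of ?x ?y] norm_triangle_ineq2[of "cinner k (phihat f h)" "rep_form f ?x ?y"]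
      by (simp add: mult_ac)
  qed
  then show ?thesis by (simp add: C_def)
qed

lemma phihat_bounded_ex:
  "\<exists>B\<ge>0. \<forall>f\<in>Cc. \<forall>h. norm (phihat f h) \<le> B * universal_norm \<mu> \<alpha> f * norm h"
proof -
  obtain M where M: "M \<ge> 0" "\<And>a h. norm (\<phi> a h) \<le> M * norm a * norm h" using phi.bounded_ex by blast
  have "norm (phihat f h) \<le> 4 * M * universal_norm \<mu> \<alpha> f * norm h" if f: "f \<in> Cc" for f h
  proof (rule norm_le_if_cinner_le)
    have u0: "universal_norm \<mu> \<alpha> f \<ge> 0" using universal_norm_bounds(1)[OF f] rep_norm(1)[OF f] by linarith
    show "4 * M * universal_norm \<mu> \<alpha> f * norm h \<ge> 0" using M(1) u0 by simp
    fix k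
    have "cmod (cinner k (phihat f h)) \<le> 4 * M * rep_norm f * norm k * norm h" by (rule norm_cinner_phihat_le[OF M f])
    also have "\<dots> \<le> 4 * M * universal_norm \<mu> \<alpha> f * norm k * norm h"
      using M(1) universal_norm_bounds(1)[OF f] by (intro mult_right_mono mult_left_mono) auto
    finally show "cmod (cinner k (phihat f h)) \<le> 4 * M * universal_norm \<mu> \<alpha> f * norm h * norm k" by (simp add: mult_ac)
  qed
  then show ?thesis using M(1) by (intro exI[of _ "4 * M"]) auto
qed

lemma positive_finite:
  assumes "finite I"
  shows "(\<Sum>i\<in>I. \<Sum>j\<in>I. cinner (h i) (\<phi> (star (b i) * b j) (h j))) \<in> \<real>\<^sub>\<ge>\<^sub>0"
proof -
  obtain \<pi> where \<pi>: "bij_betw \<pi> {..<card I} I"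
    using ex_bij_betw_nat_finite[OF assms] by (auto simp: atLeast0LessThan)
  have "(\<Sum>i\<in>I. \<Sum>j\<in>I. cinner (h i) (\<phi> (star (b i) * b j) (h j))) =
    (\<Sum>i<card I. \<Sum>j<card I. cinner (h (\<pi> i)) (\<phi> (star (b (\<pi> i)) * b (\<pi> j)) (h (\<pi> j))))"
    by (simp add: sum.reindex_bij_betw[OF \<pi>, symmetric])
  then show ?thesis using phi.positive_row by simp
qed

text \<open>Each term is a double integral over t and s of the coefficient of \<phi>(star (f i t) *
  f j s) between u_t h_i and u_s h_j. A Riemann sum of the whole is therefore a row form of \<phi>,
  indexed by pairs of a cell and a number below n.\<close>

lemma phihat_positive:
  fixes n :: nat
  assumes f: "\<And>i. i < n \<Longrightarrow> f i \<in> Cc"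
  shows "(\<Sum>i<n. \<Sum>j<n. cinner (h i) (phihat (convolution \<mu> \<alpha> (involution \<mu> \<alpha> (f i)) (f j)) (h j))) \<in> \<real>\<^sub>\<ge>\<^sub>0"
proof -
  have "\<exists>K. \<forall>i\<in>{..<n}. compact (K i) \<and> (\<forall>t. t \<notin> K i \<longrightarrow> f i t = 0)"
    using CcD(2)[OF f] by (intro bchoice) auto
  then obtain K where K: "\<And>i. i < n \<Longrightarrow> compact (K i)" "\<And>i t. i < n \<Longrightarrow> t \<notin> K i \<Longrightarrow> f i t = 0" by blast
  let ?K = "\<Union>i<n. K i"
  have cK: "compact ?K" using K(1) by (intro compact_UN) auto
  have z: "f i t = 0" if "i < n" "t \<notin> ?K" for i t using K(2) that by blast
  define F where "F i j p = cinner (u (fst p) (h i)) (\<phi> (star (f i (fst p)) * f j (snd p)) (u (snd p) (h j)))" for i j p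
  have Fc: "continuous_on UNIV (F i j)" if "i < n" "j < n" for i j
    unfolding F_def
    by (intro continuous_on_cinner continuous_phi u.continuous_apply continuous_on_mult continuous_on_star
        continuous_on_UNIV_compose[OF CcD(1)[OF f[OF that(1)]]] continuous_on_UNIV_compose[OF CcD(1)[OF f[OF that(2)]]]
        continuous_on_pairs)
  have Fz: "F i j (s, t) = 0" if "i < n" "j < n" "s \<notin> ?K \<or> t \<notin> ?K" for i j s t
    using that(3) z[OF that(1)] z[OF that(2)] by (auto simp: F_def phi.zero)
  have eq: "cinner (h i) (phihat (convolution \<mu> \<alpha> (involution \<mu> \<alpha> (f i)) (f j)) (h j)) = (\<integral>t. \<integral>s. F i j (t, s) \<partial>\<mu> \<partial>\<mu>)"
    if ij: "i < n" "j < n" for i j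
  proof -
    have "cinner (h i) (\<phi> (\<alpha> (- t) (star (f i t) * f j s)) (u (- t + s) (h j))) = F i j (t, s)" for t s
      by (simp add: F_def u.plus covariant u.cinner_left)
    then show ?thesis
      using f ij by (simp add: cinner_phihat convolution_Cc involution_Cc functional_involution_convolution[OF _ _ functional_phi])
  qed
  let ?F = "\<lambda>p. \<Sum>i<n. \<Sum>j<n. F i j p"
  have "(\<Sum>i<n. \<Sum>j<n. cinner (h i) (phihat (convolution \<mu> \<alpha> (involution \<mu> \<alpha> (f i)) (f j)) (h j))) =
     (\<Sum>i<n. \<Sum>j<n. (\<integral>t. \<integral>s. F i j (t, s) \<partial>\<mu> \<partial>\<mu>))"
    by (intro sum.cong refl eq) auto
  also have "\<dots> = (\<integral>t. (\<Sum>i<n. \<Sum>j<n. (\<integral>s. F i j (t, s) \<partial>\<mu>)) \<partial>\<mu>)"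
  proof -
    have int: "integrable \<mu> (\<lambda>t. \<integral>s. F i j (t, s) \<partial>\<mu>)" if "i < n" "j < n" for i j
      by (rule integrable_Cc[OF Cc_integral[OF Fc[OF that] cK Fz[OF that]]])
    have "(\<integral>t. (\<Sum>i<n. \<Sum>j<n. (\<integral>s. F i j (t, s) \<partial>\<mu>)) \<partial>\<mu>) = (\<Sum>i<n. (\<integral>t. (\<Sum>j<n. (\<integral>s. F i j (t, s) \<partial>\<mu>)) \<partial>\<mu>))"
      by (intro Bochner_Integration.integral_sum Bochner_Integration.integrable_sum int) auto
    also have "\<dots> = (\<Sum>i<n. \<Sum>j<n. (\<integral>t. \<integral>s. F i j (t, s) \<partial>\<mu> \<partial>\<mu>))"
      by (intro sum.cong refl Bochner_Integration.integral_sum int) auto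
    finally show ?thesis by simp
  qed
  also have "\<dots> = (\<integral>t. \<integral>s. ?F (t, s) \<partial>\<mu> \<partial>\<mu>)"
  proof (rule Bochner_Integration.integral_cong[OF refl])
    fix t
    have int: "integrable \<mu> (\<lambda>s. F i j (t, s))" if "i < n" "j < n" for i j
      by (rule integrable_Cc[OF Cc_slice(1)[OF Fc[OF that] cK Fz[OF that]]])
    have "(\<integral>s. ?F (t, s) \<partial>\<mu>) = (\<Sum>i<n. (\<integral>s. (\<Sum>j<n. F i j (t, s)) \<partial>\<mu>))"
      by (intro Bochner_Integration.integral_sum Bochner_Integration.integrable_sum int) auto
    also have "\<dots> = (\<Sum>i<n. \<Sum>j<n. (\<integral>s. F i j (t, s) \<partial>\<mu>))"
      by (intro sum.cong refl Bochner_Integration.integral_sum int) auto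
    finally show "(\<Sum>i<n. \<Sum>j<n. (\<integral>s. F i j (t, s) \<partial>\<mu>)) = (\<integral>s. ?F (t, s) \<partial>\<mu>)" by simp
  qed
  also have "\<dots> \<in> \<real>\<^sub>\<ge>\<^sub>0"
  proof (rule double_integral_positive[of ?F, OF _ cK])
    show "continuous_on UNIV ?F" by (intro continuous_on_sum Fc) auto
    show "?F (s, t) = 0" if "s \<notin> ?K \<or> t \<notin> ?K" for s t using Fz[OF _ _ that] by (intro sum.neutral ballI) auto
    fix P :: "'g set set" and w :: "'g set \<Rightarrow> real" and \<tau> :: "'g set \<Rightarrow> 'g"
    assume P: "finite P"
    have cart: "(\<Sum>E\<in>P. \<Sum>i<n. q E i) = (\<Sum>x\<in>P \<times> {..<n}. q (fst x) (snd x))" for q :: "'g set \<Rightarrow> nat \<Rightarrow> complex"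
      by (simp add: sum.cartesian_product case_prod_unfold)
    have "(\<Sum>E\<in>P. \<Sum>E'\<in>P. (w E * w E') *\<^sub>R ?F (\<tau> E, \<tau> E')) =
      (\<Sum>E\<in>P. \<Sum>E'\<in>P. \<Sum>i<n. \<Sum>j<n. (w E * w E') *\<^sub>R F i j (\<tau> E, \<tau> E'))"
      by (simp add: scaleR_sum_right)
    also have "\<dots> = (\<Sum>E\<in>P. \<Sum>i<n. \<Sum>E'\<in>P. \<Sum>j<n. (w E * w E') *\<^sub>R F i j (\<tau> E, \<tau> E'))"
      by (intro sum.cong refl sum.swap)
    also have "\<dots> = (\<Sum>x\<in>P \<times> {..<n}. \<Sum>y\<in>P \<times> {..<n}. (w (fst x) * w (fst y)) *\<^sub>R F (snd x) (snd y) (\<tau> (fst x), \<tau> (fst y)))"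
      by (simp only: cart)
    also have "\<dots> = (\<Sum>x\<in>P \<times> {..<n}. \<Sum>y\<in>P \<times> {..<n}.
        cinner (w (fst x) *\<^sub>R u (\<tau> (fst x)) (h (snd x)))
         (\<phi> (star (f (snd x) (\<tau> (fst x))) * f (snd y) (\<tau> (fst y))) (w (fst y) *\<^sub>R u (\<tau> (fst y)) (h (snd y)))))"
      by (simp add: F_def cinner_scaleR_left cinner_scaleR_right phi.apply_simps mult.commute)
    also have "\<dots> \<in> \<real>\<^sub>\<ge>\<^sub>0" using P by (intro positive_finite) simp
    finally show "(\<Sum>E\<in>P. \<Sum>E'\<in>P. (w E * w E') *\<^sub>R ?F (\<tau> E, \<tau> E')) \<in> \<real>\<^sub>\<ge>\<^sub>0" .
  qed
  finally show ?thesis .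
qed

end

section \<open>Hilbert modules\<close>

context hilbert_module
begin

lemma ip_add_left: "ip (x + y) z = ip x z + ip y z"
  by (metis ip_add_right ip_star star_add)

lemma ip_scaleC_left: "ip (c *\<^sub>C x) y = cnj c *\<^sub>C ip x y"
  by (metis ip_scaleC_right ip_star star_scaleC)

lemma ip_scaleR_left: "ip (r *\<^sub>R x) y = r *\<^sub>R ip x y"
  by (simp add: scaleR_scaleC ip_scaleC_left)

lemma ip_scaleR_right: "ip x (r *\<^sub>R y) = r *\<^sub>R ip x y"
  by (simp add: scaleR_scaleC ip_scaleC_right)

lemma ip_zero [simp]: "ip 0 x = 0" "ip x 0 = 0"
  using ip_scaleR_left[of 0 0 x] ip_scaleR_right[of x 0 0] by auto

lemma norm_ip_self: "norm (ip x x) = (norm x)\<^sup>2"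
  using norm_ip[of x] by simp

text \<open>The triangle inequality in \<open>X\<close> and polarisation give a weak form of the Cauchy-Schwarz
  inequality without the order of \<open>A\<close>.\<close>

lemma norm_ip_le: "norm (ip x y) \<le> 6 * norm x * norm y"
proof -
  have unit: "norm (ip x y) \<le> 6" if xy: "norm x \<le> 1" "norm y \<le> 1" for x y
  proof -
    have sq: "norm (ip v v) \<le> r\<^sup>2" if "norm v \<le> r" for v r
      unfolding norm_ip_self using that by (intro power_mono) auto
    have tri: "norm (a - b - c) \<le> norm a + norm b + norm c" for a b c :: 'a
      using norm_triangle_ineq4[of "a - b" c] norm_triangle_ineq4[of a b] by linarith
    have "ip x y + ip y x = ip (x + y) (x + y) - ip x x - ip y y"
      by (simp add: ip_add_left ip_add_right)
    \<comment> \<open>6 = 4 + 1 + 1, the 4 coming from norm (x + y) \<le> 2.\<close>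
    then have 1: "norm (ip x y + ip y x) \<le> 6"
      using tri[of "ip (x + y) (x + y)" "ip x x" "ip y y"] sq[of "x + y" 2] sq[OF xy(1)] sq[OF xy(2)]
        norm_triangle_ineq[of x y] xy by simp
    have "\<i> *\<^sub>C (ip x y - ip y x) = ip (x + \<i> *\<^sub>C y) (x + \<i> *\<^sub>C y) - ip x x - ip y y"
      by (simp add: ip_add_left ip_add_right ip_scaleC_left ip_scaleC_right scaleC_scaleC scaleC_diff_right)
    then have 2: "norm (ip x y - ip y x) \<le> 6"
      using tri[of "ip (x + \<i> *\<^sub>C y) (x + \<i> *\<^sub>C y)" "ip x x" "ip y y"] sq[of "x + \<i> *\<^sub>C y" 2] sq[OF xy(1)] sq[OF xy(2)]
        norm_triangle_ineq[of x "\<i> *\<^sub>C y"] xy norm_scaleC[of \<i> "ip x y - ip y x"] by (simp add: norm_scaleC)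
    have "2 *\<^sub>R ip x y = (ip x y + ip y x) + (ip x y - ip y x)" by (simp add: scaleR_2)
    then have "2 * norm (ip x y) = norm ((ip x y + ip y x) + (ip x y - ip y x))"
      by (metis abs_numeral norm_scaleR)
    also have "\<dots> \<le> 6 + 6" using 1 2 norm_triangle_ineq[of "ip x y + ip y x" "ip x y - ip y x"] by linarith
    finally show ?thesis by simp
  qed
  show ?thesis
  proof (cases "x = 0 \<or> y = 0")
    case False
    have "norm (ip (inverse (norm x) *\<^sub>R x) (inverse (norm y) *\<^sub>R y)) \<le> 6" using False by (intro unit) auto
    then show ?thesis using False by (simp add: ip_scaleR_left ip_scaleR_right field_simps)
  qed auto
qed

lemma bounded_bilinear_ip: "bounded_bilinear ip"
proof (rule bounded_bilinear.intro)
  have "norm (ip x y) \<le> norm x * norm y * 6" for x y using norm_ip_le[of x y] by (simp add: mult_ac)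
  then show "\<exists>K. \<forall>a b. norm (ip a b) \<le> norm a * norm b * K" by blast
qed (simp_all add: ip_add_left ip_add_right ip_scaleR_left ip_scaleR_right)

lemmas continuous_on_ip = bounded_bilinear.continuous_on [OF bounded_bilinear_ip]
lemmas tendsto_ip = bounded_bilinear.tendsto [OF bounded_bilinear_ip]

lemma norm_act_le: "norm (act x a) \<le> norm x * norm a"
proof -
  have "ip (act x a) (act x a) = star a * ip x x * a"
    by (metis ip_act_right ip_star star_mult)
  then have "(norm (act x a))\<^sup>2 = norm (star a * ip x x * a)" by (metis norm_ip_self)
  also have "\<dots> \<le> norm a * (norm x)\<^sup>2 * norm a"
  proof (rule order_trans[OF norm_mult_ineq mult_right_mono])
    show "norm (star a * ip x x) \<le> norm a * (norm x)\<^sup>2"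
      using norm_mult_ineq[of "star a" "ip x x"] by (simp add: norm_ip_self)
  qed simp
  finally have "(norm (act x a))\<^sup>2 \<le> (norm x * norm a)\<^sup>2" by (simp add: power2_eq_square mult_ac)
  then show ?thesis by (rule power2_le_imp_le) simp
qed

lemma bounded_linear_act: "bounded_linear (act x)"
proof (rule bounded_linear_intro[of _ "norm x"])
  show "norm (act x a) \<le> norm a * norm x" for a using norm_act_le[of x a] by (simp add: mult.commute)
qed (simp_all add: act_add_right scaleR_scaleC act_scaleC_right)

text \<open>Finite sums suffice: scalars and algebra factors can be moved into the entries of an
  inner product, so this is already a two-sided ideal.\<close>

inductive_set ip_span :: "'a set" where
  zero: "0 \<in> ip_span"
| add: "s \<in> ip_span \<Longrightarrow> s + ip x y \<in> ip_span"

lemma ip_span_add: "s \<in> ip_span \<Longrightarrow> t \<in> ip_span \<Longrightarrow> t + s \<in> ip_span"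
  by (induction rule: ip_span.induct) (auto simp: add.assoc[symmetric] intro: ip_span.add)

lemma ip_span_scaleC: "s \<in> ip_span \<Longrightarrow> c *\<^sub>C s \<in> ip_span"
  by (induction rule: ip_span.induct)
     (auto simp: scaleC_add_right ip_scaleC_right[symmetric] intro: ip_span.intros)

lemma ip_span_mult_right: "s \<in> ip_span \<Longrightarrow> s * a \<in> ip_span"
  by (induction rule: ip_span.induct)
     (auto simp: distrib_right ip_act_right[symmetric] intro: ip_span.intros)

lemma ip_span_mult_left: "s \<in> ip_span \<Longrightarrow> a * s \<in> ip_span"
proof (induction rule: ip_span.induct)
  case (add s x y)
  have "a * ip x y = ip (act x (star a)) y" by (metis ip_act_right ip_star star_mult star_star)
  then show ?case using add by (simp add: distrib_left ip_span.add)
qed (simp add: ip_span.zero)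

lemma ip_span_dense:
  assumes "full_module ip"
  shows "closure ip_span = UNIV"
proof -
  \<comment> \<open>A continuous map that sends the span into its closure does the same to the
    closure. Addition uses this once in each argument.\<close>
  have cl: "T a \<in> closure ip_span" if a: "a \<in> closure ip_span" and T: "continuous_on UNIV T"
    and m: "\<And>s. s \<in> ip_span \<Longrightarrow> T s \<in> closure ip_span" for T :: "'a \<Rightarrow> 'a" and a
  proof -
    have "T ` closure ip_span \<subseteq> closure ip_span"
      by (rule image_closure_subset) (use T m in \<open>auto intro: continuous_on_subset\<close>)
    then show ?thesis using a by blast
  qed
  have sub: "s \<in> closure ip_span" if "s \<in> ip_span" for s using that closure_subset by blast
  have "closed_two_sided_ideal (closure ip_span)"
    unfolding closed_two_sided_ideal_def
  proof (intro conjI ballI allI)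
    show "0 \<in> closure ip_span" by (intro sub ip_span.zero)
    fix a assume a: "a \<in> closure ip_span"
    show "a + b \<in> closure ip_span" if b: "b \<in> closure ip_span" for b
    proof (rule cl[OF a, of "\<lambda>a. a + b"])
      show "s + b \<in> closure ip_span" if "s \<in> ip_span" for s
        by (rule cl[OF b, of "\<lambda>b. s + b"]) (auto intro!: continuous_intros sub ip_span_add that)
    qed (intro continuous_intros)
    show "c *\<^sub>C a \<in> closure ip_span" for c
      by (rule cl[OF a]) (auto intro!: continuous_on_scaleC continuous_on_const continuous_on_id sub ip_span_scaleC)
    show "a * b \<in> closure ip_span" for b
      by (rule cl[OF a]) (auto intro!: continuous_on_mult continuous_on_const continuous_on_id sub ip_span_mult_right)
    show "b * a \<in> closure ip_span" for b
      by (rule cl[OF a]) (auto intro!: continuous_on_mult continuous_on_const continuous_on_id sub ip_span_mult_left)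
  qed simp
  moreover have "ip x y \<in> closure ip_span" for x y
    using sub[OF ip_span.add[OF ip_span.zero, of x y]] by simp
  ultimately show ?thesis using assms unfolding full_module_def by blast
qed

end

section \<open>Extension by density\<close>

text \<open>For each fixed h the bound makes the map Lipschitz on the dense image, so it extends to
  the closure. Linearity in both arguments is then recovered along sequences.\<close>

lemma dense_extension:
  fixes \<kappa> :: "('g::t2_space \<Rightarrow> 'v::complex_normed_vector) \<Rightarrow> 'y::complex_normed_vector"
    and T :: "('g \<Rightarrow> 'v) \<Rightarrow> 'h::complex_normed_vector \<Rightarrow> 'k::{complex_normed_vector, complete_space}"
  assumes Cc: "\<And>f g :: 'g \<Rightarrow> 'v. f \<in> Cc \<Longrightarrow> g \<in> Cc \<Longrightarrow> (\<lambda>t. f t + g t) \<in> Cc"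
      "\<And>c (f :: 'g \<Rightarrow> 'v). f \<in> Cc \<Longrightarrow> (\<lambda>t. c *\<^sub>C f t) \<in> Cc"
    and \<kappa>: "\<And>f g. f \<in> Cc \<Longrightarrow> g \<in> Cc \<Longrightarrow> \<kappa> (\<lambda>t. f t + g t) = \<kappa> f + \<kappa> g" "\<And>c f. f \<in> Cc \<Longrightarrow> \<kappa> (\<lambda>t. c *\<^sub>C f t) = c *\<^sub>C \<kappa> f"
    and dense: "closure (\<kappa> ` Cc) = UNIV"
    and T: "\<And>f g h. f \<in> Cc \<Longrightarrow> g \<in> Cc \<Longrightarrow> T (\<lambda>t. f t + g t) h = T f h + T g h"
      "\<And>c f h. f \<in> Cc \<Longrightarrow> T (\<lambda>t. c *\<^sub>C f t) h = c *\<^sub>C T f h"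
      "\<And>f h k. f \<in> Cc \<Longrightarrow> T f (h + k) = T f h + T f k" "\<And>c f h. f \<in> Cc \<Longrightarrow> T f (c *\<^sub>C h) = c *\<^sub>C T f h"
    and bound: "\<And>f h. f \<in> Cc \<Longrightarrow> norm (T f h) \<le> B * norm (\<kappa> f) * norm h" and B: "B \<ge> 0"
  shows "\<exists>S. (\<forall>f\<in>Cc. \<forall>h. S (\<kappa> f) h = T f h) \<and> (\<forall>a b h. S (a + b) h = S a h + S b h) \<and>
    (\<forall>c a h. S (c *\<^sub>C a) h = c *\<^sub>C S a h) \<and> (\<forall>a. bounded_clinear (S a)) \<and>
    (\<forall>a h. norm (S a h) \<le> B * norm a * norm h)"
proof -
  have lip: "norm (T f h - T g h) \<le> B * norm h * norm (\<kappa> f - \<kappa> g)" if f: "f \<in> Cc" and g: "g \<in> Cc" for f g h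
  proof -
    have g': "(\<lambda>t. (- 1) *\<^sub>C g t) \<in> Cc" by (rule Cc(2)[OF g])
    show ?thesis
      using bound[OF Cc(1)[OF f g'], of h] unfolding T(1)[OF f g'] T(2)[OF g] \<kappa>(1)[OF f g'] \<kappa>(2)[OF g]
      by (simp add: mult_ac)
  qed
  have "\<exists>S. (\<forall>f\<in>Cc. S (\<kappa> f) = T f h) \<and> (B * norm h)-lipschitz_on UNIV S" for h
  proof -
    \<comment> \<open>\<kappa> need not be injective, so preimages are chosen; \<open>lip\<close>
      makes the value independent of the choice.\<close>
    define p where "p a = (SOME f. f \<in> Cc \<and> \<kappa> f = a)" for a
    have p: "p a \<in> Cc \<and> \<kappa> (p a) = a" if "a \<in> \<kappa> ` Cc" for a
      using someI_ex[of "\<lambda>f. f \<in> Cc \<and> \<kappa> f = a"] that unfolding p_def by blast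
    have pk: "T (p (\<kappa> f)) h = T f h" if "f \<in> Cc" for f
      using lip[of "p (\<kappa> f)" f h] p[of "\<kappa> f"] that by simp
    have "(B * norm h)-lipschitz_on (\<kappa> ` Cc) (\<lambda>a. T (p a) h)"
    proof (rule lipschitz_onI)
      fix a b assume "a \<in> \<kappa> ` Cc" "b \<in> \<kappa> ` Cc"
      then show "dist (T (p a) h) (T (p b) h) \<le> B * norm h * dist a b"
        using lip[of "p a" "p b" h] p[of a] p[of b] by (simp add: dist_norm)
    qed (use B in simp)
    from lipschitz_extend_closure[OF this] obtain S
      where "(B * norm h)-lipschitz_on UNIV S" "\<forall>a\<in>\<kappa> ` Cc. S a = T (p a) h" unfolding dense by blast
    then show ?thesis using pk by (intro exI[of _ S]) auto
  qed
  then obtain S where S: "\<And>f h. f \<in> Cc \<Longrightarrow> S h (\<kappa> f) = T f h" "\<And>h. (B * norm h)-lipschitz_on UNIV (S h)"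
    by metis
  have cont: "continuous_on UNIV (S h)" for h using S(2) lipschitz_on_continuous_on by blast
  have lim: "(\<lambda>n. S h (x n)) \<longlonglongrightarrow> S h a" if "x \<longlonglongrightarrow> a" for x a h
    using continuous_on_tendsto_compose[OF cont that] by simp
  have seq: "\<exists>f. (\<forall>n. f n \<in> Cc) \<and> (\<lambda>n. \<kappa> (f n)) \<longlonglongrightarrow> a" for a
  proof -
    have "a \<in> closure (\<kappa> ` Cc)" by (simp add: dense)
    then obtain x where x: "\<forall>n. x n \<in> \<kappa> ` Cc" "x \<longlonglongrightarrow> a" unfolding closure_sequential by blast
    show ?thesis
      by (rule exI[of _ "\<lambda>n. inv_into Cc \<kappa> (x n)"]) (use x in \<open>simp add: inv_into_into f_inv_into_f\<close>)
  qed
  have add: "S h (a + b) = S h a + S h b" for h a b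
  proof -
    obtain f where f: "\<And>n. f n \<in> Cc" "(\<lambda>n. \<kappa> (f n)) \<longlonglongrightarrow> a" using seq[of a] by blast
    obtain g where g: "\<And>n. g n \<in> Cc" "(\<lambda>n. \<kappa> (g n)) \<longlonglongrightarrow> b" using seq[of b] by blast
    have "S h (\<kappa> (f n) + \<kappa> (g n)) = S h (\<kappa> (f n)) + S h (\<kappa> (g n))" for n
      using f(1) g(1) by (simp add: S(1) T(1) Cc(1) flip: \<kappa>(1))
    then show ?thesis
      using LIMSEQ_unique[OF lim[OF tendsto_add[OF f(2) g(2)]]] tendsto_add[OF lim[OF f(2)] lim[OF g(2)]] by simp
  qed
  have scale: "S h (c *\<^sub>C a) = c *\<^sub>C S h a" for h c a
  proof -
    obtain f where f: "\<And>n. f n \<in> Cc" "(\<lambda>n. \<kappa> (f n)) \<longlonglongrightarrow> a" using seq[of a] by blast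
    have "S h (c *\<^sub>C \<kappa> (f n)) = c *\<^sub>C S h (\<kappa> (f n))" for n
      using f(1) by (simp add: S(1) T(2) Cc(2) flip: \<kappa>(2))
    then show ?thesis
      using LIMSEQ_unique[OF lim[OF tendsto_scaleC[OF tendsto_const f(2)]]] tendsto_scaleC[OF tendsto_const lim[OF f(2)], of c] by simp
  qed
  have opadd: "S (h + k) a = S h a + S k a" for h k a
  proof -
    obtain f where f: "\<And>n. f n \<in> Cc" "(\<lambda>n. \<kappa> (f n)) \<longlonglongrightarrow> a" using seq[of a] by blast
    have "S (h + k) (\<kappa> (f n)) = S h (\<kappa> (f n)) + S k (\<kappa> (f n))" for n using f(1) by (simp add: S(1) T(3))
    then show ?thesis using LIMSEQ_unique[OF lim[OF f(2), of "h + k"]] tendsto_add[OF lim[OF f(2), of h] lim[OF f(2), of k]] by simp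
  qed
  have opscale: "S (c *\<^sub>C h) a = c *\<^sub>C S h a" for h c a
  proof -
    obtain f where f: "\<And>n. f n \<in> Cc" "(\<lambda>n. \<kappa> (f n)) \<longlonglongrightarrow> a" using seq[of a] by blast
    have "S (c *\<^sub>C h) (\<kappa> (f n)) = c *\<^sub>C S h (\<kappa> (f n))" for n using f(1) by (simp add: S(1) T(4))
    then show ?thesis using LIMSEQ_unique[OF lim[OF f(2), of "c *\<^sub>C h"]] tendsto_scaleC[OF tendsto_const lim[OF f(2), of h], of c] by simp
  qed
  have bd: "norm (S h a) \<le> B * norm a * norm h" for h a
    using lipschitz_onD[OF S(2), of a 0 h] scale[of h 0 0] by (simp add: dist_norm mult_ac)
  show ?thesis
  proof (intro exI[of _ "\<lambda>a h. S h a"] conjI ballI allI)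
    fix a show "bounded_clinear (\<lambda>h. S h a)"
    proof (rule bounded_clinearI[of _ "B * norm a"])
      show "norm (S h a) \<le> norm h * (B * norm a)" for h using bd[of h a] by (simp add: mult.commute)
    qed (simp_all add: opadd opscale)
  qed (simp_all add: S(1) add scale bd)
qed

context compact_finite_measure
begin

lemma vector_integral_add:
  fixes f :: "'g \<Rightarrow> 'b::banach"
  assumes "f \<in> Cc" "g \<in> Cc"
  shows "vector_integral \<mu> (\<lambda>t. f t + g t) = vector_integral \<mu> f + vector_integral \<mu> g"
proof -
  have "(\<lambda>t. f t + g t - g t) = f" by simp
  then show ?thesis using vector_integral_diff[OF Cc_add[OF assms] assms(2)] by simp
qed

end

section \<open>The integrated module map\<close>

locale covariant_module_map =
  covariant_cp \<mu> \<phi> u \<alpha> + X: hilbert_module act ip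
  for \<mu> :: "'g::{topological_group_add, t2_space} measure"
    and \<phi> :: "'a::cstar_algebra \<Rightarrow> 'h::chilbert_space \<Rightarrow> 'h"
    and u :: "'g \<Rightarrow> 'h \<Rightarrow> 'h" and \<alpha> :: "'g \<Rightarrow> 'a \<Rightarrow> 'a"
    and act :: "'x::{complex_normed_vector, complete_space} \<Rightarrow> 'a \<Rightarrow> 'x" and ip :: "'x \<Rightarrow> 'x \<Rightarrow> 'a" +
  fixes \<Phi> :: "'x \<Rightarrow> 'h \<Rightarrow> 'k::chilbert_space"
  assumes full: "full_module ip" and Phi_clinear: "bounded_clinear (\<Phi> x)"
    and Phi_ip: "cinner (\<Phi> x h) (\<Phi> y k) = cinner h (\<phi> (ip x y) k)"
begin

lemmas Phi_simps = bounded_clinearD(2-)[OF Phi_clinear]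

lemma eq_if_self_cinner_zero: "cinner (v - w) (v - w) = 0 \<Longrightarrow> v = (w :: 'k)"
  by (simp add: cinner_self del: of_real_power)

text \<open>The definition of a completely positive module map does not mention linearity. It is
  forced, because inner products among the vectors \<Phi> x h are given by \<phi>, and the squared
  norm of the defect expands to 0.\<close>

lemma Phi_add: "\<Phi> (x + y) h = \<Phi> x h + \<Phi> y h"
  by (rule eq_if_self_cinner_zero)
     (simp add: cinner_diff_left cinner_diff_right cinner_add_left cinner_add_right Phi_ip X.ip_add_left X.ip_add_right phi.add)

lemma Phi_scaleC: "\<Phi> (c *\<^sub>C x) h = c *\<^sub>C \<Phi> x h"
  by (rule eq_if_self_cinner_zero)
     (simp add: cinner_diff_left cinner_diff_right cinner_scaleC_left cinner_scaleC_right Phi_ip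
       X.ip_scaleC_left X.ip_scaleC_right phi.scaleC)

text \<open>The squared norm of \<Phi> x h is the coefficient of \<phi> (ip x x) at h; hence the
  square root of the bound of \<phi>.\<close>

lemma bounded_bilinear_Phi: "bounded_bilinear \<Phi>"
proof -
  obtain M where M: "M \<ge> 0" "\<And>a h. norm (\<phi> a h) \<le> M * norm a * norm h" using phi.bounded_ex by blast
  have "norm (\<Phi> x h) \<le> norm x * norm h * sqrt M" for x h
  proof (rule power2_le_imp_le)
    have "complex_of_real ((norm (\<Phi> x h))\<^sup>2) = cinner h (\<phi> (ip x x) h)"
      unfolding cinner_self[symmetric] by (rule Phi_ip)
    then have "(norm (\<Phi> x h))\<^sup>2 = Re (cinner h (\<phi> (ip x x) h))" by (metis Re_complex_of_real)
    also have "\<dots> \<le> norm h * norm (\<phi> (ip x x) h)" by (rule Re_cinner_le)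
    also have "\<dots> \<le> norm h * (M * norm (ip x x) * norm h)" by (intro mult_left_mono M(2)) simp
    also have "\<dots> = (norm x * norm h * sqrt M)\<^sup>2"
      using M(1) by (simp add: X.norm_ip_self power_mult_distrib power2_eq_square)
    finally show "(norm (\<Phi> x h))\<^sup>2 \<le> (norm x * norm h * sqrt M)\<^sup>2" .
  qed (use M(1) in simp)
  then show ?thesis
    by (intro bounded_bilinear.intro exI[of _ "sqrt M"]) (simp_all add: Phi_add Phi_simps scaleR_scaleC Phi_scaleC)
qed

lemma continuous_Phi: "continuous_on S f \<Longrightarrow> continuous_on S g \<Longrightarrow> continuous_on S (\<lambda>x. \<Phi> (f x) (g x))"
  by (rule bounded_bilinear.continuous_on[OF bounded_bilinear_Phi])

lemma Phi_zero: "\<Phi> 0 h = 0"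
  using Phi_scaleC[of 0 0 h] by simp

lemma Phihat_Cc: "x \<in> Cc \<Longrightarrow> (\<lambda>t. \<Phi> (x t) (u t h)) \<in> Cc"
  by (rule Cc_compose[of x "\<lambda>t v. \<Phi> v (u t h)"])
     (simp_all add: continuous_Phi u.continuous_apply continuous_on_id continuous_on_const CcD(1) Phi_zero)

definition Phihat :: "('g \<Rightarrow> 'x) \<Rightarrow> 'h \<Rightarrow> 'k"
  where "Phihat x h = vector_integral \<mu> (\<lambda>t. \<Phi> (x t) (u t h))"

abbreviation cip :: "('g \<Rightarrow> 'x) \<Rightarrow> ('g \<Rightarrow> 'x) \<Rightarrow> 'g \<Rightarrow> 'a"
  where "cip \<equiv> crossed_product_ip \<mu> \<alpha> ip"

lemma cip_kernel:
  assumes x: "x \<in> Cc" and y: "y \<in> Cc"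
  shows "\<exists>K. compact K \<and> continuous_on UNIV (\<lambda>p. \<alpha> (- snd p) (ip (x (snd p)) (y (snd p + fst p)))) \<and>
    (\<forall>s t. s \<notin> K \<or> t \<notin> K \<longrightarrow> \<alpha> (- t) (ip (x t) (y (t + s))) = 0)"
proof -
  obtain K where K: "compact K" "\<And>t. t \<notin> K \<Longrightarrow> x t = 0" using CcD(2)[OF x] by blast
  obtain L where L: "compact L" "\<And>t. t \<notin> L \<Longrightarrow> y t = 0" using CcD(2)[OF y] by blast
  let ?P = "(\<lambda>p. fst p + snd p) ` (uminus ` K \<times> L)"
  show ?thesis
  proof (intro exI[of _ "K \<union> ?P"] conjI allI impI)
    show "compact (K \<union> ?P)" by (intro compact_Un compact_plus compact_minus K L)
    show "continuous_on UNIV (\<lambda>p. \<alpha> (- snd p) (ip (x (snd p)) (y (snd p + fst p))))"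
      by (intro continuous_alpha X.continuous_on_ip continuous_on_UNIV_compose[OF CcD(1)[OF x]]
          continuous_on_UNIV_compose[OF CcD(1)[OF y]] continuous_on_pairs)
    fix s t assume st: "s \<notin> K \<union> ?P \<or> t \<notin> K \<union> ?P"
    show "\<alpha> (- t) (ip (x t) (y (t + s))) = 0"
    proof (rule ccontr)
      assume "\<alpha> (- t) (ip (x t) (y (t + s))) \<noteq> 0"
      then have "x t \<noteq> 0" "y (t + s) \<noteq> 0" by auto
      then have ts: "t \<in> K" "t + s \<in> L" using K(2) L(2) by blast+
      moreover have "s = - t + (t + s)" by (simp add: add.assoc[symmetric])
      ultimately have "s \<in> ?P" by (intro image_eqI[of _ _ "(- t, t + s)"]) auto
      with st ts(1) show False by blast
    qed
  qed
qed

lemma cip_Cc: "x \<in> Cc \<Longrightarrow> y \<in> Cc \<Longrightarrow> cip x y \<in> Cc"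
proof -
  assume "x \<in> Cc" "y \<in> Cc"
  from cip_kernel[OF this]
  obtain K where K: "compact K" "continuous_on UNIV (\<lambda>p. \<alpha> (- snd p) (ip (x (snd p)) (y (snd p + fst p))))"
    "\<forall>s t. s \<notin> K \<or> t \<notin> K \<longrightarrow> \<alpha> (- t) (ip (x t) (y (t + s))) = 0"
    by (elim exE conjE)
  have "(\<lambda>s. vector_integral \<mu> (\<lambda>t. \<alpha> (- snd (s, t)) (ip (x (snd (s, t))) (y (snd (s, t) + fst (s, t)))))) \<in> Cc"
    by (rule Cc_parameter_integral[OF K(2,1)]) (use K(3) in simp)
  then show ?thesis by (simp add: crossed_product_ip_def)
qed

lemma functional_cip:
  assumes x: "x \<in> Cc" and y: "y \<in> Cc" and b: "functional b"
  shows "(\<integral>s. b (cip x y s) s \<partial>\<mu>) = (\<integral>t. \<integral>s. b (\<alpha> (- t) (ip (x t) (y s))) (- t + s) \<partial>\<mu> \<partial>\<mu>)"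
proof -
  obtain K where K: "compact K" "continuous_on UNIV (\<lambda>p. \<alpha> (- snd p) (ip (x (snd p)) (y (snd p + fst p))))"
    "\<forall>s t. s \<notin> K \<or> t \<notin> K \<longrightarrow> \<alpha> (- t) (ip (x t) (y (t + s))) = 0"
    using cip_kernel[OF x y] by (elim exE conjE)
  have "(\<integral>s. b (cip x y s) s \<partial>\<mu>) = (\<integral>t. \<integral>s. b (\<alpha> (- t) (ip (x t) (y (t + s)))) s \<partial>\<mu> \<partial>\<mu>)"
    unfolding crossed_product_ip_def using functional_parameter_integral[OF K(2,1) _ b] K(3) by simp
  also have "\<dots> = (\<integral>t. \<integral>s. b (\<alpha> (- t) (ip (x t) (y s))) (- t + s) \<partial>\<mu> \<partial>\<mu>)"
  proof (rule Bochner_Integration.integral_cong[OF refl])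
    fix t
    have "continuous_on UNIV (\<lambda>s. b (\<alpha> (- t) (ip (x t) (y s))) (- t + s))"
      by (intro functional_simps(4)[OF b] continuous_alpha X.continuous_on_ip CcD(1)[OF y] continuous_on_pairs)
    from integral_translate[OF this, of t]
    show "(\<integral>s. b (\<alpha> (- t) (ip (x t) (y (t + s)))) s \<partial>\<mu>) = (\<integral>s. b (\<alpha> (- t) (ip (x t) (y s))) (- t + s) \<partial>\<mu>)"
      by (simp add: add.assoc[symmetric])
  qed
  finally show ?thesis .
qed

text \<open>Taking both integrals out leaves the coefficient of \<phi> (ip (x t) (y s)) between u_t
  h and u_s k. Covariance moves u_t to the other side, where it becomes \<alpha>_(-t) inside \<phi>
  and u_(-t+s) on k, the integrand of the inner product of the crossed product module.\<close>

lemma Phihat_ip: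
  assumes x: "x \<in> Cc" and y: "y \<in> Cc"
  shows "cinner (Phihat x h) (Phihat y k) = cinner h (phihat (cip x y) k)"
proof -
  obtain K where K: "compact K" "\<And>t. t \<notin> K \<Longrightarrow> x t = 0" using CcD(2)[OF x] by blast
  obtain L where L: "compact L" "\<And>t. t \<notin> L \<Longrightarrow> y t = 0" using CcD(2)[OF y] by blast
  let ?F = "\<lambda>p. cinner (u (fst p) h) (\<phi> (ip (x (fst p)) (y (snd p))) (u (snd p) k))"
  have F: "continuous_on UNIV ?F"
    by (intro continuous_on_cinner continuous_phi X.continuous_on_ip u.continuous_apply continuous_on_UNIV_compose[OF CcD(1)[OF x]]
          continuous_on_UNIV_compose[OF CcD(1)[OF y]] continuous_on_pairs)
  have z: "?F (s, t) = 0" if "s \<notin> K \<union> L \<or> t \<notin> K \<union> L" for s t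
    using that K(2) L(2) by (auto simp: phi.zero)
  have left: "cinner (Phihat x h) v = (\<integral>s. cinner (\<Phi> (x s) (u s h)) v \<partial>\<mu>)" for v
  proof -
    have "cinner v (Phihat x h) = (\<integral>s. cinner v (\<Phi> (x s) (u s h)) \<partial>\<mu>)"
      unfolding Phihat_def by (rule linear_vector_integral[OF bounded_linear_cinner_right Phihat_Cc[OF x]])
    then have "cnj (cinner v (Phihat x h)) = (\<integral>s. cnj (cinner v (\<Phi> (x s) (u s h))) \<partial>\<mu>)" by simp
    then show ?thesis by (simp add: cinner_commute[symmetric] del: integral_cnj)
  qed
  have "cinner (Phihat x h) (Phihat y k) = (\<integral>t. cinner (Phihat x h) (\<Phi> (y t) (u t k)) \<partial>\<mu>)"
    unfolding Phihat_def[of y] by (rule linear_vector_integral[OF bounded_linear_cinner_right Phihat_Cc[OF y]])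
  also have "\<dots> = (\<integral>t. \<integral>s. ?F (s, t) \<partial>\<mu> \<partial>\<mu>)" by (simp add: left Phi_ip)
  also have "\<dots> = (\<integral>s. \<integral>t. ?F (s, t) \<partial>\<mu> \<partial>\<mu>)"
    using Fubini_Cc[OF F compact_Un[OF K(1) L(1)] z] by simp
  also have "\<dots> = (\<integral>t. \<integral>s. cinner h (\<phi> (\<alpha> (- t) (ip (x t) (y s))) (u (- t + s) k)) \<partial>\<mu> \<partial>\<mu>)"
    by (simp add: u.plus covariant u.cinner_left)
  also have "\<dots> = cinner h (phihat (cip x y) k)"
    by (simp add: cinner_phihat cip_Cc x y functional_cip[OF x y functional_phi])
  finally show ?thesis .
qed

lemma Phihat_linear:
  assumes x: "x \<in> Cc"
  shows "y \<in> Cc \<Longrightarrow> Phihat (\<lambda>t. x t + y t) h = Phihat x h + Phihat y h"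
    "Phihat (\<lambda>t. c *\<^sub>C x t) h = c *\<^sub>C Phihat x h"
    "Phihat x (h + k) = Phihat x h + Phihat x k" "Phihat x (c *\<^sub>C h) = c *\<^sub>C Phihat x h"
  unfolding Phihat_def
  by (simp_all add: Phi_add Phi_scaleC Phi_simps u.apply_simps vector_integral_add Phihat_Cc x
      linear_vector_integral'[OF bounded_bilinear.bounded_linear_right[OF bounded_bilinear_scaleC] Phihat_Cc[OF x]])

lemma phihat_linear:
  assumes f: "f \<in> Cc"
  shows "g \<in> Cc \<Longrightarrow> phihat (\<lambda>t. f t + g t) h = phihat f h + phihat g h"
    "phihat (\<lambda>t. c *\<^sub>C f t) h = c *\<^sub>C phihat f h"
    "phihat f (h + k) = phihat f h + phihat f k" "phihat f (c *\<^sub>C h) = c *\<^sub>C phihat f h"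
  unfolding phihat_def
  by (simp_all add: phi.add phi.scaleC phi.apply_simps u.apply_simps vector_integral_add phihat_Cc f
      linear_vector_integral'[OF bounded_bilinear.bounded_linear_right[OF bounded_bilinear_scaleC] phihat_Cc[OF f]])

section \<open>Density of the inner products\<close>

text \<open>With \<open>\<delta>\<close> concentrated near the identity and \<open>e = \<Sum> \<langle>x\<^sub>j,y\<^sub>j\<rangle>\<close> close to a unit on the range of \<open>f\<close>,
  the sum of the inner products of \<open>\<delta> x\<^sub>j\<close> and \<open>y\<^sub>j f\<close> is \<open>s \<mapsto> \<integral> \<delta>(t) \<alpha>\<^sub>-\<^sub>t (e f(ts)) dt\<close>, which is close to \<open>f\<close>.\<close>

lemma cip_dense:
  assumes f: "f \<in> Cc" and \<epsilon>: "\<epsilon> > 0"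
    and Q0: "Q (\<lambda>t. 0)" and Qadd: "\<And>g h. g \<in> Cc \<Longrightarrow> h \<in> Cc \<Longrightarrow> Q g \<Longrightarrow> Q h \<Longrightarrow> Q (\<lambda>t. g t + h t)"
    and Qcip: "\<And>x y. x \<in> Cc \<Longrightarrow> y \<in> Cc \<Longrightarrow> Q (cip x y)"
  shows "\<exists>g\<in>Cc. Q g \<and> L1_norm \<mu> (\<lambda>t. f t - g t) \<le> \<epsilon>"
proof -
  obtain K where K: "compact K" "\<And>t. t \<notin> K \<Longrightarrow> f t = 0" using CcD(2)[OF f] by blast
  note cf = CcD(1)[OF f]
  obtain U N where N: "open U" "compact N" "(0::'g) \<in> U" "U \<subseteq> N" by (rule compact_neighbourhood)
  \<comment> \<open>L contains K and every s for which t + s lies in K for some t in N, so f and its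
    averages over N vanish off L.\<close>
  define L where "L = K \<union> (\<lambda>p. fst p + snd p) ` (uminus ` N \<times> K)"
  have L: "compact L" unfolding L_def by (intro compact_Un compact_plus compact_minus K N)
  have L_mem: "s \<in> L" if "t \<in> N" "t + s \<in> K" for s t
  proof -
    have "s = - t + (t + s)" by (simp add: add.assoc[symmetric])
    then show ?thesis using that unfolding L_def by (intro UnI2 image_eqI[of _ _ "(- t, t + s)"]) auto
  qed
  define r where "r = \<epsilon> / (measure \<mu> L + 1)"
  have m: "measure \<mu> L + 1 > 0" by (simp add: add_nonneg_pos)
  have r: "r > 0" using \<epsilon> m by (simp add: r_def)
  have rm: "r * measure \<mu> L \<le> \<epsilon>"
  proof -
    have "r * measure \<mu> L \<le> r * (measure \<mu> L + 1)" using r by simp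
    then show ?thesis using m by (simp add: r_def)
  qed
  have cK: "compact (f ` K)" by (intro compact_continuous_image continuous_on_subset[OF cf] K) simp
  have "r / 4 > 0" using r by simp
  then have "\<exists>e. \<forall>y\<in>f ` K. norm (y - e * y) \<le> r / 4"
    by (rule approximate_unit_compact[OF cK]) blast
  then obtain e0 where e0: "\<And>y. y \<in> f ` K \<Longrightarrow> norm (y - e0 * y) \<le> r / 4" by blast
  obtain C where C: "C > 0" "\<And>y. y \<in> f ` K \<Longrightarrow> norm y \<le> C"
    using compact_imp_bounded[OF cK] unfolding bounded_pos by blast
  have "e0 \<in> closure X.ip_span" by (simp add: X.ip_span_dense[OF full])
  then obtain e where e: "e \<in> X.ip_span" "dist e e0 < r / (4 * C)"
    using closure_approachable[of e0 X.ip_span] r C(1) by (metis divide_pos_pos mult_pos_pos zero_less_numeral)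
  have ef: "norm (f s - e * f s) \<le> r / 2" for s
  proof (cases "s \<in> K")
    case True
    have "norm ((e0 - e) * f s) \<le> norm (e0 - e) * norm (f s)" by (rule norm_mult_ineq)
    also have "\<dots> \<le> r / (4 * C) * C"
      using e(2) C(2)[of "f s"] True C(1) r by (intro mult_mono) (auto simp: dist_norm norm_minus_commute less_imp_le)
    finally have "norm ((e0 - e) * f s) \<le> r / 4" using C(1) by simp
    moreover have "norm (f s - e0 * f s) \<le> r / 4" using e0 True by blast
    moreover have eq: "f s - e * f s = (f s - e0 * f s) + (e0 - e) * f s" by (simp add: left_diff_distrib)
    ultimately show ?thesis using norm_triangle_ineq[of "f s - e0 * f s" "(e0 - e) * f s"] unfolding eq by linarith
  qed (use r in \<open>simp add: K(2)\<close>)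
  \<comment> \<open>At t = 0 this is f s - e * f s, already at most r / 2. Compactness of L keeps it
    below r for all t near 0, uniformly in s.\<close>
  let ?H = "\<lambda>p. f (snd p) - \<alpha> (- fst p) (e * f (fst p + snd p))"
  have H: "continuous_on UNIV ?H"
    by (intro continuous_on_diff continuous_alpha continuous_on_mult continuous_on_UNIV_compose[OF cf] continuous_on_pairs)
  have "\<exists>V. 0 \<in> V \<and> open V \<and> (\<forall>t\<in>V \<inter> UNIV. \<forall>s\<in>L. dist (?H (t, s)) (?H (0, s)) \<le> r / 2)"
    by (rule continuous_on_prod_compact_ex[OF continuous_on_subset[OF H] L]) (use r in auto)
  then obtain V where V: "0 \<in> V" "open V" "\<And>t s. t \<in> V \<Longrightarrow> s \<in> L \<Longrightarrow> dist (?H (t, s)) (?H (0, s)) \<le> r / 2" by blast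
  have HV: "norm (?H (t, s)) \<le> r" if "t \<in> V" "s \<in> L" for t s
    using V(3)[OF that] ef[of s] norm_triangle_ineq2[of "?H (t, s)" "?H (0, s)"] by (simp add: dist_norm)
  obtain b :: "'g \<Rightarrow> real" where b: "b \<in> Cc" "\<And>t. 0 \<le> b t" "b 0 = 1" "\<And>t. t \<notin> V \<inter> U \<Longrightarrow> b t = 0"
    using bump[of "V \<inter> U" 0] V(1,2) N(1,3) by (auto simp: open_Int)
  have bpos: "(\<integral>t. b t \<partial>\<mu>) > 0" by (rule integral_Cc_pos[OF b(1,2), of 0]) (simp add: b(3))
  define \<delta> where "\<delta> t = b t / (\<integral>t. b t \<partial>\<mu>)" for t
  have \<delta>0: "\<delta> t \<ge> 0" for t using b(2) bpos by (simp add: \<delta>_def)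
  have \<delta>z: "\<delta> t = 0" if "t \<notin> V \<or> t \<notin> N" for t using b(4)[of t] that N(4) by (auto simp: \<delta>_def)
  have \<delta>: "\<delta> \<in> Cc" unfolding \<delta>_def using Cc_mult_left[OF b(1), of "\<lambda>_. 1 / (\<integral>t. b t \<partial>\<mu>)"] by simp
  have \<delta>1: "(\<integral>t. \<delta> t \<partial>\<mu>) = 1" using bpos by (simp add: \<delta>_def)
  note c\<delta> = continuous_on_UNIV_compose[OF CcD(1)[OF \<delta>]]
  define g where "g a s = vector_integral \<mu> (\<lambda>t. \<delta> t *\<^sub>R \<alpha> (- t) (a * f (t + s)))" for a s
  have kern: "continuous_on UNIV (\<lambda>p. \<delta> (snd p) *\<^sub>R \<alpha> (- snd p) (a * f (snd p + fst p)))" for a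
    by (intro continuous_on_scaleR c\<delta> continuous_alpha continuous_on_mult continuous_on_UNIV_compose[OF cf] continuous_on_pairs)
  have kz: "\<delta> t *\<^sub>R \<alpha> (- t) (a * f (t + s)) = 0" if "s \<notin> L \<union> N \<or> t \<notin> L \<union> N" for a s t
  proof (rule ccontr)
    assume "\<delta> t *\<^sub>R \<alpha> (- t) (a * f (t + s)) \<noteq> 0"
    then have "\<delta> t \<noteq> 0" "f (t + s) \<noteq> 0" by auto
    then have "t \<in> N" "t + s \<in> K" using \<delta>z K(2) by blast+
    then show False using L_mem that by blast
  qed
  have gCc: "g a \<in> Cc" for a
  proof -
    have "(\<lambda>s. vector_integral \<mu> (\<lambda>t. \<delta> (snd (s, t)) *\<^sub>R \<alpha> (- snd (s, t)) (a * f (snd (s, t) + fst (s, t))))) \<in> Cc"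
      by (rule Cc_parameter_integral[OF kern compact_Un[OF L N(2)]]) (use kz in simp)
    then show ?thesis by (simp add: g_def[abs_def])
  qed
  have kCc: "(\<lambda>t. \<delta> t *\<^sub>R \<alpha> (- t) (a * f (t + s))) \<in> Cc" for a s
  proof -
    have "(\<lambda>t. \<delta> (snd (s, t)) *\<^sub>R \<alpha> (- snd (s, t)) (a * f (snd (s, t) + fst (s, t)))) \<in> Cc"
      by (rule Cc_slice(1)[OF kern compact_Un[OF L N(2)]]) (use kz in simp)
    then show ?thesis by simp
  qed
  \<comment> \<open>g is additive in a, and for a = ip x y it is the inner product of \<delta> x
    with y f. Induction along the span thus reaches g e.\<close>
  have "Q (g a)" if "a \<in> X.ip_span" for a
    using that
  proof (induction rule: X.ip_span.induct)
    case zero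
    have "g 0 = (\<lambda>t. 0)"
      unfolding g_def using linear_vector_integral'[OF bounded_linear_zero kCc, where 'd = 'a] by simp
    then show ?case using Q0 by simp
  next
    case (add a x y)
    have x: "(\<lambda>t. \<delta> t *\<^sub>R x) \<in> Cc"
      by (rule Cc_compose[OF \<delta>, of "\<lambda>_ v. v *\<^sub>R x"]) (auto intro: continuous_on_scaleR continuous_on_const CcD(1)[OF \<delta>])
    have y: "(\<lambda>t. act y (f t)) \<in> Cc"
      by (rule Cc_compose[OF f, of "\<lambda>_. act y"])
         (auto intro: bounded_linear.continuous_on[OF X.bounded_linear_act] cf simp: linear_simps(3)[OF X.bounded_linear_act])
    have "cip (\<lambda>t. \<delta> t *\<^sub>R x) (\<lambda>t. act y (f t)) = g (ip x y)"
      by (rule ext) (simp add: crossed_product_ip_def g_def X.ip_scaleR_left X.ip_act_right alpha_scaleR)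
    then have "Q (g (ip x y))" using Qcip[OF x y] by simp
    moreover have "g (a + ip x y) s = g a s + g (ip x y) s" for s
      unfolding g_def vector_integral_add[OF kCc kCc, symmetric]
      by (simp add: distrib_right alpha_simps(1) scaleR_add_right)
    then have "g (a + ip x y) = (\<lambda>s. g a s + g (ip x y) s)" by (rule ext)
    ultimately show ?case using Qadd[OF gCc gCc add.IH] by simp
  qed
  then have "Q (g e)" using e(1) .
  moreover have "L1_norm \<mu> (\<lambda>t. f t - g e t) \<le> r * measure \<mu> L"
    unfolding L1_norm_def
  proof (rule integral_norm_le_const[OF Cc_diff[OF f gCc] L])
    fix s assume s: "s \<notin> L"
    have "(\<lambda>t. \<delta> t *\<^sub>R \<alpha> (- t) (e * f (t + s))) = (\<lambda>t. 0)"
    proof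
      fix t show "\<delta> t *\<^sub>R \<alpha> (- t) (e * f (t + s)) = 0"
      proof (rule ccontr)
        assume "\<delta> t *\<^sub>R \<alpha> (- t) (e * f (t + s)) \<noteq> 0"
        then have "\<delta> t \<noteq> 0" "f (t + s) \<noteq> 0" by auto
        then show False using \<delta>z K(2) L_mem s by blast
      qed
    qed
    then have "g e s = vector_integral \<mu> (\<lambda>t. 0)" by (simp add: g_def)
    also have "\<dots> = 0" using linear_vector_integral'[OF bounded_linear_zero kCc, where 'd = 'a] by simp
    finally show "f s - g e s = 0" using s K(2)[of s] by (auto simp: L_def)
  next
    fix s assume s: "s \<in> L"
    have d: "(\<lambda>t. \<delta> t *\<^sub>R f s) \<in> Cc"
      by (rule Cc_compose[OF \<delta>, of "\<lambda>_ v. v *\<^sub>R f s"]) (auto intro: continuous_on_scaleR continuous_on_const CcD(1)[OF \<delta>])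
    have "vector_integral \<mu> (\<lambda>t. \<delta> t *\<^sub>R f s) = f s"
      using linear_vector_integral'[OF bounded_linear_scaleR_left \<delta>, of "f s"] vector_integral_eq_integral[OF \<delta>] \<delta>1 by simp
    then have "f s - g e s = vector_integral \<mu> (\<lambda>t. \<delta> t *\<^sub>R f s - \<delta> t *\<^sub>R \<alpha> (- t) (e * f (t + s)))"
      by (simp add: g_def vector_integral_diff[OF d kCc])
    also have "norm \<dots> \<le> (\<integral>t. norm (\<delta> t *\<^sub>R f s - \<delta> t *\<^sub>R \<alpha> (- t) (e * f (t + s))) \<partial>\<mu>)"
      by (rule norm_vector_integral_le[OF Cc_diff[OF d kCc]])
    also have "\<dots> \<le> (\<integral>t. r * \<delta> t \<partial>\<mu>)"
    proof (rule integral_mono)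
      fix t
      have "norm (\<delta> t *\<^sub>R f s - \<delta> t *\<^sub>R \<alpha> (- t) (e * f (t + s))) = \<delta> t * norm (?H (t, s))"
        using \<delta>0[of t] by (simp flip: scaleR_diff_right)
      also have "\<dots> \<le> r * \<delta> t"
      proof (cases "t \<in> V")
        case True
        then show ?thesis using mult_left_mono[OF HV[OF True s] \<delta>0[of t]] by (simp add: mult.commute)
      qed (simp add: \<delta>z)
      finally show "norm (\<delta> t *\<^sub>R f s - \<delta> t *\<^sub>R \<alpha> (- t) (e * f (t + s))) \<le> r * \<delta> t" .
    qed (intro integrable_Cc Cc_norm Cc_diff d kCc integrable_mult_right \<delta>)+
    also have "\<dots> = r" using \<delta>1 by simp
    finally show "norm (f s - g e s) \<le> r" .
  qed
  ultimately show ?thesis using gCc rm by (intro bexI[of _ "g e"]) auto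
qed

section \<open>The map on the crossed product\<close>

text \<open>Existence of an associated map is contained in
  \<open>completely_positive_module_map\<close>; the last clause identifies every such map, so it
  includes the uniqueness question for the crossed product module.\<close>

lemma crossed_product_map:
  fixes \<iota> :: "('g \<Rightarrow> 'a) \<Rightarrow> 'c::cstar_algebra"
    and actY :: "'y::{complex_normed_vector, complete_space} \<Rightarrow> 'c \<Rightarrow> 'y"
  assumes CA: "crossed_product_algebra \<mu> \<alpha> \<iota>"
    and CM: "crossed_product_module \<mu> \<alpha> act ip \<iota> actY ipY \<kappa>"
  shows "\<exists>\<Phi>h :: 'y \<Rightarrow> 'h \<Rightarrow> 'k.
    completely_positive_module_map ipY \<Phi>h \<and>
    (\<forall>x\<in>Cc. has_strong_integral \<mu> (\<lambda>t. \<Phi> (x t) \<circ> u t) (\<Phi>h (\<kappa> x))) \<and>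
    (\<forall>\<phi>h. associated_cp ipY \<Phi>h \<phi>h \<longrightarrow>
      (\<forall>f\<in>Cc. has_strong_integral \<mu> (\<lambda>t. \<phi> (f t) \<circ> u t) (\<phi>h (\<iota> f))))"
proof -
  interpret Y: hilbert_module actY ipY using CM by (simp add: crossed_product_module_def)
  have iota: "\<And>f g. f \<in> Cc \<Longrightarrow> g \<in> Cc \<Longrightarrow> \<iota> (\<lambda>t. f t + g t) = \<iota> f + \<iota> g" "\<And>c f. f \<in> Cc \<Longrightarrow> \<iota> (\<lambda>t. c *\<^sub>C f t) = c *\<^sub>C \<iota> f"
    "\<And>f g. f \<in> Cc \<Longrightarrow> g \<in> Cc \<Longrightarrow> \<iota> (convolution \<mu> \<alpha> f g) = \<iota> f * \<iota> g" "\<And>f. f \<in> Cc \<Longrightarrow> \<iota> (involution \<mu> \<alpha> f) = star (\<iota> f)"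
    "\<And>f. f \<in> Cc \<Longrightarrow> norm (\<iota> f) = universal_norm \<mu> \<alpha> f" "closure (\<iota> ` Cc) = UNIV"
    using CA by (simp_all add: crossed_product_algebra_def)
  have kappa: "\<And>x y. x \<in> Cc \<Longrightarrow> y \<in> Cc \<Longrightarrow> \<kappa> (\<lambda>t. x t + y t) = \<kappa> x + \<kappa> y" "\<And>c x. x \<in> Cc \<Longrightarrow> \<kappa> (\<lambda>t. c *\<^sub>C x t) = c *\<^sub>C \<kappa> x"
    "\<And>x y. x \<in> Cc \<Longrightarrow> y \<in> Cc \<Longrightarrow> ipY (\<kappa> x) (\<kappa> y) = \<iota> (cip x y)" "closure (\<kappa> ` Cc) = UNIV"
    using CM by (simp_all add: crossed_product_module_def)
  obtain B where B: "B \<ge> 0" "\<And>f h. f \<in> Cc \<Longrightarrow> norm (phihat f h) \<le> B * norm (\<iota> f) * norm h"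
    using phihat_bounded_ex iota(5) by auto
  have Phihat_le: "norm (Phihat x h) \<le> sqrt B * norm (\<kappa> x) * norm h" if x: "x \<in> Cc" for x h
  proof (rule power2_le_imp_le)
    have "complex_of_real ((norm (Phihat x h))\<^sup>2) = cinner h (phihat (cip x x) h)"
      unfolding cinner_self[symmetric] by (rule Phihat_ip[OF x x])
    then have "(norm (Phihat x h))\<^sup>2 = Re (cinner h (phihat (cip x x) h))" by (metis Re_complex_of_real)
    also have "\<dots> \<le> norm h * norm (phihat (cip x x) h)" by (rule Re_cinner_le)
    also have "\<dots> \<le> norm h * (B * norm (\<iota> (cip x x)) * norm h)" by (intro mult_left_mono B(2) cip_Cc x) simp
    also have "\<dots> = (sqrt B * norm (\<kappa> x) * norm h)\<^sup>2"
      using B(1) by (simp add: Y.norm_ip_self power_mult_distrib power2_eq_square flip: kappa(3)[OF x x])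
    finally show "(norm (Phihat x h))\<^sup>2 \<le> (sqrt B * norm (\<kappa> x) * norm h)\<^sup>2" .
  qed (use B(1) in simp)
  obtain S where S: "\<And>f h. f \<in> Cc \<Longrightarrow> S (\<iota> f) h = phihat f h" "\<And>a b h. S (a + b) h = S a h + S b h"
    "\<And>c a h. S (c *\<^sub>C a) h = c *\<^sub>C S a h" "\<And>a. bounded_clinear (S a)" "\<And>a h. norm (S a h) \<le> B * norm a * norm h"
    using dense_extension[of \<iota> phihat B, OF Cc_add Cc_scaleC iota(1,2,6) phihat_linear B(2,1)] by metis
  obtain P where P: "\<And>x h. x \<in> Cc \<Longrightarrow> P (\<kappa> x) h = Phihat x h" "\<And>a b h. P (a + b) h = P a h + P b h"
    "\<And>c a h. P (c *\<^sub>C a) h = c *\<^sub>C P a h" "\<And>a. bounded_clinear (P a)" "\<And>a h. norm (P a h) \<le> sqrt B * norm a * norm h"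
    using dense_extension[of \<kappa> Phihat "sqrt B", OF Cc_add Cc_scaleC kappa(1,2,4) Phihat_linear Phihat_le] B(1)
    by (metis real_sqrt_ge_zero)
  have bS: "bounded_bilinear S"
  proof (rule bounded_bilinear.intro)
    have "norm (S a h) \<le> norm a * norm h * B" for a h using S(5)[of a h] by (simp add: mult_ac)
    then show "\<exists>K. \<forall>a h. norm (S a h) \<le> norm a * norm h * K" by blast
  qed (simp_all add: S(2,3) bounded_clinearD[OF S(4)] scaleR_scaleC)
  have bP: "bounded_bilinear P"
  proof (rule bounded_bilinear.intro)
    have "norm (P a h) \<le> norm a * norm h * sqrt B" for a h using P(5)[of a h] by (simp add: mult_ac)
    then show "\<exists>K. \<forall>a h. norm (P a h) \<le> norm a * norm h * K" by blast
  qed (simp_all add: P(2,3) bounded_clinearD[OF P(4)] scaleR_scaleC)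
  have seq_c: "\<exists>f. (\<forall>m. f m \<in> Cc) \<and> (\<lambda>m. \<iota> (f m)) \<longlonglongrightarrow> b" for b
  proof -
    have "b \<in> closure (\<iota> ` Cc)" by (simp add: iota(6))
    then obtain x where "\<forall>m. x m \<in> \<iota> ` Cc" "x \<longlonglongrightarrow> b" unfolding closure_sequential by blast
    then show ?thesis
      by (intro exI[of _ "\<lambda>m. inv_into Cc \<iota> (x m)"]) (simp add: inv_into_into f_inv_into_f)
  qed
  have seq_y: "\<exists>f. (\<forall>m. f m \<in> Cc) \<and> (\<lambda>m. \<kappa> (f m)) \<longlonglongrightarrow> b" for b
  proof -
    have "b \<in> closure (\<kappa> ` Cc)" by (simp add: kappa(4))
    then obtain x where "\<forall>m. x m \<in> \<kappa> ` Cc" "x \<longlonglongrightarrow> b" unfolding closure_sequential by blast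
    then show ?thesis
      by (intro exI[of _ "\<lambda>m. inv_into Cc \<kappa> (x m)"]) (simp add: inv_into_into f_inv_into_f)
  qed
  \<comment> \<open>Positivity holds for functions by \<open>phihat_positive\<close> and passes to
    limits in each b i, the nonnegative reals being closed.\<close>
  have row: "(\<Sum>i<n. \<Sum>j<n. cinner (h i) (S (star (b i) * b j) (h j))) \<in> \<real>\<^sub>\<ge>\<^sub>0" for n :: nat and b h
  proof -
    have "\<forall>i. \<exists>f. (\<forall>m. f m \<in> Cc) \<and> (\<lambda>m. \<iota> (f m)) \<longlonglongrightarrow> b i" using seq_c by blast
    then obtain f where f: "\<And>i m. f i m \<in> Cc" "\<And>i. (\<lambda>m. \<iota> (f i m)) \<longlonglongrightarrow> b i" by metis
    let ?s = "\<lambda>m. \<Sum>i<n. \<Sum>j<n. cinner (h i) (S (star (\<iota> (f i m)) * \<iota> (f j m)) (h j))"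
    have "S (star (\<iota> (f i m)) * \<iota> (f j m)) k = phihat (convolution \<mu> \<alpha> (involution \<mu> \<alpha> (f i m)) (f j m)) k" for i j m k
      using f(1) by (simp add: involution_Cc convolution_Cc flip: iota(3,4) S(1))
    then have pos: "?s m \<in> \<real>\<^sub>\<ge>\<^sub>0" for m using phihat_positive[of n "\<lambda>i. f i m" h] f(1) by simp
    have lim: "?s \<longlonglongrightarrow> (\<Sum>i<n. \<Sum>j<n. cinner (h i) (S (star (b i) * b j) (h j)))"
      by (intro tendsto_sum tendsto_cinner tendsto_const bounded_bilinear.tendsto[OF bS] tendsto_mult tendsto_star f(2))
    show ?thesis by (rule closed_sequentially[OF closed_nonneg_Reals_complex pos lim])
  qed
  have cpS: "completely_positive S"
    unfolding completely_positive_def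
  proof (intro conjI allI impI)
    fix n M assume "positive_matrix n (M :: nat \<Rightarrow> nat \<Rightarrow> 'c)"
    then obtain b where b: "\<And>i j. i < n \<Longrightarrow> j < n \<Longrightarrow> M i j = (\<Sum>k<n. star (b k i) * b k j)"
      unfolding positive_matrix_def by blast
    have sumS: "S (sum q K) h = (\<Sum>k\<in>K. S (q k) h)" for q and K :: "nat set" and h
      using bounded_linear.linear[OF bounded_bilinear.bounded_linear_left[OF bS, of h]] by (rule linear_sum)
    show "positive_op_matrix n (\<lambda>i j. S (M i j))"
      unfolding positive_op_matrix_def
    proof
      \<comment> \<open>The matrix is a sum over k of row matrices, one for each row of b.\<close>
      fix h :: "nat \<Rightarrow> 'h"
      have "(\<Sum>i<n. \<Sum>j<n. cinner (h i) (S (M i j) (h j))) =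
          (\<Sum>i<n. \<Sum>j<n. \<Sum>k<n. cinner (h i) (S (star (b k i) * b k j) (h j)))"
        by (intro sum.cong refl) (simp add: b sumS cinner_sum_right)
      also have "\<dots> = (\<Sum>i<n. \<Sum>k<n. \<Sum>j<n. cinner (h i) (S (star (b k i) * b k j) (h j)))"
        by (intro sum.cong refl sum.swap)
      also have "\<dots> = (\<Sum>k<n. \<Sum>i<n. \<Sum>j<n. cinner (h i) (S (star (b k i) * b k j) (h j)))"
        by (rule sum.swap)
      also have "\<dots> \<in> \<real>\<^sub>\<ge>\<^sub>0"
        using row[of h _ n] by (simp add: complex_nonneg_Reals_iff sum_nonneg)
      finally show "(\<Sum>i<n. \<Sum>j<n. cinner (h i) (S (M i j) (h j))) \<in> \<real>\<^sub>\<ge>\<^sub>0" .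
    qed
  qed (simp_all add: S(2,3,4))
  have PS: "cinner (P y z) (P y' h) = cinner z (S (ipY y y') h)" for y y' z h
  proof -
    obtain f where f: "\<And>m. f m \<in> Cc" "(\<lambda>m. \<kappa> (f m)) \<longlonglongrightarrow> y" using seq_y[of y] by blast
    obtain g where g: "\<And>m. g m \<in> Cc" "(\<lambda>m. \<kappa> (g m)) \<longlonglongrightarrow> y'" using seq_y[of y'] by blast
    have "cinner (P (\<kappa> (f m)) z) (P (\<kappa> (g m)) h) = cinner z (S (ipY (\<kappa> (f m)) (\<kappa> (g m))) h)" for m
      using f(1) g(1) by (simp add: P(1) kappa(3) S(1) cip_Cc Phihat_ip)
    moreover have "(\<lambda>m. cinner (P (\<kappa> (f m)) z) (P (\<kappa> (g m)) h)) \<longlonglongrightarrow> cinner (P y z) (P y' h)"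
      by (intro tendsto_cinner bounded_bilinear.tendsto[OF bP] tendsto_const f(2) g(2))
    moreover have "(\<lambda>m. cinner z (S (ipY (\<kappa> (f m)) (\<kappa> (g m))) h)) \<longlonglongrightarrow> cinner z (S (ipY y y') h)"
      by (intro tendsto_cinner bounded_bilinear.tendsto[OF bS] Y.tendsto_ip tendsto_const f(2) g(2))
    ultimately show ?thesis using LIMSEQ_unique by simp
  qed
  have adj: "adjoint_op (P y) (P y' h) = S (ipY y y') h" for y y' h
  proof (rule cinner_extI)
    fix z
    have "cinner z (adjoint_op (P y) (P y' h)) = cnj (cinner (P y' h) (P y z))"
      by (metis adjoint_op[OF P(4)] cinner_commute)
    then show "cinner z (adjoint_op (P y) (P y' h)) = cinner z (S (ipY y y') h)"
      by (metis PS cinner_commute)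
  qed
  have "associated_cp ipY P S"
    unfolding associated_cp_def using cpS adj by (auto simp: fun_eq_iff)
  then have "completely_positive_module_map ipY P"
    unfolding completely_positive_module_map_def using P(4) by blast
  moreover have "has_strong_integral \<mu> (\<lambda>t. \<Phi> (x t) \<circ> u t) (P (\<kappa> x))" if "x \<in> Cc" for x
    unfolding has_strong_integral_def
    using has_vector_integral_Cc[OF Phihat_Cc[OF that]] by (simp add: P(1)[OF that] Phihat_def)
  moreover have "has_strong_integral \<mu> (\<lambda>t. \<phi> (f t) \<circ> u t) (S' (\<iota> f))"
    if S': "associated_cp ipY P S'" and f: "f \<in> Cc" for S' f
  proof -
    interpret S: cp_map S by unfold_locales (rule cpS)
    interpret S': cp_map S' by unfold_locales (use S' in \<open>simp add: associated_cp_def\<close>)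
    have agree: "S' (ipY y y') h = S (ipY y y') h" for y y' h
    proof -
      have "adjoint_op (P y) \<circ> P y' = S' (ipY y y')" using S' by (simp add: associated_cp_def)
      from fun_cong[OF this, of h] show ?thesis by (simp add: adj)
    qed
    \<comment> \<open>Complete positivity alone makes S' bounded, so agreement on a dense set is
      enough.\<close>
    obtain M where M: "M \<ge> 0" "\<And>a h. norm (S' a h) \<le> M * norm a * norm h" using S'.bounded_ex by blast
    have "S' (\<iota> f) h = S (\<iota> f) h" for h
    proof -
      have "norm (S' (\<iota> f) h - S (\<iota> f) h) \<le> 0"
      proof (rule field_le_epsilon)
        fix \<epsilon> :: real assume \<epsilon>: "\<epsilon> > 0"
        define c where "c = (M + B) * norm h + 1"
        have c: "c > 0" using M(1) B(1) by (simp add: c_def add_nonneg_pos)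
        \<comment> \<open>Agreement of S' and S at \<iota> g is additive in g and holds for inner
          products. The approximation is in the L1 norm, which dominates the universal norm.\<close>
        have "\<exists>g\<in>Cc. (\<forall>k. S' (\<iota> g) k = S (\<iota> g) k) \<and> L1_norm \<mu> (\<lambda>t. f t - g t) \<le> \<epsilon> / c"
        proof (rule cip_dense[OF f])
          show "\<forall>k. S' (\<iota> (\<lambda>t. 0)) k = S (\<iota> (\<lambda>t. 0)) k"
            using iota(2)[OF f, of 0] by (simp add: S.zero S'.zero)
          show "\<forall>k. S' (\<iota> (cip x y)) k = S (\<iota> (cip x y)) k" if "x \<in> Cc" "y \<in> Cc" for x y
            using agree by (simp flip: kappa(3)[OF that])
        qed (use \<epsilon> c in \<open>simp_all add: iota(1) S.add S'.add\<close>)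
        then obtain g where g: "g \<in> Cc" "\<And>k. S' (\<iota> g) k = S (\<iota> g) k" "L1_norm \<mu> (\<lambda>t. f t - g t) \<le> \<epsilon> / c"
          by blast
        have fg: "(\<lambda>t. f t - g t) \<in> Cc" by (rule Cc_diff[OF f g(1)])
        have "\<iota> f = \<iota> (\<lambda>t. (f t - g t) + g t)" by simp
        also have "\<dots> = \<iota> (\<lambda>t. f t - g t) + \<iota> g" by (rule iota(1)[OF fg g(1)])
        finally have split: "\<iota> f = \<iota> (\<lambda>t. f t - g t) + \<iota> g" .
        define d where "d = \<iota> (\<lambda>t. f t - g t)"
        have nd: "norm d \<le> \<epsilon> / c"
          unfolding d_def iota(5)[OF fg] using universal_norm_bounds(2)[OF fg] g(3) by linarith
        have "S' (\<iota> f) h - S (\<iota> f) h = S' d h - S d h"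
          unfolding split d_def S.add S'.add g(2) by simp
        also have "norm \<dots> \<le> M * norm d * norm h + B * norm d * norm h"
          using norm_triangle_ineq4[of "S' d h" "S d h"] M(2)[of d h] S(5)[of d h] by linarith
        also have "\<dots> = norm d * ((M + B) * norm h)" by (simp add: algebra_simps)
        also have "\<dots> \<le> \<epsilon> / c * c"
          using nd M(1) B(1) c \<epsilon> by (intro mult_mono) (auto simp: c_def)
        finally show "norm (S' (\<iota> f) h - S (\<iota> f) h) \<le> 0 + \<epsilon>" using c by simp
      qed
      then show ?thesis by simp
    qed
    then show ?thesis
      unfolding has_strong_integral_def
      using has_vector_integral_Cc[OF phihat_Cc[OF f]] by (simp add: S(1)[OF f] phihat_def)
  qed
  ultimately show ?thesis by blast
qed

end

section \<open>Covariance of the associated map and conclusion\<close>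

lemma associated_cp_cinner:
  assumes "associated_cp ip \<Phi> \<phi>" "\<And>x. bounded_clinear (\<Phi> x)"
  shows "cinner (\<Phi> x h) (\<Phi> y k) = cinner h (\<phi> (ip x y) k)"
proof -
  have "adjoint_op (\<Phi> x) (\<Phi> y k) = \<phi> (ip x y) k"
    using assms(1) unfolding associated_cp_def by (metis comp_apply)
  then show ?thesis using adjoint_op[OF assms(2), of x "\<Phi> y k" h] by (metis cinner_commute)
qed

text \<open>Covariance of \<open>\<Phi>\<close> determines \<open>\<phi> (\<alpha>\<^sub>t a)\<close> for inner products \<open>a\<close>, and these span a dense subspace.\<close>

lemma (in hilbert_module) covariant_associated_cp:
  assumes full: "full_module ip" and ind: "induced_action ip \<eta> \<alpha>"
    and u: "unitary_representation u" and u': "unitary_representation u'"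
    and Phi: "\<And>x. bounded_clinear (\<Phi> x)" and cov: "covariant_map u' u \<eta> \<Phi>" and as: "associated_cp ip \<Phi> \<phi>"
  shows "\<phi> (\<alpha> t a) (u t h) = u t (\<phi> a h)"
proof -
  interpret u: unitary_rep u by unfold_locales (rule u)
  interpret u': unitary_rep u' by unfold_locales (rule u')
  interpret cp_map \<phi> by unfold_locales (use as in \<open>simp add: associated_cp_def\<close>)
  note Phi_ip = associated_cp_cinner[OF as Phi] and phi_zero = zero and phi_add = add
  have alpha: "\<alpha> t (a + b) = \<alpha> t a + \<alpha> t b" "\<alpha> t (c *\<^sub>C a) = c *\<^sub>C \<alpha> t a" "\<alpha> t (ip x y) = ip (\<eta> t x) (\<eta> t y)"
    "continuous_on UNIV (\<lambda>(t, a). \<alpha> t a)" for a b c x y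
    using ind by (auto simp: induced_action_def algebra_action_def star_homomorphism_def)
  have Phi_eta: "\<Phi> (\<eta> t x) h = u' t (\<Phi> x (u (- t) h))" for x h
    using cov by (simp add: covariant_map_def u.adjoint)
  \<comment> \<open>Tested against k, the left side is an inner product of values of \<Phi> at
    \<eta>_t x and \<eta>_t y, where the unitary u'_t occurs on both sides and cancels.\<close>
  have gen: "\<phi> (\<alpha> t (ip x y)) (u t h) = u t (\<phi> (ip x y) h)" for x y
  proof (rule cinner_extI)
    fix k
    have "cinner k (\<phi> (\<alpha> t (ip x y)) (u t h)) = cinner (\<Phi> (\<eta> t x) k) (\<Phi> (\<eta> t y) (u t h))"
      by (simp add: alpha(3) Phi_ip)
    also have "\<dots> = cinner (\<Phi> x (u (- t) k)) (\<Phi> y h)" by (simp add: Phi_eta u'.cinner_eq)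
    also have "\<dots> = cinner (u (- t) k) (\<phi> (ip x y) h)" by (rule Phi_ip)
    also have "\<dots> = cinner k (u t (\<phi> (ip x y) h))" by (simp add: u.cinner_left)
    finally show "cinner k (\<phi> (\<alpha> t (ip x y)) (u t h)) = cinner k (u t (\<phi> (ip x y) h))" .
  qed
  have span: "\<phi> (\<alpha> t s) (u t h) = u t (\<phi> s h)" if "s \<in> ip_span" for s
    using that
  proof (induction rule: ip_span.induct)
    case zero
    have "\<alpha> t 0 = 0" using alpha(2)[of 0 0] by simp
    then show ?case by (simp add: phi_zero u.apply_simps)
  qed (simp add: alpha(1) phi_add u.apply_simps gen)
  have ca: "continuous_on UNIV (\<lambda>a. \<alpha> t a)"
  proof -
    have "continuous_on UNIV (\<lambda>a. (\<lambda>(t, a). \<alpha> t a) (t, a))"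
      by (rule continuous_on_compose2[OF alpha(4)]) (auto intro: continuous_on_Pair continuous_on_const continuous_on_id)
    then show ?thesis by simp
  qed
  have "closed {a. \<phi> (\<alpha> t a) (u t h) = u t (\<phi> a h)}"
    by (intro closed_Collect_eq continuous_on_apply ca u.continuous_apply continuous_on_const continuous_on_id)
  then have "closure ip_span \<subseteq> {a. \<phi> (\<alpha> t a) (u t h) = u t (\<phi> a h)}"
    using span by (intro closure_minimal) auto
  then show ?thesis using ip_span_dense[OF full] by blast
qed

theorem proposition4p2:
  fixes \<mu> :: "'g::{topological_group_add, t2_space} measure"
    and act :: "'x::{complex_normed_vector, complete_space} \<Rightarrow> 'a::cstar_algebra \<Rightarrow> 'x"
    and ip :: "'x \<Rightarrow> 'x \<Rightarrow> 'a"
    and \<eta> :: "'g \<Rightarrow> 'x \<Rightarrow> 'x"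
    and \<alpha> :: "'g \<Rightarrow> 'a \<Rightarrow> 'a"
    and u :: "'g \<Rightarrow> 'h::chilbert_space \<Rightarrow> 'h"
    and u' :: "'g \<Rightarrow> 'k::chilbert_space \<Rightarrow> 'k"
    and \<Phi> :: "'x \<Rightarrow> 'h \<Rightarrow> 'k"
    and \<phi> :: "'a \<Rightarrow> 'h \<Rightarrow> 'h"
    and \<iota> :: "('g \<Rightarrow> 'a) \<Rightarrow> 'c::cstar_algebra"
    and actY :: "'y::{complex_normed_vector, complete_space} \<Rightarrow> 'c \<Rightarrow> 'y"
    and ipY :: "'y \<Rightarrow> 'y \<Rightarrow> 'c"
    and \<kappa> :: "('g \<Rightarrow> 'x) \<Rightarrow> 'y"
  assumes "locally_compact_space (euclidean :: 'g topology)"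
    and "left_haar_measure \<mu>"
    and "hilbert_module act ip" and "full_module ip"
    and "module_action ip \<eta>" and "induced_action ip \<eta> \<alpha>"
    and "unitary_representation u" and "unitary_representation u'"
    and "completely_positive_module_map ip \<Phi>" and "covariant_map u' u \<eta> \<Phi>"
    and "associated_cp ip \<Phi> \<phi>"
    and "crossed_product_algebra \<mu> \<alpha> \<iota>"
    and "crossed_product_module \<mu> \<alpha> act ip \<iota> actY ipY \<kappa>"
  shows "\<exists>\<Phi>h :: 'y \<Rightarrow> 'h \<Rightarrow> 'k.
    completely_positive_module_map ipY \<Phi>h \<and>
    (\<forall>x\<in>Cc. has_strong_integral \<mu> (\<lambda>t. \<Phi> (x t) \<circ> u t) (\<Phi>h (\<kappa> x))) \<and>
    (\<forall>\<phi>h. associated_cp ipY \<Phi>h \<phi>h \<longrightarrow>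
      (\<forall>f\<in>Cc. has_strong_integral \<mu> (\<lambda>t. \<phi> (f t) \<circ> u t) (\<phi>h (\<iota> f))))"
proof -
  have Phi: "bounded_clinear (\<Phi> x)" for x using assms(9) by (simp add: completely_positive_module_map_def)
  interpret X: hilbert_module act ip by fact
  interpret covariant_module_map \<mu> \<phi> u \<alpha> act ip \<Phi>
  proof unfold_locales
    show "completely_positive \<phi>" using assms(11) by (simp add: associated_cp_def)
    show "algebra_action \<alpha>" using assms(6) by (simp add: induced_action_def)
    show "\<phi> (\<alpha> t a) (u t h) = u t (\<phi> a h)" for t a h
      by (rule X.covariant_associated_cp[OF assms(4,6,7,8) Phi assms(10,11)])
    show "cinner (\<Phi> x h) (\<Phi> y k) = cinner h (\<phi> (ip x y) k)" for x h y k
      by (rule associated_cp_cinner[OF assms(11) Phi])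
  qed (fact assms Phi)+
  show ?thesis by (rule crossed_product_map[OF assms(12,13)])
qed

end
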